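(* Let $\alpha\in(0,1)$ and $K\geq 1$, and let $d=2\,\frac{1+\alpha K}{1+K}$. Then there exists a compact set $E\subset\mathbb{C}$ with $0<\mathcal{H}^d(E)<\infty$ which is nonremovable for $\alpha$-Hölder continuous $K$-quasiregular mappings; that is, there exists a function $f\in\mathrm{Lip}_\alpha(\mathbb{C})$ which is $K$-quasiregular in $\mathbb{C}\setminus E$ but which is not $K$-quasiregular on $\mathbb{C}$.
   Context: $\mathcal{H}^d$ denotes $d$-dimensional Hausdorff measure in the plane. A function $f:\mathbb{C}\to\mathbb{C}$ belongs to $\mathrm{Lip}_\alpha(\mathbb{C})$ (is locally $\alpha$-Hölder continuous) if there is a constant $C$ such that $|f(z)-f(w)|\leq C|z-w|^\alpha$ whenever $z,w\in\mathbb{C}$, $|z-w|<1$. Given an open set $\Omega\subset\mathbb{C}$ and $K\geq 1$, a mapping $f:\Omega\to\mathbb{C}$ is $K$-quasiregular in $\Omega$ if $f\in W^{1,2}_{loc}(\Omega)$ and $\overline\partial f(z)=\mu(z)\,\partial f(z)$ for almost every $z\in\Omega$, for some measurable function $\mu$ with $|\mu(z)|\leq\frac{K-1}{K+1}$ for almost every $z\in\Omega$. A set $E\subset\mathbb{C}$ is removable for $\alpha$-Hölder continuous $K$-quasiregular mappings if every $f\in\mathrm{Lip}_\alpha(\mathbb{C})$ that is $K$-quasiregular in $\mathbb{C}\setminus E$ is $K$-quasiregular on the whole plane; otherwise it is nonremovable. *)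

theory Defs
  imports "HOL-Analysis.Analysis"
begin

section \<open>Hausdorff measure\<close>

text \<open>The usual unnormalised convention (no volume-of-the-ball factor); the normalisation plays no
  role for positivity and finiteness. The boundedness condition is needed because the library's
  \<open>diameter\<close> is unspecified on unbounded sets. The definition is meant for \<open>d > 0\<close>: since
  \<open>0 powr 0 = 0\<close>, it is not counting measure for \<open>d = 0\<close>.\<close>

definition hausdorff_premeasure :: "real \<Rightarrow> real \<Rightarrow> 'a::metric_space set \<Rightarrow> ennreal" where
  "hausdorff_premeasure d \<delta> A =
     (INF U \<in> {U :: nat \<Rightarrow> 'a set.
                A \<subseteq> (\<Union>i. U i) \<and> (\<forall>i. bounded (U i) \<and> diameter (U i) \<le> \<delta>)}.
        \<Sum>i. ennreal (diameter (U i) powr d))"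

definition hausdorff_measure :: "real \<Rightarrow> 'a::metric_space set \<Rightarrow> ennreal" where
  "hausdorff_measure d A = (SUP \<delta> \<in> {0<..}. hausdorff_premeasure d \<delta> A)"

section \<open>Hoelder continuity\<close>

definition Lip :: "real \<Rightarrow> (complex \<Rightarrow> complex) \<Rightarrow> bool" where
  "Lip \<alpha> f \<longleftrightarrow>
     (\<exists>C. \<forall>z w. norm (z - w) < 1 \<longrightarrow> norm (f z - f w) \<le> C * norm (z - w) powr \<alpha>)"

section \<open>Sobolev functions\<close>

definition locally_Lp :: "nat \<Rightarrow> complex set \<Rightarrow> (complex \<Rightarrow> complex) \<Rightarrow> bool" where
  "locally_Lp p \<Omega> f \<longleftrightarrow>
     set_borel_measurable lebesgue \<Omega> f \<and>
     (\<forall>L. compact L \<and> L \<subseteq> \<Omega> \<longrightarrow> set_integrable lebesgue L (\<lambda>z. norm (f z) ^ p))"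

text \<open>In finite dimension a differentiable function is of class \<open>C^(k+1)\<close> iff all of its
  directional derivatives are of class \<open>C^k\<close>. Differentiability is over the reals throughout.\<close>

primrec C_k :: "nat \<Rightarrow> (complex \<Rightarrow> real) \<Rightarrow> bool" where
  "C_k 0 \<phi> \<longleftrightarrow> continuous_on UNIV \<phi>"
| "C_k (Suc k) \<phi> \<longleftrightarrow>
     (\<forall>z. \<phi> differentiable (at z)) \<and> (\<forall>v. C_k k (\<lambda>z. frechet_derivative \<phi> (at z) v))"

definition test_function :: "complex set \<Rightarrow> (complex \<Rightarrow> real) \<Rightarrow> bool" where
  "test_function \<Omega> \<phi> \<longleftrightarrow>
     (\<forall>k. C_k k \<phi>) \<and> compact (closure {z. \<phi> z \<noteq> 0}) \<and> closure {z. \<phi> z \<noteq> 0} \<subseteq> \<Omega>"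

text \<open>\<open>g\<close> is the weak (distributional) derivative of \<open>f\<close> in the direction \<open>v\<close>; the directions
  \<open>1\<close> and \<open>\<i>\<close> give the partial derivatives with respect to the real coordinates \<open>x\<close> and \<open>y\<close>.\<close>

definition weak_derivative ::
    "complex set \<Rightarrow> complex \<Rightarrow> (complex \<Rightarrow> complex) \<Rightarrow> (complex \<Rightarrow> complex) \<Rightarrow> bool" where
  "weak_derivative \<Omega> v f g \<longleftrightarrow>
     locally_Lp 1 \<Omega> f \<and> locally_Lp 1 \<Omega> g \<and>
     (\<forall>\<phi>. test_function \<Omega> \<phi> \<longrightarrow>
        (LINT z:\<Omega>|lebesgue. frechet_derivative \<phi> (at z) v *\<^sub>R f z) =
        - (LINT z:\<Omega>|lebesgue. \<phi> z *\<^sub>R g z))"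

definition W12_loc :: "complex set \<Rightarrow> (complex \<Rightarrow> complex) \<Rightarrow> bool" where
  "W12_loc \<Omega> f \<longleftrightarrow>
     locally_Lp 2 \<Omega> f \<and>
     (\<forall>v\<in>{1, \<i>}. \<exists>g. weak_derivative \<Omega> v f g \<and> locally_Lp 2 \<Omega> g)"

section \<open>Quasiregular mappings and removability\<close>

text \<open>\<open>wirtinger p q\<close> and \<open>wirtinger_bar p q\<close> are the complex derivatives
  \<open>\<partial>f = (f_x - \<i> f_y) / 2\<close> and its conjugate counterpart \<open>(f_x + \<i> f_y) / 2\<close>,
  where \<open>p = f_x\<close> and \<open>q = f_y\<close>.\<close>

definition wirtinger :: "complex \<Rightarrow> complex \<Rightarrow> complex" where
  "wirtinger p q = (p - \<i> * q) / 2"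

definition wirtinger_bar :: "complex \<Rightarrow> complex \<Rightarrow> complex" where
  "wirtinger_bar p q = (p + \<i> * q) / 2"

text \<open>For open \<open>\<Omega>\<close> and \<open>K \<ge> 1\<close>. The weak partial derivatives \<open>p\<close>, \<open>q\<close> are unique up to
  null sets, so that the existential quantifier over them makes no choice.\<close>

definition quasiregular :: "real \<Rightarrow> complex set \<Rightarrow> (complex \<Rightarrow> complex) \<Rightarrow> bool" where
  "quasiregular K \<Omega> f \<longleftrightarrow>
     W12_loc \<Omega> f \<and>
     (\<exists>p q \<mu>. weak_derivative \<Omega> 1 f p \<and> weak_derivative \<Omega> \<i> f q \<and>
        set_borel_measurable lebesgue \<Omega> \<mu> \<and>
        (AE z in lebesgue. z \<in> \<Omega> \<longrightarrow> norm (\<mu> z) \<le> (K - 1) / (K + 1)) \<and>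
        (AE z in lebesgue. z \<in> \<Omega> \<longrightarrow>
           wirtinger_bar (p z) (q z) = \<mu> z * wirtinger (p z) (q z)))"

definition removable :: "real \<Rightarrow> real \<Rightarrow> complex set \<Rightarrow> bool" where
  "removable \<alpha> K E \<longleftrightarrow>
     (\<forall>f. Lip \<alpha> f \<and> quasiregular K (- E) f \<longrightarrow> quasiregular K UNIV f)"

end

theory Submission
  imports Defs "HOL-Complex_Analysis.Complex_Analysis"
begin

text \<open>Pack the unit disc by finitely many small discs covering almost all of its area. Inside a disc
  of radius \<open>R\<close> place a concentric disc of radius \<open>R powr (1 + \<kappa>)\<close> in the target plane and one of radius
  \<open>R powr (1 + K * \<kappa>)\<close> in the source plane, where \<open>\<kappa> = (1 - \<alpha>) / (1 + \<alpha> * K)\<close>. The radial stretching that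
  matches the two is exactly \<open>K\<close>-quasiconformal, and both small discs contribute \<open>R\<^sup>2\<close> to the Hausdorff
  content of dimension \<open>2 / (1 + \<kappa>)\<close> and \<open>2 / (1 + K * \<kappa>) = d\<close>, respectively. Iterating with packings whose
  area defects are summable therefore gives Cantor sets of positive finite measure in these dimensions,
  the one in the source being \<open>E\<close>, and a map of the plane carrying \<open>E\<close> to the other one.

  The Cauchy transform of the natural mass distribution on the target set is Hoelder continuous with
  exponent \<open>2 / (1 + \<kappa>) - 1\<close>, the map with exponent \<open>(1 + \<kappa>) / (1 + K * \<kappa>)\<close>, and the product of these
  exponents is \<open>\<alpha>\<close>. Their composition is \<open>K\<close>-quasiregular off \<open>E\<close>. However, the discs of each single
  generation carry an energy of at least \<open>\<pi>\<close>, computed from any square integrable weak gradient, while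
  these discs shrink to the null set \<open>E\<close>; hence there is no such gradient.\<close>

section \<open>Smooth plateau functions\<close>

text \<open>The number \<open>\<kappa>\<close> is the solution of
  \<open>2 / (1 + K * \<kappa>) = d\<close>, and then \<open>(2 / (1 + \<kappa>) - 1) * ((1 +
  \<kappa>) / (1 + K * \<kappa>)) = \<alpha>\<close> without loss. All exponents are critical, so
  constants must stay bounded over infinitely many generations: packings by small equal discs miss a
  fixed share of the area each time, which forces discs of many sizes and estimates that are exactly
  self-similar. Off \<open>E\<close> every point is affected by finitely many generations only.
  Finite stages therefore define the function there, and Hoelder continuity fills in the values on
  the null set \<open>E\<close>. The energy bound does not see the source scale: a packing disc of
  mass \<open>m\<close> whose radius in the target is \<open>t\<close> contributes at least
  \<open>pi * m^2 / t^2\<close>. In each generation the masses sum to 1 and the squares of the radii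
  to at most 1, so the contributions sum to at least \<open>pi\<close> by Cauchy-Schwarz.\<close>

definition flat_exp :: "real poly \<Rightarrow> real \<Rightarrow> real" where
  "flat_exp P x = (if x > 0 then poly P (1 / x) * exp (- (1 / x)) else 0)"

text \<open>Differentiating \<open>P(1/x) * exp (-1/x)\<close> gives
  \<open>(P - P')(1/x) / x^2 * exp (-1/x)\<close>. Carrying the polynomial as a parameter makes the
  family closed under differentiation, as the induction in \<open>C_k_flat_exp\<close>
  requires.\<close>

definition flat_exp_deriv :: "real poly \<Rightarrow> real poly" where
  "flat_exp_deriv P = [:0, 0, 1:] * (P - pderiv P)"

lemma poly_times_exp_tendsto_0:
  fixes P :: "real poly"
  shows "((\<lambda>y. poly P y * exp (- y)) \<longlongrightarrow> 0) at_top"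
proof -
  have *: "((\<lambda>y::real. coeff P i * (y ^ i * exp (- y))) \<longlongrightarrow> 0) at_top" for i
    using tendsto_mult[OF tendsto_const tendsto_power_div_exp_0[of i], of "coeff P i"]
    by (simp add: exp_minus divide_inverse)
  have "((\<lambda>y. \<Sum>i\<le>degree P. coeff P i * (y ^ i * exp (- y))) \<longlongrightarrow> (\<Sum>i\<le>degree P. 0)) at_top"
    by (intro tendsto_sum *)
  thus ?thesis
    by (simp add: poly_altdef sum_distrib_right mult.assoc)
qed

lemma flat_exp_at_right_0: "(flat_exp P \<longlongrightarrow> 0) (at_right 0)"
proof -
  have "((\<lambda>x. poly P (inverse x) * exp (- (inverse x))) \<longlongrightarrow> 0) (at_right 0)"
    by (rule filterlim_compose[OF poly_times_exp_tendsto_0 filterlim_inverse_at_top_right])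
  moreover have "\<forall>\<^sub>F x in at_right 0. poly P (inverse x) * exp (- (inverse x)) = flat_exp P x"
    unfolding eventually_at_right_field
    by (intro exI[of _ 1]) (auto simp: flat_exp_def inverse_eq_divide)
  ultimately show ?thesis
    by (rule Lim_transform_eventually)
qed

lemma flat_exp_has_derivative:
  "(flat_exp P has_real_derivative flat_exp (flat_exp_deriv P) x) (at x)"
proof (cases x "0::real" rule: linorder_cases)
  case less
  have "((\<lambda>x. 0) has_real_derivative 0) (at x)" by simp
  moreover have "\<forall>\<^sub>F y in nhds x. 0 = flat_exp P y"
    using eventually_nhds_in_open[of "{..<0}" x] less
    by (auto simp: flat_exp_def elim!: eventually_mono)
  ultimately have "(flat_exp P has_real_derivative 0) (at x)"
    by (subst DERIV_cong_ev[OF refl _ refl]) (auto elim: eventually_mono)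
  thus ?thesis using less by (simp add: flat_exp_def)
next
  case greater
  have "((\<lambda>x. poly P (1 / x) * exp (- (1 / x))) has_real_derivative
      poly P (1 / x) * (exp (- (1 / x)) * (1 / x\<^sup>2))
      + (poly (pderiv P) (1 / x) * (- (1 / x\<^sup>2))) * exp (- (1 / x))) (at x)"
    using greater
    by (auto intro!: derivative_eq_intros DERIV_chain'[where g="poly P"] poly_DERIV
        simp: power2_eq_square)
  moreover have "\<forall>\<^sub>F y in nhds x. poly P (1 / y) * exp (- (1 / y)) = flat_exp P y"
    using eventually_nhds_in_open[of "{0<..}" x] greater
    by (auto simp: flat_exp_def elim!: eventually_mono)
  ultimately have "(flat_exp P has_real_derivative
      poly P (1 / x) * (exp (- (1 / x)) * (1 / x\<^sup>2))
      + (poly (pderiv P) (1 / x) * (- (1 / x\<^sup>2))) * exp (- (1 / x))) (at x)"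
    by (subst DERIV_cong_ev[OF refl _ refl]) (auto elim: eventually_mono)
  also have "poly P (1 / x) * (exp (- (1 / x)) * (1 / x\<^sup>2))
      + (poly (pderiv P) (1 / x) * (- (1 / x\<^sup>2))) * exp (- (1 / x)) = flat_exp (flat_exp_deriv P) x"
    using greater by (simp add: flat_exp_def flat_exp_deriv_def power2_eq_square algebra_simps)
  finally show ?thesis .
next
  case equal
  have "((\<lambda>h. flat_exp P h / h) \<longlongrightarrow> 0) (at 0)"
  proof (rule filterlim_split_at)
    show "((\<lambda>h. flat_exp P h / h) \<longlongrightarrow> 0) (at_left 0)"
    proof (rule Lim_transform_eventually[OF tendsto_const])
      show "\<forall>\<^sub>F x in at_left 0. 0 = flat_exp P x / x"
        unfolding eventually_at_left_field
        by (intro exI[of _ "-1"]) (auto simp: flat_exp_def)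
    qed
    \<comment> \<open>Division by \<open>h\<close> multiplies the polynomial by its variable, so the
      quotient is again of the form \<open>flat_exp\<close>.\<close>
    show "((\<lambda>h. flat_exp P h / h) \<longlongrightarrow> 0) (at_right 0)"
      by (rule Lim_transform_eventually[OF flat_exp_at_right_0[of "[:0,1:] * P"]])
        (auto simp: eventually_at_right_field flat_exp_def intro!: exI[of _ 1])
  qed
  thus ?thesis
    using equal by (simp add: has_field_derivative_iff flat_exp_def)
qed

section \<open>Rules for \<open>C_k\<close>: sums, products, compositions and inverses\<close>

lemma C_k_const: "C_k k (\<lambda>z. c)"
  by (induction k arbitrary: c) auto

lemma C_k_inner: "C_k k (\<lambda>z. (z - a) \<bullet> v)"
proof (cases k)
  case (Suc m)
  have "((\<lambda>z. (z - a) \<bullet> v) has_derivative (\<lambda>w. w \<bullet> v)) (at z)" for z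
    by (auto intro!: derivative_eq_intros)
  hence "(\<lambda>z. (z - a) \<bullet> v) differentiable (at z)"
        "frechet_derivative (\<lambda>z. (z - a) \<bullet> v) (at z) = (\<lambda>w. w \<bullet> v)" for z
    unfolding differentiable_def by (blast, metis frechet_derivative_at)
  thus ?thesis using Suc by (simp add: C_k_const)
qed (auto intro!: continuous_intros)

lemma C_k_Suc_imp: "C_k (Suc k) f \<Longrightarrow> C_k k f"
proof (induction k arbitrary: f)
  case 0
  thus ?case by (auto intro!: differentiable_imp_continuous_on simp: differentiable_on_def differentiable_at_withinI)
qed auto

lemma C_k_add: "C_k k f \<Longrightarrow> C_k k g \<Longrightarrow> C_k k (\<lambda>z. f z + g z)"
proof (induction k arbitrary: f g)
  case (Suc k)
  have "frechet_derivative (\<lambda>z. f z + g z) (at z) v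
      = frechet_derivative f (at z) v + frechet_derivative g (at z) v" for z v
  proof -
    have "((\<lambda>z. f z + g z) has_derivative
        (\<lambda>v. frechet_derivative f (at z) v + frechet_derivative g (at z) v)) (at z)"
      using Suc.prems by (intro has_derivative_add) (auto simp: frechet_derivative_works)
    thus ?thesis by (metis frechet_derivative_at)
  qed
  thus ?case using Suc by (auto intro!: differentiable_add)
qed (auto intro!: continuous_intros)

lemma frechet_derivative_chain:
  assumes "f differentiable (at z)" "(\<phi> has_real_derivative D) (at (f z))"
  shows "(\<lambda>z. \<phi> (f z)) differentiable (at z)"
    and "frechet_derivative (\<lambda>z. \<phi> (f z)) (at z) v = D * frechet_derivative f (at z) v"
proof -
  have "((\<lambda>z. \<phi> (f z)) has_derivative (\<lambda>v. D * frechet_derivative f (at z) v)) (at z)"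
    using has_derivative_compose[OF assms(1)[unfolded frechet_derivative_works]
        assms(2)[unfolded has_field_derivative_def]]
    by simp
  thus "(\<lambda>z. \<phi> (f z)) differentiable (at z)"
    and "frechet_derivative (\<lambda>z. \<phi> (f z)) (at z) v = D * frechet_derivative f (at z) v"
    unfolding differentiable_def by (blast, metis frechet_derivative_at)
qed

lemma frechet_derivative_mult_real:
  fixes f g :: "'a::real_normed_vector \<Rightarrow> real"
  assumes "f differentiable (at z)" "g differentiable (at z)"
  shows "frechet_derivative (\<lambda>z. f z * g z) (at z) v
      = f z * frechet_derivative g (at z) v + frechet_derivative f (at z) v * g z"
proof -
  have "((\<lambda>z. f z * g z) has_derivative
    (\<lambda>v. f z * frechet_derivative g (at z) v + frechet_derivative f (at z) v * g z)) (at z)"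
    using assms by (intro has_derivative_mult) (auto simp: frechet_derivative_works)
  thus ?thesis by (metis frechet_derivative_at)
qed

lemma C_k_mult: "C_k k f \<Longrightarrow> C_k k g \<Longrightarrow> C_k k (\<lambda>z. f z * g z)"
proof (induction k arbitrary: f g)
  case (Suc k)
  have "frechet_derivative (\<lambda>z. f z * g z) (at z) v
      = f z * frechet_derivative g (at z) v + frechet_derivative f (at z) v * g z" for z v
    using Suc.prems by (simp add: frechet_derivative_mult_real)
  thus ?case using Suc C_k_Suc_imp[OF Suc.prems(1)] C_k_Suc_imp[OF Suc.prems(2)]
    by (auto intro!: differentiable_mult C_k_add Suc.IH)
qed (auto intro!: continuous_intros)

lemma C_k_flat_exp: "(\<And>k. C_k k u) \<Longrightarrow> C_k k (\<lambda>z. flat_exp P (u z))"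
proof (induction k arbitrary: P)
  case 0
  have "isCont (flat_exp P) x" for x
    using flat_exp_has_derivative DERIV_isCont by blast
  hence "continuous_on UNIV (flat_exp P)" by (simp add: continuous_at_imp_continuous_on)
  moreover have "continuous_on UNIV u" using 0[of 0] by simp
  ultimately show ?case by (auto intro: continuous_on_compose2)
next
  case (Suc k)
  have d: "u differentiable (at z)" for z using Suc.prems[of 1] by simp
  have "C_k k (\<lambda>z. frechet_derivative u (at z) v)" for v using Suc.prems[of "Suc k"] by simp
  thus ?case
    by (simp add: frechet_derivative_chain[OF d flat_exp_has_derivative] C_k_mult Suc)
qed

lemma C_k_inverse: "(\<And>k. C_k k u) \<Longrightarrow> (\<And>z. u z \<noteq> 0) \<Longrightarrow> C_k k (\<lambda>z. inverse (u z))"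
proof (induction k)
  case 0
  have "continuous_on UNIV u" using 0(1)[of 0] by simp
  thus ?case using 0(2) by (auto intro!: continuous_intros)
next
  case (Suc k)
  have d: "u differentiable (at z)" for z using Suc.prems(1)[of 1] by simp
  \<comment> \<open>The derivative is written as a product of values of \<open>inverse\<close>, so
    that \<open>C_k_mult\<close> and the induction hypothesis apply to it.\<close>
  have D: "(inverse has_real_derivative ((- 1) * (inverse (u z) * inverse (u z)))) (at (u z))" for z
    using DERIV_inverse[OF Suc.prems(2)[of z]] by (simp add: power2_eq_square)
  have "C_k k (\<lambda>z. frechet_derivative u (at z) v)" for v using Suc.prems(1)[of "Suc k"] by simp
  thus ?case
    using frechet_derivative_chain(1)[OF d D]
    by (simp only: frechet_derivative_chain(2)[OF d D] C_k.simps)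
      (intro conjI allI C_k_mult C_k_const Suc.IH Suc.prems, auto)
qed

text \<open>The usual cutoff \<open>a / (a + b)\<close> made of two flat functions without common
  zero. Squared distances are polynomial in the coordinates and hence smooth at the centre as
  well.\<close>

definition plateau :: "complex \<Rightarrow> real \<Rightarrow> real \<Rightarrow> complex \<Rightarrow> real" where
  "plateau a r R z =
     flat_exp 1 (R\<^sup>2 - (norm (z - a))\<^sup>2) *
     inverse (flat_exp 1 (R\<^sup>2 - (norm (z - a))\<^sup>2) + flat_exp 1 ((norm (z - a))\<^sup>2 - r\<^sup>2))"

lemma flat_exp_one: "flat_exp 1 x \<ge> 0" "x > 0 \<Longrightarrow> flat_exp 1 x > 0" "x \<le> 0 \<Longrightarrow> flat_exp 1 x = 0"
  by (auto simp: flat_exp_def)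

lemma
  assumes "0 \<le> r" "r < R"
  shows plateau_denominator: 
      "flat_exp 1 (R\<^sup>2 - (norm (z - a))\<^sup>2) + flat_exp 1 ((norm (z - a))\<^sup>2 - r\<^sup>2) > 0"
    and plateau_eq_1: "norm (z - a) \<le> r \<Longrightarrow> plateau a r R z = 1"
    and plateau_eq_0: "norm (z - a) \<ge> R \<Longrightarrow> plateau a r R z = 0"
    and plateau_nonneg: "plateau a r R z \<ge> 0"
    and plateau_le_1: "plateau a r R z \<le> 1"
proof -
  have *: "r\<^sup>2 < R\<^sup>2" using assms by (intro power_strict_mono) auto
  have "R\<^sup>2 - (norm (z - a))\<^sup>2 > 0 \<or> (norm (z - a))\<^sup>2 - r\<^sup>2 > 0"
    using * by linarith
  thus pos: "flat_exp 1 (R\<^sup>2 - (norm (z - a))\<^sup>2) + flat_exp 1 ((norm (z - a))\<^sup>2 - r\<^sup>2) > 0"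
    by (meson add_nonneg_pos add_pos_nonneg flat_exp_one(1,2))
  show "plateau a r R z \<ge> 0"
    by (auto simp: plateau_def intro!: mult_nonneg_nonneg add_nonneg_nonneg flat_exp_one)
  show "plateau a r R z \<le> 1"
    using pos flat_exp_one(1) by (simp add: plateau_def field_simps)
  show "plateau a r R z = 0" if "norm (z - a) \<ge> R"
  proof -
    have "R\<^sup>2 \<le> (norm (z - a))\<^sup>2" using that assms by (intro power_mono) auto
    thus ?thesis by (simp add: plateau_def flat_exp_one(3))
  qed
  show "plateau a r R z = 1" if "norm (z - a) \<le> r"
  proof -
    have "(norm (z - a))\<^sup>2 \<le> r\<^sup>2" using that assms by (intro power_mono) auto
    thus ?thesis using pos by (simp add: plateau_def flat_exp_one(3))
  qed
qed

lemma test_function_plateau: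
  assumes "0 \<le> r" "r < R"
  shows "test_function UNIV (plateau a r R)"
proof -
  have n: "(norm (z - a))\<^sup>2 = (z - a) \<bullet> 1 * ((z - a) \<bullet> 1) + (z - a) \<bullet> \<i> * ((z - a) \<bullet> \<i>)" for z
    unfolding cmod_power2 by (simp add: power2_eq_square)
  have N: "C_k k (\<lambda>z. (norm (z - a))\<^sup>2)" for k
    unfolding n by (intro C_k_add C_k_mult C_k_inner)
  have u: "C_k k (\<lambda>z. R\<^sup>2 - (norm (z - a))\<^sup>2)" for k
    using C_k_add[OF C_k_const[of k "R\<^sup>2"] C_k_mult[OF C_k_const[of k "-1"] N]] by simp
  have v: "C_k k (\<lambda>z. (norm (z - a))\<^sup>2 - r\<^sup>2)" for k
    using C_k_add[OF C_k_const[of k "-(r\<^sup>2)"] N] by (simp add: add.commute[of "- _"])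
  have "C_k k (plateau a r R)" for k
    unfolding plateau_def
    using plateau_denominator[OF assms]
    by (intro C_k_mult C_k_inverse C_k_flat_exp C_k_add u v) (metis less_irrefl)
  moreover have "closure {z. plateau a r R z \<noteq> 0} \<subseteq> cball a R"
    using plateau_eq_0[OF assms] 
    by (intro closure_minimal) (force simp: dist_norm norm_minus_commute)+
  hence "compact (closure {z. plateau a r R z \<noteq> 0})"
    by (metis bounded_cball bounded_subset closed_closure compact_eq_bounded_closed)
  ultimately show ?thesis by (simp add: test_function_def)
qed

section \<open>Weak derivatives of Lipschitz functions\<close>

lemma locally_LpI:
  assumes "g \<in> borel_measurable borel" "open \<Omega>"
    and "\<And>L. compact L \<Longrightarrow> L \<subseteq> \<Omega> \<Longrightarrow> \<exists>B. AE z in lebesgue. z \<in> L \<longrightarrow> norm (g z) \<le> B"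
  shows "locally_Lp p \<Omega> g"
  unfolding locally_Lp_def
proof (intro conjI allI impI)
  have g: "g \<in> borel_measurable lebesgue"
    using assms(1) by (simp add: measurable_completion)
  have "\<Omega> \<in> sets lebesgue" using assms(2) by auto
  thus "set_borel_measurable lebesgue \<Omega> g"
    unfolding set_borel_measurable_def using g by measurable
  fix L :: "complex set" assume L: "compact L \<and> L \<subseteq> \<Omega>"
  then obtain B where B: "AE z in lebesgue. z \<in> L \<longrightarrow> norm (g z) \<le> B" using assms(3) by blast
  have L': "L \<in> lmeasurable" using L lmeasurable_compact by blast
  show "set_integrable lebesgue L (\<lambda>z. norm (g z) ^ p)"
    unfolding set_integrable_def
  proof (rule Bochner_Integration.integrable_bound)
    show "integrable lebesgue (\<lambda>z. indicator L z * \<bar>B\<bar> ^ p :: real)"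
      using L' by (intro integrable_mult_left integrable_real_indicator) (auto simp: fmeasurable_def)
    have "L \<in> sets lebesgue" using L' by blast
    thus "(\<lambda>z. indicator L z *\<^sub>R norm (g z) ^ p) \<in> borel_measurable lebesgue"
      using g by measurable
    show "AE z in lebesgue. norm (indicator L z *\<^sub>R norm (g z) ^ p) \<le> norm (indicator L z * \<bar>B\<bar> ^ p)"
      using B by eventually_elim (auto simp: indicator_def intro!: power_mono)
  qed
qed

lemma integrable_continuous_bounded_support:
  fixes u :: "'a::euclidean_space \<Rightarrow> 'b::{banach, second_countable_topology}"
  assumes "continuous_on UNIV u" "\<And>z. norm z > B \<Longrightarrow> u z = 0"
  shows "integrable lborel u" "integrable lebesgue u"
proof -
  have "integrable lborel (\<lambda>x. indicator (cball 0 B) x *\<^sub>R u x)"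
    using assms(1) by (intro borel_integrable_compact) (auto intro: continuous_on_subset)
  moreover have "(\<lambda>x. indicator (cball 0 B) x *\<^sub>R u x) = u"
    using assms(2) by (auto simp: indicator_def fun_eq_iff not_le)
  ultimately show "integrable lborel u" by simp
  thus "integrable lebesgue u" by (simp add: integrable_completion borel_measurable_integrable)
qed

lemma integral_translation_lborel:
  fixes u :: "'a::euclidean_space \<Rightarrow> 'b::{banach, second_countable_topology}"
  assumes "continuous_on UNIV u"
  shows "integrable lborel u \<Longrightarrow> integrable lborel (\<lambda>z. u (z + a))"
    and "(LINT z|lborel. u (z + a)) = (LINT z|lborel. u z)"
proof -
  have u: "u \<in> borel_measurable borel" using assms by (rule borel_measurable_continuous_onI)
  show "(LINT z|lborel. u (z + a)) = (LINT z|lborel. u z)"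
    using integral_distr[of "(+) a" lborel borel u] u by (simp add: lborel_distr_plus add.commute)
  show "integrable lborel u \<Longrightarrow> integrable lborel (\<lambda>z. u (z + a))"
    using integrable_distr_eq[of "(+) a" lborel borel u] u by (simp add: lborel_distr_plus add.commute)
qed

text \<open>Integrating a difference quotient gives zero by translation invariance of Lebesgue measure;
  dominated convergence then handles the derivative. No integration along lines is needed.\<close>

lemma integral_directional_derivative_eq_0:
  fixes u D :: "complex \<Rightarrow> complex"
  assumes cont: "continuous_on UNIV u" and supp: "\<And>z. norm z > B \<Longrightarrow> u z = 0"
    and h0: "h0 > 0" and lip: "\<And>z h. 0 < h \<Longrightarrow> h < h0 \<Longrightarrow> norm (u (z + h *\<^sub>R v) - u z) \<le> C * h"
    and diff: "AE z in lebesgue. (\<lambda>n. real (Suc n) *\<^sub>R (u (z + v /\<^sub>R real (Suc n)) - u z)) \<longlonglongrightarrow> D z"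
    and D: "D \<in> borel_measurable lebesgue"
  shows "integrable lebesgue D" "integral\<^sup>L lebesgue D = 0"
proof -
  \<comment> \<open>Shifting the sequence by \<open>N\<close> makes all steps shorter than
    \<open>h0\<close>, the range in which \<open>lip\<close> holds.\<close>
  obtain N where N: "inverse (real (Suc N)) < h0"
    using h0 reals_Archimedean by blast
  define q where "q n z = real (Suc (n + N)) *\<^sub>R (u (z + v /\<^sub>R real (Suc (n + N))) - u z)" for n z
  \<comment> \<open>All quotients vanish outside this ball, which is enlarged by
    \<open>norm v\<close> to contain the supports of the translates; so \<open>w\<close> dominates
    them.\<close>
  define w where "w z = \<bar>C\<bar> * indicator (cball 0 (B + norm v)) z" for z :: complex
  have cont': "continuous_on UNIV (\<lambda>z. u (z + a))" for a
    by (rule continuous_on_compose2[OF cont]) (auto intro!: continuous_intros)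
  have iu: "integrable lborel u" by (rule integrable_continuous_bounded_support[OF cont supp])
  have iq: "integrable lborel (q n)" "integral\<^sup>L lborel (q n) = 0" for n
    unfolding q_def using iu
    by (auto simp: integral_translation_lborel[OF cont])
  have qm: "q n \<in> borel_measurable lborel" for n
    by (rule borel_measurable_integrable[OF iq(1)])
  have q0: "integral\<^sup>L lebesgue (q n) = 0" for n
    using iq(2)[of n] integral_completion[OF qm] by simp
  have bound: "norm (q n z) \<le> w z" for n z
  proof -
    define h where "h = inverse (real (Suc (n + N)))"
    have "h \<le> inverse (real (Suc N))" unfolding h_def by (intro le_imp_inverse_le) auto
    moreover have "inverse (real (Suc N)) \<le> 1" by (simp add: inverse_le_1_iff)
    moreover have "0 < h" by (simp add: h_def)
    ultimately have h: "0 < h" "h < h0" "h \<le> 1" using N by linarith+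
    have q: "norm (q n z) = norm (u (z + h *\<^sub>R v) - u z) / h"
      by (simp add: q_def h_def divide_inverse mult.commute del: of_nat_Suc)
    have "norm (q n z) \<le> \<bar>C\<bar>"
      unfolding q using lip[OF h(1,2), of z] h by (simp add: pos_divide_le_eq)
        (smt (verit) mult_right_mono)
    moreover have "norm (q n z) = 0" if "norm z > B + norm v"
    proof -
      have "norm (h *\<^sub>R v) \<le> norm v" using h by (simp add: mult_left_le_one_le)
      hence "norm (z + h *\<^sub>R v) > B" using that norm_diff_ineq[of z "h *\<^sub>R v"] by linarith
      moreover have "norm z > B" using that norm_ge_zero[of v] by linarith
      ultimately show ?thesis unfolding q by (simp add: supp)
    qed
    ultimately show ?thesis by (auto simp: w_def indicator_def)
  qed
  have wi: "integrable lebesgue w"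
    unfolding w_def using lmeasurable_cball[of 0 "B + norm v"]
    by (intro integrable_mult_right integrable_real_indicator) (auto simp: fmeasurable_def)
  have lim: "AE z in lebesgue. (\<lambda>n. q n z) \<longlonglongrightarrow> D z"
    using diff unfolding q_def by eventually_elim (rule LIMSEQ_ignore_initial_segment)
  have qm': "q n \<in> borel_measurable lebesgue" for n using qm by (simp add: measurable_completion)
  note dc = D qm' wi lim
  show "integrable lebesgue D"
    by (rule integrable_dominated_convergence[OF dc]) (simp add: bound)
  have "(\<lambda>n. integral\<^sup>L lebesgue (q n)) \<longlonglongrightarrow> integral\<^sup>L lebesgue D"
    by (rule integral_dominated_convergence[OF dc]) (simp add: bound)
  thus "integral\<^sup>L lebesgue D = 0" using q0 by (simp add: LIMSEQ_const_iff)
qed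

lemma test_functionD:
  assumes "test_function \<Omega> \<phi>"
  shows "\<phi> differentiable (at z)"
    and "continuous_on UNIV \<phi>" "continuous_on UNIV (\<lambda>z. frechet_derivative \<phi> (at z) v)"
    and "z \<notin> closure {z. \<phi> z \<noteq> 0} \<Longrightarrow> \<phi> z = 0"
    and "z \<notin> closure {z. \<phi> z \<noteq> 0} \<Longrightarrow> frechet_derivative \<phi> (at z) v = 0"
proof -
  have C: "C_k k \<phi>" for k using assms by (simp add: test_function_def)
  show "\<phi> differentiable (at z)" using C[of 1] by simp
  show "continuous_on UNIV \<phi>" using C[of 0] by simp
  show "continuous_on UNIV (\<lambda>z. frechet_derivative \<phi> (at z) v)" using C[of 1] by simp
  show *: "\<phi> z = 0" if "z \<notin> closure {z. \<phi> z \<noteq> 0}" for z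
    using that closure_subset[of "{z. \<phi> z \<noteq> 0}"] by auto
  show "frechet_derivative \<phi> (at z) v = 0" if "z \<notin> closure {z. \<phi> z \<noteq> 0}"
  proof -
    have "((\<lambda>_. 0) has_derivative (\<lambda>_. 0)) (at z)" by simp
    hence "(\<phi> has_derivative (\<lambda>_. 0)) (at z)"
    proof (rule has_derivative_transform_within_open)
      show "z \<in> - closure {z. \<phi> z \<noteq> 0}" using that by blast
      show "0 = \<phi> y" if "y \<in> - closure {z. \<phi> z \<noteq> 0}" for y
        using *[of y] that by simp
    qed auto
    thus ?thesis by (metis frechet_derivative_at)
  qed
qed

lemma difference_quotient_tendsto:
  assumes "(f has_derivative f') (at z)"
  shows "(\<lambda>n. real (Suc n) *\<^sub>R (f (z + v /\<^sub>R real (Suc n)) - f z)) \<longlonglongrightarrow> f' v"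
proof (cases "v = 0")
  case True
  thus ?thesis using linear_0[OF has_derivative_linear[OF assms]] by simp
next
  case False
  let ?h = "\<lambda>n. v /\<^sub>R real (Suc n)"
  have "?h \<longlonglongrightarrow> 0"
    using tendsto_scaleR[OF LIMSEQ_inverse_real_of_nat tendsto_const, of v] by simp
  hence "filterlim ?h (at 0) sequentially"
    using False by (auto simp: filterlim_at simp del: of_nat_Suc)
  moreover have "(\<lambda>h. norm (f (z + h) - f z - f' h) / norm h) \<midarrow>0\<rightarrow> 0"
    using assms by (simp add: has_derivative_at)
  ultimately have "(\<lambda>n. norm (f (z + ?h n) - f z - f' (?h n)) / norm (?h n)) \<longlonglongrightarrow> 0"
    by (rule filterlim_compose[rotated])
  hence "(\<lambda>n. norm v * (norm (f (z + ?h n) - f z - f' (?h n)) / norm (?h n))) \<longlonglongrightarrow> 0"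
    by (rule tendsto_mult_right_zero)
  also have "(\<lambda>n. norm v * (norm (f (z + ?h n) - f z - f' (?h n)) / norm (?h n)))
      = (\<lambda>n. norm (real (Suc n) *\<^sub>R (f (z + ?h n) - f z) - f' v))"
  proof
    fix n
    have "real (Suc n) *\<^sub>R (f (z + ?h n) - f z) - f' v = real (Suc n) *\<^sub>R (f (z + ?h n) - f z - f' (?h n))"
      using has_derivative_linear[OF assms] by (simp add: linear_cmul scaleR_diff_right del: of_nat_Suc)
    thus "norm v * (norm (f (z + ?h n) - f z - f' (?h n)) / norm (?h n))
        = norm (real (Suc n) *\<^sub>R (f (z + ?h n) - f z) - f' v)"
      using False by (simp add: divide_inverse del: of_nat_Suc)
  qed
  finally show ?thesis by (simp only: tendsto_norm_zero_iff LIM_zero_iff)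
qed

lemma test_function_directional_lipschitz:
  assumes "test_function \<Omega> \<phi>" and M: "\<And>z. \<bar>frechet_derivative \<phi> (at z) v\<bar> \<le> M" and "h > 0"
  shows "\<bar>\<phi> (z + h *\<^sub>R v) - \<phi> z\<bar> \<le> M * h"
proof -
  have d: "((\<lambda>t. \<phi> (z + t *\<^sub>R v)) has_real_derivative frechet_derivative \<phi> (at (z + t *\<^sub>R v)) v) (at t)" for t
  proof -
    have *: "(\<phi> has_derivative frechet_derivative \<phi> (at (z + t *\<^sub>R v))) (at (z + t *\<^sub>R v))"
      using test_functionD(1)[OF assms(1)] frechet_derivative_works by blast
    have "((\<lambda>t. z + t *\<^sub>R v) has_derivative (\<lambda>t. t *\<^sub>R v)) (at t)"
      by (auto intro!: derivative_eq_intros)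
    from has_derivative_compose[OF this *] show ?thesis
      using has_derivative_linear[OF *]
      by (simp add: has_field_derivative_def linear_cmul mult_commute_abs)
  qed
  obtain t where "\<phi> (z + h *\<^sub>R v) - \<phi> (z + 0 *\<^sub>R v) = (h - 0) * frechet_derivative \<phi> (at (z + t *\<^sub>R v)) v"
    using MVT2[OF assms(3), of "\<lambda>t. \<phi> (z + t *\<^sub>R v)", OF d] by blast
  thus ?thesis using M[of "z + t *\<^sub>R v"] assms(3) by (simp add: abs_mult mult.commute)
qed

text \<open>Integration by parts is the vanishing of the integral of the derivative of
  \<open>\<phi> *\<^sub>R f\<close>. Differentiability enters as convergence almost everywhere of
  the quotients with steps \<open>1 / n\<close>, a form in which the derivative is easily defined as
  a Borel function. In \<open>lip\<close> the point \<open>w\<close> ranges over a full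
  neighbourhood of \<open>z\<close>, so difference quotients at points of \<open>L\<close> are
  controlled even when they leave \<open>L\<close>.\<close>

lemma weak_derivativeI:
  fixes f g :: "complex \<Rightarrow> complex"
  assumes "open \<Omega>" and f: "continuous_on UNIV f"
    and lip: "\<And>L. compact L \<Longrightarrow> L \<subseteq> \<Omega> \<Longrightarrow>
        \<exists>\<epsilon>>0. \<exists>C. \<forall>z\<in>L. \<forall>w. dist z w < \<epsilon> \<longrightarrow> norm (f w - f z) \<le> C * dist z w"
    and g: "g \<in> borel_measurable borel"
    and diff: "AE z in lebesgue. z \<in> \<Omega> \<longrightarrow>
        (\<lambda>n. real (Suc n) *\<^sub>R (f (z + v /\<^sub>R real (Suc n)) - f z)) \<longlonglongrightarrow> g z"
  shows "weak_derivative \<Omega> v f g"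
    and "locally_Lp p \<Omega> f" "locally_Lp p \<Omega> g"
proof -
  have fb: "\<exists>B. \<forall>z\<in>L. norm (f z) \<le> B" if "compact L" for L
    using compact_imp_bounded[OF compact_continuous_image[OF continuous_on_subset[OF f subset_UNIV] that]]
    by (auto simp: bounded_iff)
  have fL: "locally_Lp p \<Omega> f" for p
  proof (rule locally_LpI[OF borel_measurable_continuous_onI[OF f] assms(1)])
    fix L :: "complex set" assume "compact L"
    then obtain B where "\<forall>z\<in>L. norm (f z) \<le> B" using fb by blast
    thus "\<exists>B. AE z in lebesgue. z \<in> L \<longrightarrow> norm (f z) \<le> B" by (intro exI[of _ B]) simp
  qed
  have gL: "locally_Lp p \<Omega> g" for p
    using g assms(1)
  proof (rule locally_LpI)
    fix L assume L: "compact L" "L \<subseteq> \<Omega>"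
    then obtain \<epsilon> C where \<epsilon>: "\<epsilon> > 0"
      and C: "\<And>z w. z \<in> L \<Longrightarrow> dist z w < \<epsilon> \<Longrightarrow> norm (f w - f z) \<le> C * dist z w"
      using lip by metis
    show "\<exists>B. AE z in lebesgue. z \<in> L \<longrightarrow> norm (g z) \<le> B"
    proof (intro exI)
      show "AE z in lebesgue. z \<in> L \<longrightarrow> norm (g z) \<le> C * norm v"
        using diff
      proof eventually_elim
        case (elim z)
        show ?case
        proof
          assume z: "z \<in> L"
          hence *: "(\<lambda>n. real (Suc n) *\<^sub>R (f (z + v /\<^sub>R real (Suc n)) - f z)) \<longlonglongrightarrow> g z"
            using elim L by blast
          have "(\<lambda>n. norm v * inverse (real (Suc n))) \<longlonglongrightarrow> norm v * 0"
            by (intro tendsto_intros LIMSEQ_inverse_real_of_nat)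
          hence "\<forall>\<^sub>F n in sequentially. norm v * inverse (real (Suc n)) < \<epsilon>"
            using \<epsilon> by (intro order_tendstoD(2)) auto
          hence "\<forall>\<^sub>F n in sequentially. norm (real (Suc n) *\<^sub>R (f (z + v /\<^sub>R real (Suc n)) - f z)) \<le> C * norm v"
          proof eventually_elim
            case (elim n)
            have d: "dist z (z + v /\<^sub>R real (Suc n)) = norm v * inverse (real (Suc n))"
              by (simp add: dist_norm mult.commute)
            have "norm (f (z + v /\<^sub>R real (Suc n)) - f z) \<le> C * (norm v * inverse (real (Suc n)))"
              using C[OF z, of "z + v /\<^sub>R real (Suc n)"] elim unfolding d by blast
            hence "real (Suc n) * norm (f (z + v /\<^sub>R real (Suc n)) - f z)
                \<le> real (Suc n) * (C * (norm v * inverse (real (Suc n))))"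
              by (rule mult_left_mono) simp
            also have "real (Suc n) * (C * (norm v * inverse (real (Suc n)))) = C * norm v" by simp
            finally show ?case by (simp only: norm_scaleR abs_of_nat)
          qed
          thus "norm (g z) \<le> C * norm v"
            using * by (intro tendsto_upperbound[OF tendsto_norm]) auto
        qed
      qed
    qed
  qed
  show "locally_Lp p \<Omega> f" "locally_Lp p \<Omega> g" by (fact fL gL)+
  show "weak_derivative \<Omega> v f g"
    unfolding weak_derivative_def
  proof (intro conjI fL gL allI impI)
    fix \<phi> assume tf: "test_function \<Omega> \<phi>"
    define L where "L = closure {z. \<phi> z \<noteq> 0}"
    define d where "d z = frechet_derivative \<phi> (at z) v" for z
    note tD = test_functionD[OF tf, folded L_def]
    have L: "compact L" "L \<subseteq> \<Omega>" using tf by (auto simp: test_function_def L_def)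
    obtain \<epsilon> C where \<epsilon>: "\<epsilon> > 0"
      and C: "\<And>z w. z \<in> L \<Longrightarrow> dist z w < \<epsilon> \<Longrightarrow> norm (f w - f z) \<le> C * dist z w"
      using lip[OF L] by metis
    obtain B where B: "\<And>z. z \<in> L \<Longrightarrow> norm z \<le> B"
      using compact_imp_bounded[OF L(1)] by (auto simp: bounded_iff)
    have bd: "\<exists>M. \<forall>z. \<bar>k z\<bar> \<le> M" if "continuous_on UNIV k" "\<And>z. z \<notin> L \<Longrightarrow> k z = 0" for k :: "complex \<Rightarrow> real"
    proof -
      have "\<exists>M. \<forall>z\<in>L. \<bar>k z\<bar> \<le> M"
        using compact_imp_bounded[OF compact_continuous_image[OF continuous_on_subset[OF that(1) subset_UNIV] L(1)]]
        by (auto simp: bounded_iff)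
      then obtain M where "\<And>z. z \<in> L \<Longrightarrow> \<bar>k z\<bar> \<le> M" by blast
      hence "\<forall>z. \<bar>k z\<bar> \<le> max M 0" using that(2) by (metis abs_zero max.cobounded2 max.coboundedI1)
      thus ?thesis ..
    qed
    obtain M where M: "\<And>z. \<bar>d z\<bar> \<le> M" using bd[of d] tD(3,5) unfolding d_def by blast
    obtain M0 where M0: "\<And>z. \<bar>\<phi> z\<bar> \<le> M0" using bd[of \<phi>] tD(2,4) by blast
    obtain Mf where Mf: "\<And>z. z \<in> cball 0 (B + norm v) \<Longrightarrow> norm (f z) \<le> Mf" "Mf \<ge> 0"
    proof -
      obtain Mf where "\<And>z. z \<in> cball 0 (B + norm v) \<Longrightarrow> norm (f z) \<le> Mf"
        using fb[of "cball 0 (B + norm v)"] compact_cball by blast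
      thus ?thesis using that[of "max Mf 0"] by fastforce
    qed
    \<comment> \<open>Steps below \<open>h0\<close> move points by less than
      \<open>\<epsilon>\<close> and by at most \<open>norm v\<close>; adding 1 to
      \<open>norm v\<close> covers \<open>v = 0\<close>.\<close>
    define h0 where "h0 = min 1 (\<epsilon> / (norm v + 1))"
    have h0: "h0 > 0" using \<epsilon> by (auto simp: h0_def intro!: divide_pos_pos add_nonneg_pos)
    define u where "u z = \<phi> z *\<^sub>R f z" for z
    define D where "D z = d z *\<^sub>R f z + \<phi> z *\<^sub>R g z" for z
    have cu: "continuous_on UNIV u" unfolding u_def using f tD(2) by (intro continuous_intros)
    have cd: "continuous_on UNIV (\<lambda>z. d z *\<^sub>R f z)" unfolding d_def using f tD(3) by (intro continuous_intros)
    have su: "u z = 0" if "norm z > B" for z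
      using that B[of z] tD(4)[of z] by (auto simp: u_def)
    have sd: "d z *\<^sub>R f z = 0" if "norm z > B" for z
      using that B[of z] tD(5)[of z] by (auto simp: d_def)
    have lu: "norm (u (z + h *\<^sub>R v) - u z) \<le> (M * Mf + M0 * (\<bar>C\<bar> * norm v)) * h" if h: "0 < h" "h < h0" for z h
    proof -
      define w where "w = z + h *\<^sub>R v"
      have hv: "norm (h *\<^sub>R v) \<le> norm v" using h by (simp add: h0_def mult_left_le_one_le)
      have "h * (norm v + 1) < \<epsilon>" using h by (simp add: h0_def pos_less_divide_eq add_nonneg_pos)
      hence hv': "dist z w < \<epsilon>" using h by (simp add: w_def dist_norm distrib_left)
      \<comment> \<open>With \<open>f\<close> taken at \<open>w\<close> and \<open>\<phi>\<close> at
        \<open>z\<close>, the first term is nonzero only if \<open>z\<close> or \<open>w\<close> is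
        in \<open>L\<close>, where \<open>f w\<close> is bounded, and the second only if
        \<open>z\<close> is in \<open>L\<close>, where \<open>lip\<close> applies.\<close>
      have split: "u w - u z = (\<phi> w - \<phi> z) *\<^sub>R f w + \<phi> z *\<^sub>R (f w - f z)"
        by (simp add: u_def algebra_simps)
      have "M0 \<ge> 0" using M0[of 0] by linarith
      have "M \<ge> 0" using M[of 0] by linarith
      have 1: "norm ((\<phi> w - \<phi> z) *\<^sub>R f w) \<le> (M * h) * Mf"
      proof (cases "z \<in> L \<or> w \<in> L")
        case True
        have "norm w \<le> B + norm v"
        proof (cases "w \<in> L")
          case False
          hence "norm z \<le> B" using True B by blast
          thus ?thesis using hv norm_triangle_ineq[of z "h *\<^sub>R v"] unfolding w_def by linarith
        qed (use B[of w] norm_ge_zero[of v] in linarith)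
        hence "norm (f w) \<le> Mf" by (intro Mf(1)) simp
        moreover have "\<bar>\<phi> w - \<phi> z\<bar> \<le> M * h"
          unfolding w_def by (rule test_function_directional_lipschitz[OF tf _ h(1)]) (use M in \<open>simp add: d_def\<close>)
        ultimately show ?thesis unfolding norm_scaleR by (intro mult_mono) (use \<open>M \<ge> 0\<close> h in auto)
      next
        case False
        hence "\<phi> w - \<phi> z = 0" using tD(4) by simp
        thus ?thesis using \<open>M \<ge> 0\<close> h Mf(2) by simp
      qed
      have 2: "norm (\<phi> z *\<^sub>R (f w - f z)) \<le> M0 * (\<bar>C\<bar> * norm v * h)"
      proof (cases "z \<in> L")
        case True
        have "norm (f w - f z) \<le> C * dist z w" by (rule C[OF True hv'])
        also have "\<dots> \<le> \<bar>C\<bar> * dist z w" by (intro mult_right_mono) auto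
        also have "dist z w = norm v * h" using h by (simp add: w_def dist_norm)
        finally show ?thesis using M0[of z] unfolding norm_scaleR
          by (intro mult_mono) (auto simp: \<open>M0 \<ge> 0\<close> mult.assoc)
      qed (use tD(4) h \<open>M0 \<ge> 0\<close> in auto)
      show ?thesis using norm_triangle_ineq[of "(\<phi> w - \<phi> z) *\<^sub>R f w" "\<phi> z *\<^sub>R (f w - f z)"] 1 2
        unfolding split[unfolded w_def] w_def by (simp add: algebra_simps)
    qed
    have gm: "g \<in> borel_measurable lebesgue" "(\<lambda>z. d z *\<^sub>R f z) \<in> borel_measurable lebesgue"
        "\<phi> \<in> borel_measurable lebesgue"
      using g borel_measurable_continuous_onI[OF cd] borel_measurable_continuous_onI[OF tD(2)]
      by (auto intro!: measurable_completion)
    have Dm: "D \<in> borel_measurable lebesgue"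
      unfolding D_def by (rule borel_measurable_add[OF gm(2) borel_measurable_scaleR[OF gm(3,1)]])
    have "AE z in lebesgue. (\<lambda>n. real (Suc n) *\<^sub>R (u (z + v /\<^sub>R real (Suc n)) - u z)) \<longlonglongrightarrow> D z"
      using diff
    proof eventually_elim
      case (elim z)
      have vn: "(\<lambda>n. z + v /\<^sub>R real (Suc n)) \<longlonglongrightarrow> z"
        using tendsto_add[OF tendsto_const tendsto_scaleR[OF LIMSEQ_inverse_real_of_nat tendsto_const], of z v]
        by simp
      have ph: "(\<lambda>n. real (Suc n) *\<^sub>R (\<phi> (z + v /\<^sub>R real (Suc n)) - \<phi> z)) \<longlonglongrightarrow> d z"
        unfolding d_def
        by (rule difference_quotient_tendsto) (use tD(1) frechet_derivative_works in blast)
      show ?case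
      proof (cases "z \<in> \<Omega>")
        case True
        have pc: "(\<lambda>n. \<phi> (z + v /\<^sub>R real (Suc n))) \<longlonglongrightarrow> \<phi> z"
          using tD(2) vn by (auto intro: continuous_on_tendsto_compose)
        have "(\<lambda>n. \<phi> (z + v /\<^sub>R real (Suc n)) *\<^sub>R (real (Suc n) *\<^sub>R (f (z + v /\<^sub>R real (Suc n)) - f z))
            + (real (Suc n) *\<^sub>R (\<phi> (z + v /\<^sub>R real (Suc n)) - \<phi> z)) *\<^sub>R f z) \<longlonglongrightarrow> \<phi> z *\<^sub>R g z + d z *\<^sub>R f z"
          using elim True by (intro tendsto_add tendsto_scaleR pc ph tendsto_const) auto
        thus ?thesis by (simp add: u_def D_def algebra_simps del: of_nat_Suc)
      next
        case False
        hence z: "z \<in> - L" using L by auto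
        hence "\<forall>\<^sub>F n in sequentially. z + v /\<^sub>R real (Suc n) \<in> - L"
          using vn compact_imp_closed[OF L(1)] by (intro topological_tendstoD) auto
        hence "\<forall>\<^sub>F n in sequentially. 0 = real (Suc n) *\<^sub>R (u (z + v /\<^sub>R real (Suc n)) - u z)"
          by (rule eventually_mono) (use z in \<open>simp add: u_def tD(4)\<close>)
        moreover have "D z = 0" using z by (simp add: D_def d_def tD(4,5))
        ultimately show ?thesis by (simp only: tendsto_cong[THEN iffD1, OF _ tendsto_const])
      qed
    qed
    from integral_directional_derivative_eq_0[OF cu su h0 lu this Dm]
    have D0: "integrable lebesgue D" "integral\<^sup>L lebesgue D = 0" by blast+
    have id: "integrable lebesgue (\<lambda>z. d z *\<^sub>R f z)"
      by (rule integrable_continuous_bounded_support(2)[OF cd sd])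
    have ig: "integrable lebesgue (\<lambda>z. \<phi> z *\<^sub>R g z)"
      using Bochner_Integration.integrable_diff[OF D0(1) id] by (simp add: D_def)
    have "D = (\<lambda>z. d z *\<^sub>R f z + \<phi> z *\<^sub>R g z)" by (simp add: D_def fun_eq_iff)
    hence "(LINT z|lebesgue. d z *\<^sub>R f z) = - (LINT z|lebesgue. \<phi> z *\<^sub>R g z)"
      using D0(2) Bochner_Integration.integral_add[OF id ig] by (simp add: eq_neg_iff_add_eq_0)
    moreover have "(LINT z:\<Omega>|lebesgue. d z *\<^sub>R f z) = (LINT z|lebesgue. d z *\<^sub>R f z)"
      unfolding set_lebesgue_integral_def using L tD(5)
      by (intro Bochner_Integration.integral_cong) (auto simp: indicator_def d_def)
    moreover have "(LINT z:\<Omega>|lebesgue. \<phi> z *\<^sub>R g z) = (LINT z|lebesgue. \<phi> z *\<^sub>R g z)"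
      unfolding set_lebesgue_integral_def using L tD(4)
      by (intro Bochner_Integration.integral_cong) (auto simp: indicator_def)
    ultimately show "(LINT z:\<Omega>|lebesgue. frechet_derivative \<phi> (at z) v *\<^sub>R f z) =
        - (LINT z:\<Omega>|lebesgue. \<phi> z *\<^sub>R g z)" by (simp add: d_def)
  qed
qed

text \<open>Supplies the values on the Cantor set, off which the function is constructed. The range
  \<open>dist z w \<le> 2\<close> is the one delivered by \<open>stretch_Hoelder\<close>.\<close>

lemma Hoelder_extension:
  fixes g :: "complex \<Rightarrow> complex"
  assumes \<alpha>: "0 < \<alpha>" and M: "0 \<le> M" and S: "closure S = UNIV"
    and g: "\<And>z w. z \<in> S \<Longrightarrow> w \<in> S \<Longrightarrow> dist z w \<le> 2 \<Longrightarrow> dist (g z) (g w) \<le> M * dist z w powr \<alpha>"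
  obtains f where "continuous_on UNIV f" "\<And>z. z \<in> S \<Longrightarrow> f z = g z" "Lip \<alpha> f"
proof -
  have "uniformly_continuous_on S g"
    unfolding uniformly_continuous_on_def
  proof (intro allI impI)
    fix e :: real assume e: "0 < e"
    \<comment> \<open>Chosen so that \<open>M * d powr \<alpha> < e\<close>, with
      \<open>M + 1\<close> in place of \<open>M\<close> to allow \<open>M = 0\<close>.\<close>
    define d where "d = min 2 ((e / (M + 1)) powr (1 / \<alpha>))"
    have d: "0 < d" using e M by (simp add: d_def)
    have "dist (g w) (g z) < e" if "z \<in> S" "w \<in> S" "dist w z < d" for z w
    proof -
      have "dist (g w) (g z) \<le> M * dist w z powr \<alpha>" using that by (intro g) (auto simp: d_def)
      also have "\<dots> \<le> M * d powr \<alpha>" using that \<alpha> M by (intro mult_left_mono powr_mono2) auto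
      also have "\<dots> \<le> M * ((e / (M + 1)) powr (1 / \<alpha>)) powr \<alpha>"
        using \<alpha> M d by (intro mult_left_mono powr_mono2) (auto simp: d_def)
      also have "\<dots> = M * (e / (M + 1))" using \<alpha> e M by (simp add: powr_powr)
      also have "\<dots> < e" using e M by (simp add: field_simps)
      finally show ?thesis .
    qed
    thus "\<exists>d>0. \<forall>x\<in>S. \<forall>x'\<in>S. dist x' x < d \<longrightarrow> dist (g x') (g x) < e" using d by blast
  qed
  then obtain f where f: "uniformly_continuous_on (closure S) f" "\<And>z. z \<in> S \<Longrightarrow> g z = f z"
    by (rule uniformly_continuous_on_extension_on_closure) blast
  have cf: "continuous_on UNIV f" using f(1) S uniformly_continuous_imp_continuous by metis
  have "norm (f z - f w) \<le> M * norm (z - w) powr \<alpha>" if zw: "norm (z - w) < 1" for z w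
  proof -
    obtain x y where x: "\<And>n. x n \<in> S" "x \<longlonglongrightarrow> z" and y: "\<And>n. y n \<in> S" "y \<longlonglongrightarrow> w"
      using S closure_sequential[of z S] closure_sequential[of w S] by auto
    have fx: "(\<lambda>n. f (x n)) \<longlonglongrightarrow> f z" "(\<lambda>n. f (y n)) \<longlonglongrightarrow> f w"
      using cf x(2) y(2) by (auto intro: continuous_on_tendsto_compose)
    have xy: "(\<lambda>n. norm (x n - y n)) \<longlonglongrightarrow> norm (z - w)" by (intro tendsto_intros x y)
    have "\<forall>\<^sub>F n in sequentially. norm (x n - y n) < 1" using xy zw by (rule order_tendstoD(2))
    hence ev: "\<forall>\<^sub>F n in sequentially. norm (f (x n) - f (y n)) \<le> M * norm (x n - y n) powr \<alpha>"
    proof eventually_elim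
      case (elim n)
      thus ?case using g[OF x(1)[of n] y(1)[of n]] f(2) x(1) y(1) by (simp add: dist_norm)
    qed
    have "(\<lambda>n. M * norm (x n - y n) powr \<alpha>) \<longlonglongrightarrow> M * norm (z - w) powr \<alpha>"
      using \<alpha> by (intro tendsto_mult tendsto_const tendsto_powr' xy) auto
    moreover have "(\<lambda>n. norm (f (x n) - f (y n))) \<longlonglongrightarrow> norm (f z - f w)" by (intro tendsto_intros fx)
    ultimately show ?thesis using ev by (intro tendsto_le[of sequentially]) auto
  qed
  hence "Lip \<alpha> f" unfolding Lip_def by blast
  thus thesis using that[of f] cf f(2) by simp
qed

section \<open>Testing against Cauchy kernels\<close>

text \<open>The Cauchy transform of the uniform probability measure on a disc: a Lipschitz substitute for
  the Cauchy kernel.\<close>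

definition disc_kernel :: "complex \<Rightarrow> real \<Rightarrow> complex \<Rightarrow> complex" where
  "disc_kernel c \<rho> z = cnj (z - c) / of_real ((max \<rho> (norm (z - c)))\<^sup>2)"

lemma disc_kernel_inside: "norm (z - c) \<le> \<rho> \<Longrightarrow> disc_kernel c \<rho> z = cnj (z - c) / of_real (\<rho>\<^sup>2)"
  by (simp add: disc_kernel_def max_absorb1)

lemma disc_kernel_outside:
  assumes "norm (z - c) \<ge> \<rho>" "\<rho> > 0"
  shows "disc_kernel c \<rho> z = 1 / (z - c)"
proof -
  have "z - c \<noteq> 0" using assms by auto
  thus ?thesis using assms complex_norm_square[of "z - c"]
    by (simp add: disc_kernel_def max_absorb2 divide_simps)
qed

lemma disc_kernel_Lipschitz:
  assumes \<rho>: "\<rho> > 0"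
  shows "norm (disc_kernel c \<rho> w - disc_kernel c \<rho> z) \<le> 3 / \<rho>\<^sup>2 * dist z w"
proof -
  have *: "norm (disc_kernel c \<rho> w - disc_kernel c \<rho> z) \<le> 3 / \<rho>\<^sup>2 * dist z w"
    if le: "norm (z - c) \<le> norm (w - c)" for z w
  proof -
    define x y M N where "x = z - c" and "y = w - c" and "M = max \<rho> (norm x)" and "N = max \<rho> (norm y)"
    have xy: "norm x \<le> norm y" "norm (y - x) = dist z w"
      using le by (simp_all add: x_def y_def dist_norm norm_minus_commute)
    have MN: "0 < M" "M \<le> N" "\<rho> \<le> M" "norm x \<le> M" "N - M \<le> dist z w"
      using \<rho> xy norm_triangle_ineq2[of y x] by (auto simp: M_def N_def)
    have N0: "0 < N" using MN by linarith
    \<comment> \<open>The changes of numerator and denominator are bounded separately; they account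
      for 1 and 2 in the constant 3.\<close>
    have "disc_kernel c \<rho> w - disc_kernel c \<rho> z
        = cnj (y - x) / of_real (N\<^sup>2) - cnj x * of_real ((N\<^sup>2 - M\<^sup>2) / (M\<^sup>2 * N\<^sup>2))"
      using MN N0 by (simp add: disc_kernel_def x_def[symmetric] y_def[symmetric] M_def[symmetric]
          N_def[symmetric] field_simps)
    hence "norm (disc_kernel c \<rho> w - disc_kernel c \<rho> z)
        \<le> norm (cnj (y - x) / of_real (N\<^sup>2)) + norm (cnj x * of_real ((N\<^sup>2 - M\<^sup>2) / (M\<^sup>2 * N\<^sup>2)))"
      by (metis norm_triangle_ineq4)
    also have "norm (cnj (y - x) / of_real (N\<^sup>2)) = dist z w / N\<^sup>2"
      unfolding norm_divide complex_mod_cnj xy by (simp add: norm_power)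
    also have "\<dots> \<le> dist z w / \<rho>\<^sup>2"
      using MN \<rho> by (intro divide_left_mono power_mono) auto
    also have "norm (cnj x * of_real ((N\<^sup>2 - M\<^sup>2) / (M\<^sup>2 * N\<^sup>2))) = norm x * ((N\<^sup>2 - M\<^sup>2) / (M\<^sup>2 * N\<^sup>2))"
    proof -
      have "0 \<le> (N\<^sup>2 - M\<^sup>2) / (M\<^sup>2 * N\<^sup>2)" using MN by (auto intro!: divide_nonneg_nonneg power_mono)
      thus ?thesis unfolding norm_mult complex_mod_cnj norm_of_real by (simp only: abs_of_nonneg)
    qed
    also have "\<dots> \<le> M * ((N\<^sup>2 - M\<^sup>2) / (M\<^sup>2 * N\<^sup>2))"
      using MN by (intro mult_right_mono) (auto intro!: divide_nonneg_nonneg power_mono)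
    also have "\<dots> = (N - M) * ((N + M) / (M * N\<^sup>2))"
      using MN by (simp add: power2_eq_square field_simps)
    also have "\<dots> \<le> dist z w * (2 / \<rho>\<^sup>2)"
    proof (intro mult_mono)
      have "(N + M) / (M * N\<^sup>2) \<le> (2 * N) / (M * N\<^sup>2)" using MN by (intro divide_right_mono) auto
      also have "\<dots> = 2 / (M * N)" using N0 by (simp add: power2_eq_square)
      also have "\<dots> \<le> 2 / \<rho>\<^sup>2" using MN \<rho> unfolding power2_eq_square
        by (intro divide_left_mono mult_mono) auto
      finally show "(N + M) / (M * N\<^sup>2) \<le> 2 / \<rho>\<^sup>2" .
    qed (use MN in auto)
    finally show ?thesis by simp
  qed
  show ?thesis
  proof (cases "norm (z - c) \<le> norm (w - c)")
    case False
    thus ?thesis using *[of w z] by (simp add: norm_minus_commute dist_commute)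
  qed (rule *)
qed

text \<open>On the ball the kernel is a multiple of \<open>cnj (z - c)\<close>, which
  \<open>\<partial>_x + \<i> * \<partial>_y\<close> turns into the constant
  \<open>2 / \<rho>^2\<close>; outside the kernel is holomorphic and the same operator annihilates
  it. Integration by parts moves the operator to \<open>\<eta>\<close>.\<close>

lemma integral_disc_kernel:
  assumes \<eta>: "test_function UNIV \<eta>" and \<rho>: "\<rho> > 0"
  shows "(LINT z|lebesgue. (of_real (frechet_derivative \<eta> (at z) 1)
        + \<i> * of_real (frechet_derivative \<eta> (at z) \<i>)) * disc_kernel c \<rho> z)
    = of_real (- (2 / \<rho>\<^sup>2) * (LINT z|lebesgue. indicator (ball c \<rho>) z * \<eta> z))"
proof -
  let ?k = "disc_kernel c \<rho>"
  \<comment> \<open>The derivative in direction \<open>v\<close>; on the circle, a null set, the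
    value is an arbitrary choice.\<close>
  define g where "g v z = (if norm (z - c) < \<rho> then cnj v / of_real (\<rho>\<^sup>2) else - v / (z - c)\<^sup>2)" for v z
  have cont: "continuous_on UNIV ?k"
    unfolding disc_kernel_def using \<rho> by (intro continuous_intros) (auto simp: max_def)
  have gb: "g v \<in> borel_measurable borel" for v unfolding g_def by measurable
  have d: "(?k has_derivative (\<lambda>v. g v z)) (at z)" if z: "z \<notin> sphere c \<rho>" for z
  proof (cases "norm (z - c) < \<rho>")
    case True
    have "((\<lambda>z. cnj (z - c) * inverse (of_real (\<rho>\<^sup>2))) has_derivative (\<lambda>v. cnj v * inverse (of_real (\<rho>\<^sup>2)))) (at z)"
      by (auto intro!: derivative_eq_intros)
    hence "((\<lambda>z. cnj (z - c) / of_real (\<rho>\<^sup>2)) has_derivative (\<lambda>v. cnj v / of_real (\<rho>\<^sup>2))) (at z)"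
      by (simp only: divide_inverse)
    hence "(?k has_derivative (\<lambda>v. cnj v / of_real (\<rho>\<^sup>2))) (at z)"
    proof (rule has_derivative_transform_within_open[OF _ open_ball[of c \<rho>]])
      show "z \<in> ball c \<rho>" using True by (simp add: dist_norm norm_minus_commute)
      show "cnj (y - c) / of_real (\<rho>\<^sup>2) = ?k y" if "y \<in> ball c \<rho>" for y
        using that disc_kernel_inside[of y c \<rho>] by (simp add: dist_norm norm_minus_commute)
    qed
    thus ?thesis using True by (simp add: g_def)
  next
    case False
    have zc: "z - c \<noteq> 0" using False \<rho> by auto
    have "((\<lambda>z. 1 / (z - c)) has_field_derivative (- 1 / (z - c)\<^sup>2)) (at z)"
      using zc by (auto intro!: derivative_eq_intros simp: power2_eq_square)
    hence "((\<lambda>z. 1 / (z - c)) has_derivative (\<lambda>v. - v / (z - c)\<^sup>2)) (at z)"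
      by (rule has_derivative_eq_rhs[OF has_field_derivative_imp_has_derivative]) (auto simp: fun_eq_iff)
    hence "(?k has_derivative (\<lambda>v. - v / (z - c)\<^sup>2)) (at z)"
    proof (rule has_derivative_transform_within_open[where s = "- cball c \<rho>"])
      show "z \<in> - cball c \<rho>" using False z by (simp add: dist_norm norm_minus_commute)
      show "1 / (y - c) = ?k y" if "y \<in> - cball c \<rho>" for y
        using that \<rho> disc_kernel_outside[of \<rho> y c] by (simp add: dist_norm norm_minus_commute)
    qed auto
    thus ?thesis using False by (simp add: g_def)
  qed
  have wd: "weak_derivative UNIV v ?k (g v)" for v
  proof (rule weak_derivativeI(1)[OF open_UNIV cont _ gb])
    fix L :: "complex set"
    show "\<exists>\<epsilon>>0. \<exists>C. \<forall>z\<in>L. \<forall>w. dist z w < \<epsilon> \<longrightarrow> norm (?k w - ?k z) \<le> C * dist z w"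
      using disc_kernel_Lipschitz[OF \<rho>] by (intro exI[of _ 1] conjI exI[of _ "3 / \<rho>\<^sup>2"]) auto
    have "AE z in lebesgue. z \<notin> sphere c \<rho>"
      by (rule AE_not_in) (simp only: negligible_iff_null_sets[symmetric] negligible_sphere)
    thus "AE z in lebesgue. z \<in> UNIV \<longrightarrow>
        (\<lambda>n. real (Suc n) *\<^sub>R (?k (z + v /\<^sub>R real (Suc n)) - ?k z)) \<longlonglongrightarrow> g v z"
      by eventually_elim (intro impI difference_quotient_tendsto d)
  qed
  have ibp: "(LINT z|lebesgue. frechet_derivative \<eta> (at z) v *\<^sub>R ?k z) = - (LINT z|lebesgue. \<eta> z *\<^sub>R g v z)" for v
    using wd[of v] \<eta> unfolding weak_derivative_def by (simp add: set_lebesgue_integral_def)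
  obtain B where B: "\<And>z. z \<in> closure {z. \<eta> z \<noteq> 0} \<Longrightarrow> norm z \<le> B"
  proof -
    have "bounded (closure {z. \<eta> z \<noteq> 0})"
      using \<eta> compact_imp_bounded by (auto simp: test_function_def)
    thus ?thesis using that unfolding bounded_iff by blast
  qed
  note tD = test_functionD[OF \<eta>]
  have i1: "integrable lebesgue (\<lambda>z. frechet_derivative \<eta> (at z) v *\<^sub>R ?k z)" for v
  proof (rule integrable_continuous_bounded_support(2))
    show "continuous_on UNIV (\<lambda>z. frechet_derivative \<eta> (at z) v *\<^sub>R ?k z)"
      using tD(3) cont by (intro continuous_intros)
    show "frechet_derivative \<eta> (at z) v *\<^sub>R ?k z = 0" if "norm z > B" for z
      using that B[of z] tD(5)[of z v] by auto
  qed
  have i2: "integrable lebesgue (\<lambda>z. \<eta> z *\<^sub>R g v z)" if v: "norm v = 1" for v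
  proof (rule Bochner_Integration.integrable_bound)
    have "integrable lebesgue \<eta>"
    proof (rule integrable_continuous_bounded_support(2)[OF tD(2)])
      show "\<eta> z = 0" if "norm z > B" for z
        using that B[of z] tD(4)[of z] by auto
    qed
    thus "integrable lebesgue (\<lambda>z. \<eta> z * (1 / \<rho>\<^sup>2))" by simp
    have "\<eta> \<in> borel_measurable borel" using borel_measurable_continuous_onI[OF tD(2)] .
    hence "(\<lambda>z. \<eta> z *\<^sub>R g v z) \<in> borel_measurable lborel" using gb[of v] by measurable
    thus "(\<lambda>z. \<eta> z *\<^sub>R g v z) \<in> borel_measurable lebesgue" by (rule measurable_completion)
    have "norm (g v z) \<le> 1 / \<rho>\<^sup>2" for z
    proof (cases "norm (z - c) < \<rho>")
      case False
      hence "\<rho>\<^sup>2 \<le> (norm (z - c))\<^sup>2" using \<rho> by (intro power_mono) auto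
      moreover have "0 < norm (z - c)" using False \<rho> by linarith
      ultimately show ?thesis
        using \<rho> v False by (simp add: g_def norm_divide norm_power frac_le)
    qed (use \<rho> v in \<open>simp add: g_def norm_divide norm_power\<close>)
    thus "AE z in lebesgue. norm (\<eta> z *\<^sub>R g v z) \<le> norm (\<eta> z * (1 / \<rho>\<^sup>2))"
      using mult_left_mono[of "norm (g v _)" "1 / \<rho>\<^sup>2" "\<bar>\<eta> _\<bar>"] by (intro AE_I2) (simp add: abs_mult)
  qed
  have "(LINT z|lebesgue. (of_real (frechet_derivative \<eta> (at z) 1)
        + \<i> * of_real (frechet_derivative \<eta> (at z) \<i>)) * ?k z)
     = (LINT z|lebesgue. frechet_derivative \<eta> (at z) 1 *\<^sub>R ?k z + \<i> * (frechet_derivative \<eta> (at z) \<i> *\<^sub>R ?k z))"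
    by (simp add: scaleR_conv_of_real algebra_simps)
  also have "\<dots> = - ((LINT z|lebesgue. \<eta> z *\<^sub>R g 1 z) + \<i> * (LINT z|lebesgue. \<eta> z *\<^sub>R g \<i> z))"
    using i1 by (subst Bochner_Integration.integral_add) (simp_all only: integrable_mult_right integral_mult_right_zero ibp, simp)
  also have "(LINT z|lebesgue. \<eta> z *\<^sub>R g 1 z) + \<i> * (LINT z|lebesgue. \<eta> z *\<^sub>R g \<i> z)
      = (LINT z|lebesgue. \<eta> z *\<^sub>R g 1 z + \<i> * (\<eta> z *\<^sub>R g \<i> z))"
    using i2[of 1] i2[of \<i>]
    by (subst Bochner_Integration.integral_add) (simp_all del: mult_scaleR_right)
  also have "(\<lambda>z. \<eta> z *\<^sub>R g 1 z + \<i> * (\<eta> z *\<^sub>R g \<i> z))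
      = (\<lambda>z. complex_of_real (2 / \<rho>\<^sup>2 * (indicator (ball c \<rho>) z * \<eta> z)))"
    by (auto simp: fun_eq_iff g_def indicator_def dist_norm norm_minus_commute scaleR_conv_of_real
        algebra_simps)
  also have "(LINT z|lebesgue. complex_of_real (2 / \<rho>\<^sup>2 * (indicator (ball c \<rho>) z * \<eta> z)))
      = of_real (2 / \<rho>\<^sup>2 * (LINT z|lebesgue. indicator (ball c \<rho>) z * \<eta> z))"
    by (simp only: integral_complex_of_real integral_mult_right_zero)
  finally show ?thesis by simp
qed

text \<open>Twice the conjugate complex derivative of \<open>\<eta>\<close>.\<close>

definition test_gradient :: "(complex \<Rightarrow> real) \<Rightarrow> complex \<Rightarrow> complex" where
  "test_gradient \<eta> z = of_real (frechet_derivative \<eta> (at z) 1) + \<i> * of_real (frechet_derivative \<eta> (at z) \<i>)"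

lemma frechet_derivative_locally_const:
  assumes "open S" "z \<in> S" "\<And>w. w \<in> S \<Longrightarrow> \<eta> w = c"
  shows "frechet_derivative \<eta> (at z) v = 0"
proof -
  have "((\<lambda>_. c) has_derivative (\<lambda>_. 0)) (at z)" by simp
  hence "(\<eta> has_derivative (\<lambda>_. 0)) (at z)"
    by (rule has_derivative_transform_within_open[OF _ assms(1,2)]) (simp add: assms(3))
  thus ?thesis by (metis frechet_derivative_at)
qed

lemma test_gradient_plateau_0:
  assumes "0 \<le> r" "r < r'" "norm (z - a) < r \<or> norm (z - a) > r'"
  shows "test_gradient (plateau a r r') z = 0"
proof -
  have "frechet_derivative (plateau a r r') (at z) v = 0" for v
  proof (cases "norm (z - a) < r")
    case True
    show ?thesis
    proof (rule frechet_derivative_locally_const[of "ball a r" _ _ 1])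
      show "z \<in> ball a r" using True by (simp add: dist_norm norm_minus_commute)
      show "plateau a r r' w = 1" if "w \<in> ball a r" for w
        using that by (intro plateau_eq_1 assms) (simp add: dist_norm norm_minus_commute)
    qed simp
  next
    case False
    show ?thesis
    proof (rule frechet_derivative_locally_const[of "- cball a r'" _ _ 0])
      show "z \<in> - cball a r'" using False assms by (simp add: dist_norm norm_minus_commute)
      show "plateau a r r' w = 0" if "w \<in> - cball a r'" for w
        using that by (intro plateau_eq_0 assms) (simp add: dist_norm norm_minus_commute)
    qed (simp add: open_Compl)
  qed
  thus ?thesis by (simp add: test_gradient_def)
qed

lemma continuous_test_gradient:
  assumes "test_function \<Omega> \<eta>" shows "continuous_on UNIV (test_gradient \<eta>)"
  unfolding test_gradient_def[abs_def] using test_functionD(3)[OF assms] by (intro continuous_intros)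

lemma continuous_disc_kernel: "\<rho> > 0 \<Longrightarrow> continuous_on UNIV (disc_kernel c \<rho>)"
  unfolding disc_kernel_def by (intro continuous_intros) (auto simp: max_def)

text \<open>Cauchy's formula for a smooth cutoff. The gradient lives on the ring between
  \<open>r\<close> and \<open>r'\<close>, where \<open>1 / (z - c)\<close> agrees with the kernel of
  the disc of radius \<open>\<rho>\<close> about \<open>c\<close>. On that disc the cutoff is
  constantly 1 or constantly 0, so \<open>integral_disc_kernel\<close> gives \<open>- 2 * pi\<close>
  or 0.\<close>

lemma
  assumes r: "0 < r" "r < r'" and c: "norm (c - a) < r \<or> norm (c - a) > r'"
  shows integrable_plateau_Cauchy: "integrable lebesgue (\<lambda>z. test_gradient (plateau a r r') z * (1 / (z - c)))"
    and integral_plateau_Cauchy: "(LINT z|lebesgue. test_gradient (plateau a r r') z * (1 / (z - c))) =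
      (if norm (c - a) < r then - 2 * pi else 0)"
proof -
  define \<rho> where "\<rho> = (if norm (c - a) < r then r - norm (c - a) else norm (c - a) - r')"
  have \<rho>: "\<rho> > 0" using c by (auto simp: \<rho>_def)
  have r0: "0 \<le> r" using r by simp
  let ?\<eta> = "plateau a r r'"
  have tf: "test_function UNIV ?\<eta>" by (rule test_function_plateau[OF r0 r(2)])
  have eq: "test_gradient ?\<eta> z * (1 / (z - c)) = test_gradient ?\<eta> z * disc_kernel c \<rho> z" for z
  proof (cases "norm (z - a) < r \<or> norm (z - a) > r'")
    case True
    thus ?thesis by (simp add: test_gradient_plateau_0[OF r0 r(2)])
  next
    case False
    hence "\<rho> \<le> norm (z - c)"
      using norm_triangle_ineq2[of "z - a" "c - a"] norm_triangle_ineq2[of "c - a" "z - a"] c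
      by (auto simp: \<rho>_def norm_minus_commute)
    thus ?thesis using disc_kernel_outside[OF _ \<rho>] by simp
  qed
  have supp: "test_gradient ?\<eta> z * disc_kernel c \<rho> z = 0" if "norm z > norm a + r'" for z
    using that norm_triangle_ineq2[of z a] by (simp add: test_gradient_plateau_0[OF r0 r(2)])
  have "continuous_on UNIV (\<lambda>z. test_gradient ?\<eta> z * disc_kernel c \<rho> z)"
    by (intro continuous_intros continuous_test_gradient[OF tf] continuous_disc_kernel \<rho>)
  thus "integrable lebesgue (\<lambda>z. test_gradient ?\<eta> z * (1 / (z - c)))"
    unfolding eq using supp by (rule integrable_continuous_bounded_support(2))
  have "(LINT z|lebesgue. test_gradient ?\<eta> z * (1 / (z - c)))
      = of_real (- (2 / \<rho>\<^sup>2) * (LINT z|lebesgue. indicator (ball c \<rho>) z * ?\<eta> z))"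
    using integral_disc_kernel[OF tf \<rho>, of c] unfolding eq by (simp only: test_gradient_def)
  also have "(LINT z|lebesgue. indicator (ball c \<rho>) z * ?\<eta> z)
      = (if norm (c - a) < r then pi * \<rho>\<^sup>2 else 0)"
  proof (cases "norm (c - a) < r")
    case True
    have "(LINT z|lebesgue. indicator (ball c \<rho>) z * ?\<eta> z) = (LINT z|lebesgue. indicator (ball c \<rho>) z)"
    proof (intro Bochner_Integration.integral_cong refl)
      fix z :: complex
      show "indicator (ball c \<rho>) z * ?\<eta> z = indicator (ball c \<rho>) z"
      proof (cases "z \<in> ball c \<rho>")
        case inb: True
        have "norm (z - a) \<le> r"
          using inb True norm_triangle_ineq[of "z - c" "c - a"] by (simp add: \<rho>_def dist_norm norm_minus_commute)
        thus ?thesis using plateau_eq_1[OF r0 r(2)] by simp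
      qed simp
    qed
    also have "\<dots> = measure lebesgue (ball c \<rho>)" by simp
    also have "\<dots> = pi * \<rho>\<^sup>2" using content_ball[of \<rho> c] \<rho> by (simp add: unit_ball_vol_2)
    finally show ?thesis using True by simp
  next
    case False
    have z0: "indicator (ball c \<rho>) z * ?\<eta> z = 0" for z
    proof (cases "z \<in> ball c \<rho>")
      case inb: True
      have "norm (z - a) \<ge> r'"
        using inb False norm_triangle_ineq2[of "c - a" "c - z"] by (simp add: \<rho>_def dist_norm)
      thus ?thesis using plateau_eq_0[OF r0 r(2)] by simp
    qed simp
    show ?thesis using False unfolding z0 by simp
  qed
  also have "complex_of_real (- (2 / \<rho>\<^sup>2) * (if norm (c - a) < r then pi * \<rho>\<^sup>2 else 0))
      = (if norm (c - a) < r then - 2 * pi else 0)" using \<rho> by simp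
  finally show "(LINT z|lebesgue. test_gradient (plateau a r r') z * (1 / (z - c))) =
      (if norm (c - a) < r then - 2 * pi else 0)" .
qed

text \<open>Completing the square replaces the Cauchy--Schwarz inequality.\<close>

lemma energy_lower_bound:
  fixes g :: "complex \<Rightarrow> complex"
  assumes r: "0 < r" "r < r'" "r' \<le> 2 * r" and m: "0 \<le> m"
    and int: "set_integrable lebesgue (cball a r') (\<lambda>z. (norm (g z))\<^sup>2)"
    and g: "set_integrable lebesgue (cball a r') g"
    and lower: "2 * pi * m \<le> norm (LINT z|lebesgue. plateau a r r' z *\<^sub>R g z)"
  shows "pi * m\<^sup>2 / r\<^sup>2 \<le> (LINT z:cball a r'|lebesgue. (norm (g z))\<^sup>2)"
proof (cases "m = 0")
  case True
  have "0 \<le> (LINT z:cball a r'|lebesgue. (norm (g z))\<^sup>2)"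
    unfolding set_lebesgue_integral_def by (intro Bochner_Integration.integral_nonneg) auto
  thus ?thesis using True by simp
next
  case False
  hence m: "0 < m" using m by simp
  let ?B = "cball a r'"
  define X where "X = (LINT z:?B|lebesgue. (norm (g z))\<^sup>2)"
  \<comment> \<open>The weight in \<open>norm (g z) \<le> t / 2 + (norm (g z))^2 / (2 * t)\<close>.
    As \<open>r' \<le> 2 * r\<close>, the first term integrates to at most \<open>pi * m\<close>,
    half of the assumed lower bound.\<close>
  define t where "t = m / (2 * r\<^sup>2)"
  have t: "0 < t" using m r by (simp add: t_def)
  have r0: "0 \<le> r" using r by simp
  have iB: "integrable lebesgue (indicator ?B :: complex \<Rightarrow> real)"
    using lmeasurable_cball[of a r'] by (intro integrable_real_indicator) (auto simp: fmeasurable_def)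
  have "norm (LINT z|lebesgue. plateau a r r' z *\<^sub>R g z) \<le> (LINT z|lebesgue. norm (plateau a r r' z *\<^sub>R g z))"
    by (rule integral_norm_bound)
  also have "\<dots> \<le> (LINT z|lebesgue. t / 2 * indicator ?B z + 1 / (2 * t) * (indicator ?B z *\<^sub>R (norm (g z))\<^sup>2))"
  proof (rule integral_mono')
    show "integrable lebesgue (\<lambda>z. t / 2 * indicator ?B z + 1 / (2 * t) * (indicator ?B z *\<^sub>R (norm (g z))\<^sup>2))"
      using int unfolding set_integrable_def
      by (intro Bochner_Integration.integrable_add integrable_mult_right iB)
    fix z :: complex
    show "0 \<le> t / 2 * indicator ?B z + 1 / (2 * t) * (indicator ?B z *\<^sub>R (norm (g z))\<^sup>2)" using t by simp
    show "norm (plateau a r r' z *\<^sub>R g z) \<le> t / 2 * indicator ?B z + 1 / (2 * t) * (indicator ?B z *\<^sub>R (norm (g z))\<^sup>2)"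
    proof (cases "z \<in> ?B")
      case True
      have "norm (plateau a r r' z *\<^sub>R g z) \<le> 1 * norm (g z)"
        unfolding norm_scaleR using plateau_nonneg[OF r0 r(2)] plateau_le_1[OF r0 r(2)]
        by (intro mult_right_mono) auto
      also have "\<dots> \<le> t / 2 + 1 / (2 * t) * (norm (g z))\<^sup>2"
      proof -
        have "0 \<le> (norm (g z) - t)\<^sup>2" by simp
        hence "2 * t * norm (g z) \<le> t\<^sup>2 + (norm (g z))\<^sup>2" by (simp add: power2_diff mult_ac add.commute)
        hence "2 * t * norm (g z) / (2 * t) \<le> (t\<^sup>2 + (norm (g z))\<^sup>2) / (2 * t)" using t by (intro divide_right_mono) auto
        thus ?thesis using t by (simp add: add_divide_distrib power2_eq_square)
      qed
      finally show ?thesis using True by simp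
    next
      case False
      hence "plateau a r r' z = 0" by (intro plateau_eq_0[OF r0 r(2)]) (simp add: dist_norm norm_minus_commute)
      thus ?thesis using False by simp
    qed
  qed
  also have "\<dots> = t / 2 * (pi * r'\<^sup>2) + 1 / (2 * t) * X"
  proof -
    have "(LINT z|lebesgue. indicator ?B z) = pi * r'\<^sup>2"
      using content_cball[of r' a] r by (simp add: unit_ball_vol_2)
    thus ?thesis unfolding X_def set_lebesgue_integral_def
      using int iB unfolding set_integrable_def by (subst Bochner_Integration.integral_add) auto
  qed
  also have "\<dots> \<le> t / 2 * (pi * (2 * r)\<^sup>2) + 1 / (2 * t) * X"
    using t r by (intro add_right_mono mult_left_mono power_mono) auto
  also have "\<dots> = pi * m + r\<^sup>2 / m * X" using m r by (simp add: t_def power2_eq_square)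
  finally have "2 * pi * m \<le> pi * m + r\<^sup>2 / m * X" using lower by linarith
  hence "pi * m \<le> r\<^sup>2 / m * X" by simp
  hence "pi * m * (m / r\<^sup>2) \<le> r\<^sup>2 / m * X * (m / r\<^sup>2)" using m by (intro mult_right_mono) auto
  thus ?thesis using m r unfolding X_def[symmetric] by (simp add: power2_eq_square)
qed

section \<open>Disc packings and discrete Cauchy transforms\<close>

lemma
  fixes r :: "complex \<Rightarrow> real"
  assumes "finite I" "\<And>p. p \<in> I \<Longrightarrow> r p \<ge> 0"
    and "\<And>p q. p \<in> I \<Longrightarrow> q \<in> I \<Longrightarrow> p \<noteq> q \<Longrightarrow> r p + r q < dist p q"
  shows disjoint_discs_measure: "measure lborel (\<Union>p\<in>I. cball p (r p)) = pi * (\<Sum>p\<in>I. (r p)\<^sup>2)"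
    and disjoint_discs_sum_le: "\<lbrakk>\<rho> \<ge> 0; \<And>p. p \<in> I \<Longrightarrow> dist x p + r p \<le> \<rho>\<rbrakk> \<Longrightarrow> (\<Sum>p\<in>I. (r p)\<^sup>2) \<le> \<rho>\<^sup>2"
proof -
  have c: "measure lborel (cball p s) = pi * s\<^sup>2" if "s \<ge> 0" for p :: complex and s
    using content_cball[OF that, of p] by (simp add: unit_ball_vol_2)
  have "disjoint_family_on (\<lambda>p. cball p (r p)) I"
    unfolding disjoint_family_on_def
  proof (intro ballI impI)
    fix p q assume pq: "p \<in> I" "q \<in> I" "p \<noteq> q"
    show "cball p (r p) \<inter> cball q (r q) = {}"
    proof (rule ccontr)
      assume "cball p (r p) \<inter> cball q (r q) \<noteq> {}"
      then obtain y where "dist p y \<le> r p" "dist q y \<le> r q" by auto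
      hence "dist p q \<le> r p + r q" by metric
      thus False using assms(3)[OF pq] by linarith
    qed
  qed
  hence "measure lborel (\<Union>p\<in>I. cball p (r p)) = (\<Sum>p\<in>I. measure lborel (cball p (r p)))"
    using assms(1) emeasure_lborel_cball_finite
    by (intro measure_finite_Union) (auto simp: less_top[symmetric])
  also have "\<dots> = (\<Sum>p\<in>I. pi * (r p)\<^sup>2)" using assms(2) by (intro sum.cong) (auto simp: c)
  finally show *: "measure lborel (\<Union>p\<in>I. cball p (r p)) = pi * (\<Sum>p\<in>I. (r p)\<^sup>2)"
    by (simp add: sum_distrib_left)
  assume \<rho>: "\<rho> \<ge> 0" and sub: "\<And>p. p \<in> I \<Longrightarrow> dist x p + r p \<le> \<rho>"
  have "measure lborel (\<Union>p\<in>I. cball p (r p)) \<le> measure lborel (cball x \<rho>)"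
  proof (rule measure_mono_fmeasurable)
    show "(\<Union>p\<in>I. cball p (r p)) \<subseteq> cball x \<rho>"
    proof
      fix y assume "y \<in> (\<Union>p\<in>I. cball p (r p))"
      then obtain p where "p \<in> I" "dist p y \<le> r p" by auto
      thus "y \<in> cball x \<rho>" using sub[of p] dist_triangle[of x y p] by simp
    qed
    show "(\<Union>p\<in>I. cball p (r p)) \<in> sets lborel" using assms(1) by auto
    show "cball x \<rho> \<in> fmeasurable lborel"
      using emeasure_lborel_cball_finite[of x \<rho>] by (auto simp: fmeasurable_def)
  qed
  thus "(\<Sum>p\<in>I. (r p)\<^sup>2) \<le> \<rho>\<^sup>2" using * c[OF \<rho>, of x] by simp
qed

lemma disjoint_cballs_dist:
  fixes p q :: "'a::real_normed_vector"
  assumes "r > 0" "s > 0" "cball p r \<inter> cball q s = {}"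
  shows "r + s < dist p q"
proof (rule ccontr)
  assume *: "\<not> r + s < dist p q"
  define x where "x = p + (r / (r + s)) *\<^sub>R (q - p)"
  have n: "norm (q - p) \<le> r + s" using * by (simp add: dist_norm norm_minus_commute)
  have "norm (x - p) = r / (r + s) * norm (q - p)" using assms by (simp add: x_def)
  also have "\<dots> \<le> r / (r + s) * (r + s)" using assms n by (intro mult_left_mono) auto
  finally have 1: "norm (x - p) \<le> r" using assms by simp
  have "q - x = (1 - r / (r + s)) *\<^sub>R (q - p)" by (simp add: x_def algebra_simps)
  also have "1 - r / (r + s) = s / (r + s)" using assms by (simp add: field_simps)
  finally have "norm (q - x) = s / (r + s) * norm (q - p)" using assms by simp
  also have "\<dots> \<le> s / (r + s) * (r + s)" using assms n by (intro mult_left_mono) auto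
  finally have "norm (q - x) \<le> s" using assms by simp
  hence "x \<in> cball p r \<inter> cball q s" using 1 by (simp add: dist_norm norm_minus_commute)
  thus False using assms(3) by blast
qed

text \<open>Vitali's theorem fills the disc up to a null set, and finitely many of its discs cover
  the share \<open>sqrt \<tau>\<close> of the area. Shrinking all radii by \<open>\<theta>\<close>
  with \<open>\<theta>^2 = sqrt \<tau>\<close> costs the other factor \<open>sqrt \<tau>\<close> and
  creates the rings between \<open>R\<close> and \<open>R'\<close>. The bound
  \<open>1/4 \<le> \<tau>\<close> yields \<open>1/2 \<le> \<theta>\<close> and hence
  \<open>R' \<le> 2 * R\<close>.\<close>

lemma disc_packing:
  fixes \<tau> \<rho> :: real
  assumes \<tau>: "1/4 \<le> \<tau>" "\<tau> < 1" and \<rho>: "\<rho> > 0"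
  shows "\<exists>I R R'. finite I \<and>
     (\<forall>p\<in>I. 0 < R p \<and> R p < R' p \<and> R' p \<le> 2 * R p \<and> norm p + R' p \<le> 1 \<and> R p \<le> \<rho>) \<and>
     (\<forall>p\<in>I. \<forall>q\<in>I. p \<noteq> q \<longrightarrow> R' p + R' q < dist p q) \<and> \<tau> \<le> (\<Sum>p\<in>(I::complex set). (R p)\<^sup>2)"
proof -
  define K where "K = {(c::complex, r). r > 0 \<and> cball c r \<subseteq> ball 0 1 \<and> r < \<rho>}"
  obtain C where C: "countable C" "C \<subseteq> K"
      "pairwise (\<lambda>i j. disjnt (cball (fst i) (snd i)) (cball (fst j) (snd j))) C"
      "negligible (ball 0 1 - (\<Union>i\<in>C. cball (fst i) (snd i)))"
  proof (rule Vitali_covering_theorem_cballs[of K snd "ball 0 1" fst])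
    fix x :: complex and d :: real assume x: "x \<in> ball 0 1" "0 < d"
    define r where "r = min (min (d/2) (\<rho>/2)) ((1 - norm x)/2)"
    have "r > 0" using x \<rho> by (simp add: r_def)
    moreover have "cball x r \<subseteq> ball 0 1"
    proof
      fix y assume "y \<in> cball x r"
      moreover have "norm x + r < 1" using x by (auto simp: r_def min_def field_simps)
      ultimately show "y \<in> ball 0 1" using norm_triangle_ineq2[of y x] by (simp add: dist_norm norm_minus_commute)
    qed
    moreover have "r < \<rho>" "r < d" using x \<rho> by (auto simp: r_def)
    ultimately show "\<exists>i. i \<in> K \<and> x \<in> cball (fst i) (snd i) \<and> snd i < d"
      by (intro exI[of _ "(x, r)"]) (auto simp: K_def)
  next
    fix i :: "complex \<times> real" assume "i \<in> K"
    thus "0 < snd i" by (auto simp: K_def)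
  next
    fix C assume "countable C" "C \<subseteq> K"
      "pairwise (\<lambda>i j. disjnt (cball (fst i) (snd i)) (cball (fst j) (snd j))) C"
      "negligible (ball 0 1 - (\<Union>i\<in>C. cball (fst i) (snd i)))"
    thus thesis by (rule that)
  qed
  have CK: "snd i > 0" "cball (fst i) (snd i) \<subseteq> ball 0 1" "snd i < \<rho>" if "i \<in> C" for i
    using subsetD[OF C(2) that] by (auto simp: K_def case_prod_beta)
  define U where "U = (\<Union>i\<in>C. cball (fst i) (snd i))"
  have UB: "U \<in> sets borel" unfolding U_def using C(1) by auto
  have U1: "U \<subseteq> ball 0 1" unfolding U_def using CK by blast
  have Ufm: "U \<in> lmeasurable" using UB U1 by (intro fmeasurableI2[OF lmeasurable_ball[of 0 1]]) auto
  have mU: "measure lebesgue U = pi"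
  proof -
    have "measure lebesgue (ball (0::complex) 1) = measure lebesgue U"
      using C(4) U1 unfolding U_def[symmetric]
      by (intro measure_negligible_symdiff[symmetric] negligible_subset[OF C(4)[folded U_def]])
        (use UB in auto)
    thus ?thesis using content_ball[of 1 "0::complex"] by (simp add: unit_ball_vol_2)
  qed
  have Cne: "C \<noteq> {}" using mU U_def by auto
  define F where "F n = from_nat_into C ` {..<n}" for n
  define A where "A n = (\<Union>i\<in>F n. cball (fst i) (snd i))" for n
  have FC: "F n \<subseteq> C" "finite (F n)" for n using from_nat_into[OF Cne] by (auto simp: F_def)
  have "incseq A" unfolding incseq_def A_def F_def
    by (intro allI impI UN_mono image_mono) auto
  moreover have UA: "(\<Union>n. A n) = U"
  proof -
    have "(\<Union>n. F n) = C" using range_from_nat_into[OF Cne C(1)] by (auto simp: F_def)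
    thus ?thesis by (auto simp: A_def U_def)
  qed
  moreover have "range A \<subseteq> sets lebesgue" by (auto simp: A_def FC)
  ultimately have "(\<lambda>n. measure lebesgue (A n)) \<longlonglongrightarrow> measure lebesgue U"
    using Ufm by (metis Lim_measure_incseq fmeasurableD2 infinity_ennreal_def)
  moreover have sq: "0 < sqrt \<tau>" "sqrt \<tau> < 1" "1/2 \<le> sqrt \<tau>"
    using \<tau> real_le_rsqrt[of "1/2" \<tau>] by (auto simp: power2_eq_square)
  ultimately have "\<forall>\<^sub>F n in sequentially. pi * sqrt \<tau> < measure lebesgue (A n)"
    unfolding mU by (intro order_tendstoD(1)) auto
  then obtain n where n: "pi * sqrt \<tau> < measure lebesgue (A n)"
    by (auto simp: eventually_sequentially)
  define I where "I = fst ` F n"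
  \<comment> \<open>Discs are indexed by their centres, which are distinct because the closed discs
    are disjoint; so \<open>SOME\<close> finds the one disc with centre \<open>p\<close>.\<close>
  define R' where "R' p = snd (SOME i. i \<in> F n \<and> fst i = p)" for p
  have inj: "i = j" if ij: "i \<in> C" "j \<in> C" "fst i = fst j" for i j
  proof (rule ccontr)
    assume "i \<noteq> j"
    hence "disjnt (cball (fst i) (snd i)) (cball (fst j) (snd j))" using C(3) ij by (auto simp: pairwise_def)
    thus False using CK(1)[OF ij(1)] CK(1)[OF ij(2)] ij(3) by (auto simp: disjnt_iff)
      (metis dist_self less_imp_le)
  qed
  have R': "R' (fst i) = snd i" if "i \<in> F n" for i
  proof -
    have "(SOME j. j \<in> F n \<and> fst j = fst i) = i"
      using that FC inj by (intro some_equality) blast+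
    thus ?thesis by (simp add: R'_def)
  qed
  have disj: "R' p + R' q < dist p q" if pq: "p \<in> I" "q \<in> I" "p \<noteq> q" for p q
  proof -
    obtain i j where ij: "i \<in> F n" "p = fst i" "j \<in> F n" "q = fst j" using pq by (auto simp: I_def)
    have iC: "i \<in> C" "j \<in> C" "i \<noteq> j" using ij FC pq by auto
    hence "disjnt (cball p (R' p)) (cball q (R' q))"
      using C(3) R' ij by (auto simp: pairwise_def)
    moreover have "R' p > 0" "R' q > 0" using CK(1)[OF iC(1)] CK(1)[OF iC(2)] R' ij by auto
    ultimately show ?thesis
      using disjoint_cballs_dist[of "R' p" "R' q" p q] by (simp add: disjnt_def)
  qed
  have Ipos: "R' p > 0 \<and> norm p + R' p \<le> 1 \<and> R' p < \<rho>" if p: "p \<in> I" for p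
  proof -
    obtain i where i: "i \<in> F n" "p = fst i" using p by (auto simp: I_def)
    hence iC: "i \<in> C" using FC by auto
    have "cball p (R' p) \<subseteq> cball 0 1" "R' p > 0"
      using CK[OF iC] i R' ball_subset_cball[of 0 1] by auto
    hence "norm p + R' p \<le> 1" by (simp add: cball_subset_cball_iff)
    thus ?thesis using CK[OF iC] i R' by auto
  qed
  have "A n = (\<Union>p\<in>I. cball p (R' p))" using R' by (auto simp: A_def I_def)
  moreover have "measure lborel (\<Union>p\<in>I. cball p (R' p)) = pi * (\<Sum>p\<in>I. (R' p)\<^sup>2)"
    by (rule disjoint_discs_measure) (use FC disj Ipos in \<open>auto simp: I_def less_imp_le\<close>)
  moreover have "A n \<in> sets borel" by (auto simp: A_def FC)
  ultimately have "measure lebesgue (A n) = pi * (\<Sum>p\<in>I. (R' p)\<^sup>2)"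
    by (simp add: measure_completion)
  hence S: "sqrt \<tau> < (\<Sum>p\<in>I. (R' p)\<^sup>2)" using n by simp
  define \<theta> where "\<theta> = sqrt (sqrt \<tau>)"
  have th: "\<theta>\<^sup>2 = sqrt \<tau>" "\<theta> < 1" "0 < \<theta>" "1/2 \<le> \<theta>"
    using sq real_le_rsqrt[of "1/2" "sqrt \<tau>"] by (auto simp: \<theta>_def power2_eq_square)
  define R where "R p = \<theta> * R' p" for p
  have "\<tau> = sqrt \<tau> * sqrt \<tau>" using \<tau> by simp
  also have "\<dots> \<le> sqrt \<tau> * (\<Sum>p\<in>I. (R' p)\<^sup>2)" using S sq by (intro mult_left_mono) auto
  also have "\<dots> = (\<Sum>p\<in>I. (R p)\<^sup>2)" by (simp add: R_def power_mult_distrib th sum_distrib_left)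
  finally have "\<tau> \<le> (\<Sum>p\<in>I. (R p)\<^sup>2)" .
  moreover have "0 < R p \<and> R p < R' p \<and> R' p \<le> 2 * R p \<and> norm p + R' p \<le> 1 \<and> R p \<le> \<rho>" if "p \<in> I" for p
  proof -
    have "R' p > 0" using Ipos that by blast
    hence "\<theta> * R' p < 1 * R' p" "1/2 * R' p \<le> \<theta> * R' p"
      using th by (auto intro!: mult_strict_right_mono mult_right_mono)
    moreover have "\<theta> * R' p \<le> \<rho>" using calculation Ipos[OF that] by linarith
    ultimately show ?thesis using Ipos[OF that] th by (auto simp: R_def)
  qed
  moreover have "finite I" using FC by (simp add: I_def)
  ultimately show ?thesis using disj by blast
qed

text \<open>Summing over dyadic annuli, organised as an induction on the number of halvings.\<close>

lemma sum_inverse_dist_near: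
  fixes m :: "'b \<Rightarrow> real" and c :: "'b \<Rightarrow> complex"
  assumes fin: "finite T" and m: "\<And>L. L \<in> T \<Longrightarrow> m L \<ge> 0" and \<beta>: "\<beta> > 0" and C: "C \<ge> 0"
    and growth: "\<And>s. s > 0 \<Longrightarrow> (\<Sum>L | L \<in> T \<and> dist x (c L) < s. m L) \<le> C * s powr (1 + \<beta>)"
    and ne: "\<And>L. L \<in> T \<Longrightarrow> c L \<noteq> x" and s: "s > 0"
  shows "(\<Sum>L | L \<in> T \<and> dist x (c L) < s. m L / dist x (c L)) \<le> 2 * C / (1 - 2 powr - \<beta>) * s powr \<beta>"
proof -
  \<comment> \<open>The fixed point of \<open>B = B * 2 powr - \<beta> + 2 * C\<close>, whose last
    term comes from one annulus; so the constant does not grow in the induction.\<close>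
  define B where "B = 2 * C / (1 - 2 powr - \<beta>)"
  have p1: "2 powr - \<beta> < 1" using \<beta> powr_less_mono[of "- \<beta>" 0 2] by simp
  have B: "B * 2 powr - \<beta> + 2 * C = B" 
  proof -
    have "B * (1 - 2 powr - \<beta>) = 2 * C" using p1 \<beta> by (simp add: B_def)
    thus ?thesis by (simp add: right_diff_distrib)
  qed
  have B0: "B \<ge> 0" using C p1 by (simp add: B_def)
  have main: "(\<Sum>L | L \<in> T \<and> dist x (c L) < s. m L / dist x (c L)) \<le> B * s powr \<beta>"
    if "s > 0" "\<And>L. L \<in> T \<Longrightarrow> dist x (c L) \<ge> s / 2 ^ k" for k s
    using that
  proof (induction k arbitrary: s)
    case 0
    hence "{L. L \<in> T \<and> dist x (c L) < s} = {}" by fastforce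
    thus ?case using B0 by (simp only: sum.empty) simp
  next
    case (Suc k)
    let ?N = "{L. L \<in> T \<and> dist x (c L) < s / 2}" and ?M = "{L. L \<in> T \<and> s / 2 \<le> dist x (c L) \<and> dist x (c L) < s}"
    have split: "{L. L \<in> T \<and> dist x (c L) < s} = ?N \<union> ?M" using Suc.prems(1) by auto
    have "(\<Sum>L\<in>?M. m L / dist x (c L)) \<le> (\<Sum>L\<in>?M. m L * (2 / s))"
    proof (rule sum_mono)
      fix L assume L: "L \<in> ?M"
      have "0 < dist x (c L)" using L Suc.prems(1) by auto
      hence "1 / dist x (c L) \<le> 2 / s" using L Suc.prems(1) by (simp add: field_simps)
      thus "m L / dist x (c L) \<le> m L * (2 / s)"
        using m[of L] L mult_left_mono[of "1 / dist x (c L)" "2 / s" "m L"] by simp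
    qed
    also have "\<dots> \<le> (\<Sum>L | L \<in> T \<and> dist x (c L) < s. m L * (2 / s))"
      using fin m Suc.prems(1) by (intro sum_mono2) auto
    also have "\<dots> = (\<Sum>L | L \<in> T \<and> dist x (c L) < s. m L) * (2 / s)" by (simp only: sum_distrib_right)
    also have "\<dots> \<le> C * s powr (1 + \<beta>) * (2 / s)"
      using growth[OF Suc.prems(1)] Suc.prems(1) by (intro mult_right_mono) auto
    also have "\<dots> = 2 * C * s powr \<beta>" using Suc.prems(1) by (simp add: powr_add)
    finally have M: "(\<Sum>L\<in>?M. m L / dist x (c L)) \<le> 2 * C * s powr \<beta>" .
    have N: "(\<Sum>L\<in>?N. m L / dist x (c L)) \<le> B * (s / 2) powr \<beta>"
      using Suc.prems by (intro Suc.IH) auto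
    have "(\<Sum>L\<in>?N \<union> ?M. m L / dist x (c L)) = (\<Sum>L\<in>?N. m L / dist x (c L)) + (\<Sum>L\<in>?M. m L / dist x (c L))"
      using fin by (intro sum.union_disjoint) auto
    also have "\<dots> \<le> B * (s / 2) powr \<beta> + 2 * C * s powr \<beta>" using M N by linarith
    also have "(s / 2) powr \<beta> = 2 powr - \<beta> * s powr \<beta>"
      using Suc.prems(1) by (simp add: powr_divide powr_minus_divide)
    also have "B * (2 powr - \<beta> * s powr \<beta>) + 2 * C * s powr \<beta> = (B * 2 powr - \<beta> + 2 * C) * s powr \<beta>"
      by (simp add: algebra_simps)
    finally show ?case unfolding split B .
  qed
  have "\<exists>k. \<forall>L\<in>T. dist x (c L) \<ge> s / 2 ^ k"
  proof (cases "T = {}")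
    case False
    define \<delta> where "\<delta> = Min ((\<lambda>L. dist x (c L)) ` T)"
    have "\<delta> > 0" using ne fin False by (auto simp: \<delta>_def)
    obtain k where "(1/2) ^ k < \<delta> / s" using real_arch_pow_inv[of "\<delta> / s" "1/2"] \<open>\<delta> > 0\<close> s by auto
    hence "s / 2 ^ k \<le> \<delta>" using s by (simp add: field_simps power_divide)
    moreover have "\<delta> \<le> dist x (c L)" if "L \<in> T" for L using fin that by (simp add: \<delta>_def)
    ultimately show ?thesis by (meson order_trans)
  qed auto
  thus ?thesis using main[OF s] unfolding B_def by blast
qed

text \<open>The same induction outwards, with radii doubling. The annulus at radius \<open>s\<close>
  contributes a multiple of \<open>s powr (\<beta> - 1)\<close>, summable because
  \<open>\<beta> < 1\<close>; finiteness of \<open>T\<close> ends the recursion.\<close>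

lemma sum_inverse_dist_far:
  fixes m :: "'b \<Rightarrow> real" and c :: "'b \<Rightarrow> complex"
  assumes fin: "finite T" and m: "\<And>L. L \<in> T \<Longrightarrow> m L \<ge> 0" and \<beta>: "\<beta> < 1" and C: "C \<ge> 0"
    and growth: "\<And>s. s > 0 \<Longrightarrow> (\<Sum>L | L \<in> T \<and> dist x (c L) < s. m L) \<le> C * s powr (1 + \<beta>)"
    and s: "s > 0"
  shows "(\<Sum>L | L \<in> T \<and> dist x (c L) \<ge> s. m L / (dist x (c L))\<^sup>2)
    \<le> 2 powr (1 + \<beta>) * C / (1 - 2 powr (\<beta> - 1)) * s powr (\<beta> - 1)"
proof -
  define B where "B = 2 powr (1 + \<beta>) * C / (1 - 2 powr (\<beta> - 1))"
  have p1: "2 powr (\<beta> - 1) < 1" using \<beta> powr_less_mono[of "\<beta> - 1" 0 2] by simp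
  have B: "B * 2 powr (\<beta> - 1) + 2 powr (1 + \<beta>) * C = B" 
  proof -
    have "B * (1 - 2 powr (\<beta> - 1)) = 2 powr (1 + \<beta>) * C" using p1 \<beta> by (simp add: B_def)
    thus ?thesis by (simp add: right_diff_distrib)
  qed
  have B0: "B \<ge> 0" using C p1 by (simp add: B_def)
  have main: "(\<Sum>L | L \<in> T \<and> dist x (c L) \<ge> s. m L / (dist x (c L))\<^sup>2) \<le> B * s powr (\<beta> - 1)"
    if "s > 0" "\<And>L. L \<in> T \<Longrightarrow> dist x (c L) < s * 2 ^ k" for k s
    using that
  proof (induction k arbitrary: s)
    case 0
    hence "{L. L \<in> T \<and> dist x (c L) \<ge> s} = {}" by fastforce
    thus ?case using B0 by (simp only: sum.empty) simp
  next
    case (Suc k)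
    let ?N = "{L. L \<in> T \<and> dist x (c L) \<ge> 2 * s}" and ?M = "{L. L \<in> T \<and> s \<le> dist x (c L) \<and> dist x (c L) < 2 * s}"
    have split: "{L. L \<in> T \<and> dist x (c L) \<ge> s} = ?N \<union> ?M" using Suc.prems(1) by auto
    have "(\<Sum>L\<in>?M. m L / (dist x (c L))\<^sup>2) \<le> (\<Sum>L\<in>?M. m L * (1 / s\<^sup>2))"
    proof (rule sum_mono)
      fix L assume L: "L \<in> ?M"
      hence "1 / (dist x (c L))\<^sup>2 \<le> 1 / s\<^sup>2" using Suc.prems(1)
        by (intro divide_left_mono power_mono mult_pos_pos zero_less_power) auto
      thus "m L / (dist x (c L))\<^sup>2 \<le> m L * (1 / s\<^sup>2)"
        using m[of L] L mult_left_mono[of "1 / (dist x (c L))\<^sup>2" "1 / s\<^sup>2" "m L"] by simp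
    qed
    also have "\<dots> \<le> (\<Sum>L | L \<in> T \<and> dist x (c L) < 2 * s. m L * (1 / s\<^sup>2))"
      using fin m Suc.prems(1) by (intro sum_mono2) auto
    also have "\<dots> = (\<Sum>L | L \<in> T \<and> dist x (c L) < 2 * s. m L) * (1 / s\<^sup>2)" by (simp only: sum_distrib_right)
    also have "\<dots> \<le> C * (2 * s) powr (1 + \<beta>) * (1 / s\<^sup>2)"
      using growth[of "2 * s"] Suc.prems(1) by (intro mult_right_mono) auto
    also have "\<dots> = 2 powr (1 + \<beta>) * C * s powr (\<beta> - 1)"
    proof -
      have "s powr (1 + \<beta>) = s powr (\<beta> - 1) * s powr 2" by (simp add: powr_add[symmetric] add.commute)
      thus ?thesis using Suc.prems(1) by (simp add: powr_mult)
    qed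
    finally have M: "(\<Sum>L\<in>?M. m L / (dist x (c L))\<^sup>2) \<le> 2 powr (1 + \<beta>) * C * s powr (\<beta> - 1)" .
    have N: "(\<Sum>L\<in>?N. m L / (dist x (c L))\<^sup>2) \<le> B * (2 * s) powr (\<beta> - 1)"
      using Suc.prems by (intro Suc.IH) (auto simp: mult_ac)
    have "(\<Sum>L\<in>?N \<union> ?M. m L / (dist x (c L))\<^sup>2) = (\<Sum>L\<in>?N. m L / (dist x (c L))\<^sup>2) + (\<Sum>L\<in>?M. m L / (dist x (c L))\<^sup>2)"
      using fin by (intro sum.union_disjoint) auto
    also have "\<dots> \<le> B * (2 * s) powr (\<beta> - 1) + 2 powr (1 + \<beta>) * C * s powr (\<beta> - 1)" using M N by linarith
    also have "(2 * s) powr (\<beta> - 1) = 2 powr (\<beta> - 1) * s powr (\<beta> - 1)"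
      using Suc.prems(1) by (simp add: powr_mult)
    also have "B * (2 powr (\<beta> - 1) * s powr (\<beta> - 1)) + 2 powr (1 + \<beta>) * C * s powr (\<beta> - 1)
        = (B * 2 powr (\<beta> - 1) + 2 powr (1 + \<beta>) * C) * s powr (\<beta> - 1)"
      by (simp add: algebra_simps)
    finally show ?case unfolding split B .
  qed
  have "\<exists>k. \<forall>L\<in>T. dist x (c L) < s * 2 ^ k"
  proof (cases "T = {}")
    case False
    define \<delta> where "\<delta> = Max ((\<lambda>L. dist x (c L)) ` T)"
    obtain k where "\<delta> / s < 2 ^ k" using real_arch_pow[of 2 "\<delta> / s"] by auto
    hence "\<delta> < s * 2 ^ k" using s by (simp add: field_simps)
    moreover have "dist x (c L) \<le> \<delta>" if "L \<in> T" for L using fin that by (simp add: \<delta>_def)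
    ultimately show ?thesis by (meson le_less_trans)
  qed auto
  thus ?thesis using main[OF s] unfolding B_def by blast
qed

text \<open>Split at distance \<open>2 * \<delta>\<close> from \<open>u\<close>, where
  \<open>\<delta> = dist u v\<close>. For near points the two kernels are estimated one by one, the
  ball about \<open>u\<close> lying in the ball of radius \<open>3 * \<delta>\<close> about
  \<open>v\<close>; for far points their difference is at most
  \<open>2 * \<delta> / (dist u (c L))^2\<close>. The constant is independent of \<open>T\<close>,
  so the bound survives a limit. The growth condition is imposed at \<open>u\<close> and
  \<open>v\<close> alone, because it will be verified only for points at positive distance from the
  masses.\<close>

lemma discrete_Cauchy_transform_Hoelder:
  fixes m :: "'b \<Rightarrow> real" and c :: "'b \<Rightarrow> complex" and \<beta> C :: real
  assumes fin: "finite T" and m: "\<And>L. L \<in> T \<Longrightarrow> m L \<ge> 0" and \<beta>: "0 < \<beta>" "\<beta> < 1" and C: "C \<ge> 0"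
    and growth: "\<And>x s. x \<in> {u, v} \<Longrightarrow> s > 0 \<Longrightarrow> (\<Sum>L | L \<in> T \<and> dist x (c L) < s. m L) \<le> C * s powr (1 + \<beta>)"
    and ne: "\<And>L. L \<in> T \<Longrightarrow> c L \<noteq> u \<and> c L \<noteq> v"
  shows "norm ((\<Sum>L\<in>T. m L / (u - c L)) - (\<Sum>L\<in>T. m L / (v - c L)))
    \<le> (10 * C / (1 - 2 powr - \<beta>) + 8 * C / (1 - 2 powr (\<beta> - 1))) * norm (u - v) powr \<beta>"
proof (cases "u = v")
  case False
  define \<delta> where "\<delta> = dist u v"
  have d: "\<delta> > 0" using False by (simp add: \<delta>_def)
  let ?A = "{L. L \<in> T \<and> dist u (c L) < 2 * \<delta>}" and ?F = "{L. L \<in> T \<and> dist u (c L) \<ge> 2 * \<delta>}"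
  let ?A' = "{L. L \<in> T \<and> dist v (c L) < 3 * \<delta>}"
  define e where "e L = norm (of_real (m L) / (u - c L) - of_real (m L) / (v - c L))" for L
  have e: "e L = m L * \<delta> / (dist u (c L) * dist v (c L))" if "L \<in> T" for L
  proof -
    have *: "u - c L \<noteq> 0" "v - c L \<noteq> 0" using ne[OF that] by auto
    have "of_real (m L) / (u - c L) - of_real (m L) / (v - c L) = of_real (m L) * (v - u) / ((u - c L) * (v - c L))"
      using * by (simp add: field_simps)
    thus ?thesis using m[OF that]
      by (simp add: e_def \<delta>_def norm_mult norm_divide dist_norm norm_minus_commute)
  qed
  have A: "(\<Sum>L\<in>?A. e L) \<le> (\<Sum>L\<in>?A. m L / dist u (c L)) + (\<Sum>L\<in>?A'. m L / dist v (c L))"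
  proof -
    have "(\<Sum>L\<in>?A. e L) \<le> (\<Sum>L\<in>?A. m L / dist u (c L) + m L / dist v (c L))"
    proof (rule sum_mono)
      fix L assume L: "L \<in> ?A"
      hence LT: "L \<in> T" by simp
      have pos: "dist u (c L) > 0" "dist v (c L) > 0" using ne[OF LT] by (metis zero_less_dist_iff)+
      have "\<delta> \<le> dist u (c L) + dist v (c L)" unfolding \<delta>_def by metric
      hence "m L * \<delta> \<le> m L * (dist u (c L) + dist v (c L))" using m[OF LT] by (rule mult_left_mono)
      thus "e L \<le> m L / dist u (c L) + m L / dist v (c L)"
        unfolding e[OF LT] using pos by (simp add: field_simps)
    qed
    also have "\<dots> = (\<Sum>L\<in>?A. m L / dist u (c L)) + (\<Sum>L\<in>?A. m L / dist v (c L))" by (simp add: sum.distrib)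
    also have "(\<Sum>L\<in>?A. m L / dist v (c L)) \<le> (\<Sum>L\<in>?A'. m L / dist v (c L))"
    proof (intro sum_mono2)
      show "?A \<subseteq> ?A'"
      proof
        fix L assume "L \<in> ?A"
        thus "L \<in> ?A'" using dist_triangle[of v "c L" u] by (auto simp: \<delta>_def dist_commute)
      qed
    qed (use fin m in auto)
    finally show ?thesis by simp
  qed
  have F: "(\<Sum>L\<in>?F. e L) \<le> 2 * \<delta> * (\<Sum>L\<in>?F. m L / (dist u (c L))\<^sup>2)"
    unfolding sum_distrib_left
  proof (rule sum_mono)
    fix L assume L: "L \<in> ?F"
    hence LT: "L \<in> T" by simp
    have pos: "dist u (c L) > 0" "dist v (c L) > 0" using ne[OF LT] by (metis zero_less_dist_iff)+
    have "dist u (c L) \<le> 2 * dist v (c L)" using L dist_triangle[of u "c L" v] by (auto simp: \<delta>_def)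
    hence "m L * \<delta> * dist u (c L) \<le> m L * \<delta> * (2 * dist v (c L))" using m[OF LT] d by (intro mult_left_mono) auto
    thus "e L \<le> 2 * \<delta> * (m L / (dist u (c L))\<^sup>2)"
      unfolding e[OF LT] using pos by (simp add: field_simps power2_eq_square)
  qed
  have near: "(\<Sum>L\<in>?A. m L / dist u (c L)) \<le> 2 * C / (1 - 2 powr - \<beta>) * (2 * \<delta>) powr \<beta>"
    "(\<Sum>L\<in>?A'. m L / dist v (c L)) \<le> 2 * C / (1 - 2 powr - \<beta>) * (3 * \<delta>) powr \<beta>"
    by (rule sum_inverse_dist_near[OF fin m \<beta>(1) C growth]; use ne d in auto)+
  have far: "(\<Sum>L\<in>?F. m L / (dist u (c L))\<^sup>2) \<le> 2 powr (1 + \<beta>) * C / (1 - 2 powr (\<beta> - 1)) * (2 * \<delta>) powr (\<beta> - 1)"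
    by (rule sum_inverse_dist_far[OF fin m \<beta>(2) C growth]) (use d in auto)
  have p: "1 - 2 powr - \<beta> > 0" "1 - 2 powr (\<beta> - 1) > 0" 
    using \<beta> powr_less_mono[of "- \<beta>" 0 2] powr_less_mono[of "\<beta> - 1" 0 2] by auto
  have p23: "(2 * \<delta>) powr \<beta> \<le> 2 * \<delta> powr \<beta>" "(3 * \<delta>) powr \<beta> \<le> 3 * \<delta> powr \<beta>"
    using powr_mono[of \<beta> 1 2] powr_mono[of \<beta> 1 3] \<beta> d by (auto simp: powr_mult intro!: mult_right_mono)
  have near': "(\<Sum>L\<in>?A. m L / dist u (c L)) \<le> 4 * C / (1 - 2 powr - \<beta>) * \<delta> powr \<beta>"
    "(\<Sum>L\<in>?A'. m L / dist v (c L)) \<le> 6 * C / (1 - 2 powr - \<beta>) * \<delta> powr \<beta>"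
    using near mult_left_mono[OF p23(1), of "2 * C / (1 - 2 powr - \<beta>)"]
      mult_left_mono[OF p23(2), of "2 * C / (1 - 2 powr - \<beta>)"] C p by auto
  have far': "2 * \<delta> * (\<Sum>L\<in>?F. m L / (dist u (c L))\<^sup>2) \<le> 8 * C / (1 - 2 powr (\<beta> - 1)) * \<delta> powr \<beta>"
  proof -
    have "2 * \<delta> * (\<Sum>L\<in>?F. m L / (dist u (c L))\<^sup>2)
      \<le> 2 * \<delta> * (2 powr (1 + \<beta>) * C / (1 - 2 powr (\<beta> - 1)) * (2 * \<delta>) powr (\<beta> - 1))"
      using far d by (intro mult_left_mono) auto
    also have "\<dots> = C / (1 - 2 powr (\<beta> - 1)) * (2 powr (1 + \<beta>) * ((2 * \<delta>) powr 1 * (2 * \<delta>) powr (\<beta> - 1)))"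
      using d by simp
    also have "(2 * \<delta>) powr 1 * (2 * \<delta>) powr (\<beta> - 1) = (2 * \<delta>) powr \<beta>" by (simp only: powr_add[symmetric]) simp
    also have "C / (1 - 2 powr (\<beta> - 1)) * (2 powr (1 + \<beta>) * (2 * \<delta>) powr \<beta>)
        \<le> C / (1 - 2 powr (\<beta> - 1)) * (4 * (2 * \<delta> powr \<beta>))"
      using p C p23(1) powr_mono[of "1 + \<beta>" 2 2] \<beta> by (intro mult_left_mono mult_mono) auto
    also have "\<dots> = 8 * C / (1 - 2 powr (\<beta> - 1)) * \<delta> powr \<beta>" by simp
    finally show ?thesis .
  qed
  have "norm ((\<Sum>L\<in>T. m L / (u - c L)) - (\<Sum>L\<in>T. m L / (v - c L))) \<le> (\<Sum>L\<in>T. e L)"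
    unfolding sum_subtractf[symmetric] e_def by (rule norm_sum)
  also have "(\<Sum>L\<in>T. e L) = (\<Sum>L\<in>?A. e L) + (\<Sum>L\<in>?F. e L)"
    using fin by (subst sum.union_disjoint[symmetric]) (auto intro!: sum.cong)
  also have "\<dots> \<le> 4 * C / (1 - 2 powr - \<beta>) * \<delta> powr \<beta> + 6 * C / (1 - 2 powr - \<beta>) * \<delta> powr \<beta>
      + 8 * C / (1 - 2 powr (\<beta> - 1)) * \<delta> powr \<beta>"
    using A F near' far' by linarith
  also have "\<dots> = (10 * C / (1 - 2 powr - \<beta>) + 8 * C / (1 - 2 powr (\<beta> - 1))) * norm (u - v) powr \<beta>"
    by (simp add: \<delta>_def dist_norm distrib_right)
  finally show ?thesis .
qed simp

section \<open>Cantor sets from disc packings\<close>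

text \<open>The larger radii \<open>R'\<close> leave a ring around each disc on which the stretching is a similarity; test
  functions will be nonconstant only there. The lower bounds for the covered areas multiply to
  \<open>exp (- 1)\<close>.\<close>

locale disc_packings =
  fixes I :: "nat \<Rightarrow> complex set" and R R' :: "nat \<Rightarrow> complex \<Rightarrow> real" and \<kappa> K :: real
  assumes \<kappa>: "0 < \<kappa>" and K: "1 \<le> K"
    and finite_I [simp]: "finite (I k)"
    and R_pos: "p \<in> I k \<Longrightarrow> 0 < R k p"
    and R_less: "p \<in> I k \<Longrightarrow> R k p < R' k p"
    and R'_le: "p \<in> I k \<Longrightarrow> R' k p \<le> 2 * R k p"
    and norm_centre: "p \<in> I k \<Longrightarrow> norm p + R' k p \<le> 1"
    and separated': "p \<in> I k \<Longrightarrow> q \<in> I k \<Longrightarrow> p \<noteq> q \<Longrightarrow> R' k p + R' k q < dist p q"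
    and R_small: "p \<in> I k \<Longrightarrow> R k p powr \<kappa> \<le> 1 / 3"
    and area_ge: "exp (- ((1 / 2) ^ Suc k)) \<le> (\<Sum>p\<in>I k. (R k p)\<^sup>2)"
begin

definition area :: "nat \<Rightarrow> real" where "area k = (\<Sum>p\<in>I k. (R k p)\<^sup>2)"

text \<open>A disc of generation \<open>n\<close> is addressed by the word of the centres of the packing discs that lead to
  it. The parameter \<open>e\<close> is \<open>\<kappa>\<close> in the target and \<open>K * \<kappa>\<close> in the source, and \<open>k\<close> is the first packing used.\<close>

definition radius :: "real \<Rightarrow> nat \<Rightarrow> complex \<Rightarrow> real" where
  "radius e k p = R k p powr (1 + e)"

fun words :: "nat \<Rightarrow> nat \<Rightarrow> complex list set" where
  "words k 0 = {[]}"
| "words k (Suc n) = (\<lambda>(p, L). p # L) ` (I k \<times> words (Suc k) n)"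

fun centre :: "real \<Rightarrow> nat \<Rightarrow> complex list \<Rightarrow> complex" where
  "centre e k [] = 0"
| "centre e k (p # L) = p + radius e k p * centre e (Suc k) L"

fun scale :: "real \<Rightarrow> nat \<Rightarrow> complex list \<Rightarrow> real" where
  "scale e k [] = 1"
| "scale e k (p # L) = radius e k p * scale e (Suc k) L"

text \<open>The weights are independent of \<open>e\<close>: one mass distribution serves both the
  source and the target Cantor set.\<close>

fun mass :: "nat \<Rightarrow> complex list \<Rightarrow> real" where
  "mass k [] = 1"
| "mass k (p # L) = (R k p)\<^sup>2 / area k * mass (Suc k) L"

fun stage :: "real \<Rightarrow> nat \<Rightarrow> nat \<Rightarrow> complex set" where
  "stage e k 0 = cball 0 1"
| "stage e k (Suc n) = (\<Union>p\<in>I k. (\<lambda>z. p + radius e k p * z) ` stage e (Suc k) n)"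

section \<open>Elementary bounds for radii, scales and masses\<close>

lemma R_less_1: "p \<in> I k \<Longrightarrow> R k p < 1"
  using norm_centre[of p k] R_less[of p k] norm_ge_zero[of p] by linarith

lemma separated: "p \<in> I k \<Longrightarrow> q \<in> I k \<Longrightarrow> p \<noteq> q \<Longrightarrow> R k p + R k q < dist p q"
  using separated'[of p k q] R_less[of p k] R_less[of q k] by linarith

lemma area_pos: "0 < area k"
  using area_ge[of k] exp_gt_zero[of "- ((1 / 2) ^ Suc k)"] unfolding area_def by linarith

lemma inverse_area_le: "1 / area k \<le> exp ((1 / 2) ^ Suc k)"
proof -
  have "exp (- ((1 / 2) ^ Suc k)) \<le> area k" using area_ge[of k] by (simp only: area_def)
  hence "1 / area k \<le> 1 / exp (- ((1 / 2) ^ Suc k))"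
    using area_pos[of k] by (intro divide_left_mono) auto
  thus ?thesis by (simp only: exp_minus inverse_eq_divide) simp
qed

lemma area_le_1: "area k \<le> 1"
  unfolding area_def
  using disjoint_discs_sum_le[of "I k" "R k" 1 0] R_pos separated[of _ k] norm_centre[of _ k] R_less[of _ k]
  by (force simp: less_imp_le)

lemma radius_pos: "p \<in> I k \<Longrightarrow> 0 < radius e k p"
  using R_pos[of p k] by (simp add: radius_def)

lemma radius_le: "p \<in> I k \<Longrightarrow> \<kappa> \<le> e \<Longrightarrow> radius e k p \<le> R k p / 3"
proof -
  assume p: "p \<in> I k" and e: "\<kappa> \<le> e"
  have "R k p powr e \<le> R k p powr \<kappa>"
    using R_pos[OF p] R_less_1[OF p] e by (intro powr_mono') auto
  hence "R k p * R k p powr e \<le> R k p * (1 / 3)"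
    using R_small[OF p] R_pos[OF p] by (intro mult_left_mono) auto
  thus ?thesis using R_pos[OF p] by (simp add: radius_def powr_add)
qed

lemma radius_le_third: "p \<in> I k \<Longrightarrow> \<kappa> \<le> e \<Longrightarrow> radius e k p \<le> 1 / 3"
  using radius_le[of p k e] R_less_1[of p k] by linarith

lemma radius_powr: "p \<in> I k \<Longrightarrow> 0 < e \<Longrightarrow> radius e k p powr (2 / (1 + e)) = (R k p)\<^sup>2"
proof -
  assume p: "p \<in> I k" "0 < e"
  have "radius e k p powr (2 / (1 + e)) = R k p powr ((1 + e) * (2 / (1 + e)))"
    by (simp only: radius_def powr_powr)
  also have "(1 + e) * (2 / (1 + e)) = 2" using p by (simp add: field_simps)
  finally show ?thesis using R_pos[OF p(1)] by simp
qed

lemma finite_words [simp]: "finite (words k n)"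
  by (induction k n rule: words.induct) simp_all

lemma words_SucE:
  assumes "L \<in> words k (Suc n)"
  obtains p L' where "L = p # L'" "p \<in> I k" "L' \<in> words (Suc k) n"
  using assms by auto

lemma sum_words_Suc:
  "(\<Sum>L\<in>words k (Suc n). f L) = (\<Sum>p\<in>I k. \<Sum>L\<in>words (Suc k) n. f (p # L))"
proof -
  have "inj_on (\<lambda>(p, L). p # L) (I k \<times> words (Suc k) n)" by (auto simp: inj_on_def)
  thus ?thesis by (simp add: sum.reindex sum.cartesian_product o_def case_prod_unfold)
qed

lemma mass_nonneg: "0 \<le> mass k L"
  using area_pos by (induction k L rule: mass.induct) (auto simp: less_imp_le)

lemma sum_mass: "(\<Sum>L\<in>words k n. mass k L) = 1"
proof (induction n arbitrary: k)
  case (Suc n)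
  show ?case
    using area_pos[of k] unfolding sum_words_Suc
    by (simp add: sum_distrib_left[symmetric] sum_divide_distrib[symmetric] Suc area_def[symmetric])
qed simp

lemma scale_pos: "L \<in> words k n \<Longrightarrow> 0 < scale e k L"
  by (induction n arbitrary: k L) (auto simp: radius_pos)

lemma scale_le: "L \<in> words k n \<Longrightarrow> \<kappa> \<le> e \<Longrightarrow> scale e k L \<le> (1 / 3) ^ n"
proof (induction n arbitrary: k L)
  case (Suc n)
  obtain p M where L: "L = p # M" "p \<in> I k" "M \<in> words (Suc k) n" using words_SucE[OF Suc.prems(1)] .
  have "radius e k p * scale e (Suc k) M \<le> (1 / 3) * (1 / 3) ^ n"
    using radius_le_third[OF L(2) Suc.prems(2)] Suc.IH[OF L(3) Suc.prems(2)] scale_pos[OF L(3)]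
    by (intro mult_mono) (auto intro: less_imp_le)
  thus ?case by (simp add: L)
qed simp

lemma norm_centre_scale: "L \<in> words k n \<Longrightarrow> \<kappa> \<le> e \<Longrightarrow> norm (centre e k L) + scale e k L \<le> 1"
proof (induction n arbitrary: k L)
  case (Suc n)
  obtain p M where L: "L = p # M" "p \<in> I k" "M \<in> words (Suc k) n" using words_SucE[OF Suc.prems(1)] .
  have "norm (centre e k L) + scale e k L \<le> norm p + radius e k p * (norm (centre e (Suc k) M) + scale e (Suc k) M)"
    using norm_triangle_ineq[of p "radius e k p * centre e (Suc k) M"] radius_pos[OF L(2), of e]
    by (simp add: L norm_mult distrib_left)
  also have "\<dots> \<le> norm p + radius e k p * 1"
    using Suc.IH[OF L(3) Suc.prems(2)] radius_pos[OF L(2), of e] by (intro add_left_mono mult_left_mono) auto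
  also have "\<dots> \<le> 1"
    using radius_le[OF L(2) Suc.prems(2)] norm_centre[OF L(2)] R_less[OF L(2)] R_pos[OF L(2)] by linarith
  finally show ?case .
qed simp

text \<open>By \<open>radius_powr\<close> each letter multiplies the left side by exactly
  \<open>(R k p)^2\<close> and the mass by \<open>(R k p)^2 / area k\<close>, where
  \<open>area k \<le> 1\<close>.\<close>

lemma mass_le_scale:
  "L \<in> words k n \<Longrightarrow> 0 < e \<Longrightarrow> (scale e k L) powr (2 / (1 + e)) \<le> mass k L"
proof (induction n arbitrary: k L)
  case (Suc n)
  obtain p M where L: "L = p # M" "p \<in> I k" "M \<in> words (Suc k) n" using words_SucE[OF Suc.prems(1)] .
  have "(scale e k L) powr (2 / (1 + e)) = (R k p)\<^sup>2 * scale e (Suc k) M powr (2 / (1 + e))"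
    using radius_powr[OF L(2) Suc.prems(2)] radius_pos[OF L(2), of e] scale_pos[OF L(3), of e]
    by (simp add: L powr_mult)
  also have "\<dots> \<le> (R k p)\<^sup>2 / area k * mass (Suc k) M"
    using Suc.IH[OF L(3) Suc.prems(2)] area_pos[of k] area_le_1[of k]
    by (intro mult_mono) (auto simp: pos_le_divide_eq mult_left_le)
  finally show ?case by (simp add: L)
qed simp

lemma sum_scale_powr_le: "0 < e \<Longrightarrow> (\<Sum>L\<in>words k n. (scale e k L) powr (2 / (1 + e))) \<le> 1"
  using sum_mono[of "words k n" "\<lambda>L. (scale e k L) powr (2 / (1 + e))" "mass k"] mass_le_scale[of _ k n e]
    sum_mass[of k n] by simp

text \<open>A disc of radius \<open>r\<close> meeting a next-generation disc of radius at least \<open>r\<close> meets no other one,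
  and then self-similarity applies; otherwise comparing areas gives the bound directly. The factors
  \<open>1 / area k\<close> picked up along the way multiply to a bounded constant.\<close>

lemma mass_growth:
  assumes e: "\<kappa> \<le> e" and r: "r > 0" and le: "\<And>L. L \<in> words k n \<Longrightarrow> scale e k L \<le> r"
  shows "(\<Sum>L\<in>words k n. if dist x (centre e k L) < r + scale e k L then mass k L else 0)
    \<le> 9 * exp ((1 / 2) ^ k) * r powr (2 / (1 + e))"
  using r le
proof (induction n arbitrary: k x r)
  case 0
  hence "1 \<le> r" by simp
  hence "1 \<le> r powr (2 / (1 + e))" using e \<kappa> by (intro ge_one_powr_ge_zero) auto
  moreover have "1 \<le> 9 * exp ((1 / 2) ^ k :: real)" using one_le_exp_iff[of "(1/2)^k"] by (smt (verit) zero_le_power divide_nonneg_nonneg)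
  ultimately have "1 * 1 \<le> 9 * exp ((1 / 2) ^ k) * r powr (2 / (1 + e))" by (intro mult_mono) auto
  moreover have "(\<Sum>L\<in>words k 0. if dist x (centre e k L) < r + scale e k L then mass k L else 0) \<le> 1"
    unfolding words.simps by auto
  ultimately show ?case by linarith
next
  case (Suc n)
  define D where "D = 2 / (1 + e)"
  have e0: "0 < e" using e \<kappa> by linarith
  have D: "0 < D" "D < 2" using e0 by (auto simp: D_def field_simps)
  \<comment> \<open>As \<open>(1/2)^k = (1/2)^Suc k + (1/2)^Suc k\<close>, the factor
    \<open>1 / area k\<close>, at most \<open>exp ((1/2)^Suc k)\<close>, is absorbed on passing from
    \<open>C (Suc k)\<close> to \<open>C k\<close>.\<close>
  define C where "C k = 9 * exp ((1 / 2) ^ k :: real)" for k :: nat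
  have C1: "9 \<le> C k" for k unfolding C_def by simp
  have CS: "C (Suc k) / area k \<le> C k"
  proof -
    have "C (Suc k) * (1 / area k) \<le> C (Suc k) * exp ((1 / 2) ^ Suc k)"
      using inverse_area_le[of k] C1[of "Suc k"] by (intro mult_left_mono) auto
    also have "\<dots> = 9 * exp ((1/2) ^ Suc k + (1/2) ^ Suc k)" by (simp only: C_def exp_add mult.assoc)
    also have "(1/2) ^ Suc k + (1/2) ^ Suc k = ((1/2) ^ k :: real)" by simp
    finally show ?thesis by (simp add: C_def)
  qed
  define w where "w p = (R k p)\<^sup>2 / area k" for p
  have w0: "0 \<le> w p" for p using area_pos[of k] by (simp add: w_def)
  have sw: "(\<Sum>p\<in>I k. w p) = 1"
    using area_pos[of k] by (simp add: w_def sum_divide_distrib[symmetric] area_def[symmetric])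
  define g where "g p = (\<Sum>L\<in>words (Suc k) n.
      if dist ((x - p) / radius e k p) (centre e (Suc k) L) < r / radius e k p + scale e (Suc k) L
      then mass (Suc k) L else 0)" for p
  have g0: "0 \<le> g p" for p unfolding g_def by (intro sum_nonneg) (auto simp: mass_nonneg)
  have g1: "g p \<le> 1" for p
    unfolding g_def sum_mass[of "Suc k" n, symmetric] by (intro sum_mono) (auto simp: mass_nonneg)
  have hit: "dist x (centre e k (p # L)) < r + scale e k (p # L) \<longleftrightarrow>
      dist ((x - p) / radius e k p) (centre e (Suc k) L) < r / radius e k p + scale e (Suc k) L"
    if p: "p \<in> I k" for p L
  proof -
    let ?l = "radius e k p"
    have l: "?l > 0" by (rule radius_pos[OF p])
    have "x - (p + ?l * centre e (Suc k) L) = ?l * ((x - p) / ?l - centre e (Suc k) L)"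
      using l by (simp add: field_simps)
    hence "dist x (centre e k (p # L)) = ?l * dist ((x - p) / ?l) (centre e (Suc k) L)"
      using l by (simp add: dist_norm norm_mult)
    moreover have "r + scale e k (p # L) = ?l * (r / ?l + scale e (Suc k) L)" using l by (simp add: field_simps)
    ultimately show ?thesis using l by simp
  qed
  have S: "(\<Sum>L\<in>words k (Suc n). if dist x (centre e k L) < r + scale e k L then mass k L else 0)
      = (\<Sum>p\<in>I k. w p * g p)"
    unfolding sum_words_Suc g_def sum_distrib_left
    by (intro sum.cong refl) (simp only: hit mult_zero_right w_def mass.simps if_distrib[of "\<lambda>x. _ * x"])
  have near: "dist x p < r + radius e k p" if p: "p \<in> I k" and gp: "g p \<noteq> 0" for p
  proof -
    obtain L where L: "L \<in> words (Suc k) n" "dist x (centre e k (p # L)) < r + scale e k (p # L)"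
      using gp sum.neutral[of "words (Suc k) n"] unfolding g_def hit[OF p, symmetric] by (smt (verit, best))
    let ?l = "radius e k p"
    have l: "?l > 0" by (rule radius_pos[OF p])
    have "dist x p \<le> dist x (centre e k (p # L)) + norm (?l * centre e (Suc k) L)"
      using dist_triangle[of x p "centre e k (p # L)"] by (simp add: dist_norm norm_minus_commute)
    also have "\<dots> < r + ?l * scale e (Suc k) L + ?l * norm (centre e (Suc k) L)"
      using L(2) l by (simp add: norm_mult)
    also have "\<dots> = r + ?l * (norm (centre e (Suc k) L) + scale e (Suc k) L)" by (simp add: algebra_simps)
    also have "\<dots> \<le> r + ?l * 1"
      using norm_centre_scale[OF L(1) e] l by (intro add_left_mono mult_left_mono) auto
    finally show ?thesis by simp
  qed
  consider "r \<ge> 1" | p where "r < 1" "p \<in> I k" "r \<le> radius e k p" "dist x p < r + radius e k p"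
    | "r < 1" "\<And>p. p \<in> I k \<Longrightarrow> g p \<noteq> 0 \<Longrightarrow> radius e k p < r"
    using near by (meson not_le)
  hence "(\<Sum>p\<in>I k. w p * g p) \<le> C k * r powr D"
  proof cases
    case 1
    have "(\<Sum>p\<in>I k. w p * g p) \<le> (\<Sum>p\<in>I k. w p * 1)"
      using w0 g1 by (intro sum_mono mult_left_mono)
    also have "\<dots> = 1 * 1" using sw by simp
    also have "\<dots> \<le> C k * r powr D" using C1[of k] 1 D by (intro mult_mono ge_one_powr_ge_zero) auto
    finally show ?thesis .
  next
    case (2 p)
    let ?l = "radius e k p"
    have l: "?l > 0" by (rule radius_pos[OF 2(2)])
    \<comment> \<open>As \<open>r \<le> ?l\<close>, a second disc that is hit would have its centre
      closer to \<open>p\<close> than \<open>3 * ?l + radius e k q \<le> R k p + R k q\<close>,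
      against the separation.\<close>
    have "w q * g q = 0" if q: "q \<in> I k - {p}" for q
    proof (rule ccontr)
      assume "w q * g q \<noteq> 0"
      hence "dist x q < r + radius e k q" using near q by auto
      hence "dist p q < 3 * ?l + radius e k q"
        using 2 dist_triangle[of p q x] by (simp add: dist_commute)
      also have "\<dots> \<le> R k p + R k q" using radius_le[OF 2(2) e] radius_le[of q k e] q e R_pos[of q k] by auto
      finally show False using separated[of p k q] q 2(2) by auto
    qed
    hence "(\<Sum>p\<in>I k. w p * g p) = w p * g p"
      using sum.mono_neutral_left[of "I k" "{p}" "\<lambda>p. w p * g p"] 2(2) by (simp add: sum.mono_neutral_right[of "I k" "{p}"])
    also have "g p \<le> C (Suc k) * (r / ?l) powr D"
      unfolding g_def C_def D_def
    proof (rule Suc.IH)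
      show "scale e (Suc k) L \<le> r / ?l" if "L \<in> words (Suc k) n" for L
        using Suc.prems(2)[of "p # L"] that 2(2) l by (auto simp: pos_le_divide_eq mult.commute)
    qed (use Suc.prems l in auto)
    hence "w p * g p \<le> w p * (C (Suc k) * (r / ?l) powr D)" using w0 by (intro mult_left_mono)
    also have "(r / ?l) powr D = r powr D / (R k p)\<^sup>2"
      using radius_powr[OF 2(2) e0] l Suc.prems(1) by (simp add: powr_divide D_def)
    also have "w p * (C (Suc k) * (r powr D / (R k p)\<^sup>2)) = (C (Suc k) / area k) * r powr D"
      using R_pos[OF 2(2)] by (simp add: w_def)
    also have "\<dots> \<le> C k * r powr D" using CS by (intro mult_right_mono) auto
    finally show ?thesis .
  next
    case 3
    define J where "J = {p \<in> I k. g p \<noteq> 0}"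
    have J: "finite J" "J \<subseteq> I k" by (auto simp: J_def)
    have nearJ: "dist x p < 2 * r" "radius e k p < r" if "p \<in> J" for p
      using near[of p] 3(2)[of p] that by (auto simp: J_def)
    \<comment> \<open>The centres are within \<open>2 * r\<close> of \<open>x\<close>; truncating
      the radii at \<open>r\<close> keeps the packing discs inside the disc of radius
      \<open>3 * r\<close>, which is where the constant 9 comes from.\<close>
    have "(\<Sum>p\<in>J. (min (R k p) r)\<^sup>2) \<le> (3 * r)\<^sup>2"
    proof (rule disjoint_discs_sum_le[where x = x])
      fix p assume p: "p \<in> J"
      show "0 \<le> min (R k p) r" using R_pos[of p k] p J Suc.prems(1) by auto
      show "dist x p + min (R k p) r \<le> 3 * r" using nearJ[OF p] by auto
      fix q assume q: "q \<in> J" "p \<noteq> q"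
      show "min (R k p) r + min (R k q) r < dist p q"
        using separated[of p k q] p q subsetD[OF J(2), of p] subsetD[OF J(2), of q] by auto
    qed (use J Suc.prems(1) in auto)
    \<comment> \<open>Undoes the truncation: for \<open>R k p < r\<close> because
      \<open>r < 1\<close> and \<open>D < 2\<close>, otherwise because
      \<open>(R k p)^2 = radius e k p powr D\<close> and \<open>radius e k p < r\<close>.\<close>
    moreover have "(R k p)\<^sup>2 \<le> r powr (D - 2) * (min (R k p) r)\<^sup>2" if p: "p \<in> J" for p
    proof (cases "R k p < r")
      case True
      have "1 \<le> r powr (D - 2)" using 3(1) Suc.prems(1) D powr_mono'[of "D - 2" 0 r] by simp
      thus ?thesis using True mult_right_mono[of 1 "r powr (D - 2)" "(R k p)\<^sup>2"] by simp
    next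
      case False
      have pI: "p \<in> I k" using p J by auto
      have "(R k p)\<^sup>2 = radius e k p powr D" using radius_powr[OF pI e0] by (simp add: D_def)
      also have "\<dots> \<le> r powr D" using nearJ[OF p] radius_pos[OF pI, of e] D by (intro powr_mono2) auto
      also have "\<dots> = r powr (D - 2) * r powr 2" by (simp add: powr_add[symmetric])
      also have "r powr 2 = r\<^sup>2" using Suc.prems(1) by simp
      finally show ?thesis using False by (simp only: min_absorb2 not_less)
    qed
    hence "(\<Sum>p\<in>J. (R k p)\<^sup>2) \<le> r powr (D - 2) * (\<Sum>p\<in>J. (min (R k p) r)\<^sup>2)"
      unfolding sum_distrib_left by (rule sum_mono)
    ultimately have "(\<Sum>p\<in>J. (R k p)\<^sup>2) \<le> r powr (D - 2) * (3 * r)\<^sup>2"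
      by (meson mult_left_mono order_trans powr_ge_zero)
    also have "\<dots> = 9 * (r powr (D - 2) * r powr 2)" using Suc.prems(1) by (simp add: power2_eq_square)
    also have "\<dots> = 9 * r powr D" by (simp add: powr_add[symmetric])
    finally have JR: "(\<Sum>p\<in>J. (R k p)\<^sup>2) \<le> 9 * r powr D" .
    have "(\<Sum>p\<in>I k. w p * g p) = (\<Sum>p\<in>J. w p * g p)"
      unfolding J_def by (intro sum.mono_neutral_right) auto
    also have "\<dots> \<le> (\<Sum>p\<in>J. w p * 1)" using w0 g1 by (intro sum_mono mult_left_mono)
    also have "\<dots> = (\<Sum>p\<in>J. (R k p)\<^sup>2) / area k" by (simp add: w_def sum_divide_distrib)
    also have "\<dots> \<le> 9 * r powr D / area k" using JR area_pos[of k] by (intro divide_right_mono) auto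
    also have "\<dots> = (9 / area k) * r powr D" by simp
    also have "\<dots> \<le> (C (Suc k) / area k) * r powr D"
      using C1[of "Suc k"] area_pos[of k] by (intro mult_right_mono divide_right_mono) auto
    also have "\<dots> \<le> C k * r powr D" using CS by (intro mult_right_mono) auto
    finally show ?thesis .
  qed
  thus ?case unfolding S C_def D_def .
qed

section \<open>The stages as decreasing unions of discs\<close>

lemma stage_eq: "stage e k n = (\<Union>L\<in>words k n. (\<lambda>z. centre e k L + scale e k L * z) ` cball (0::complex) 1)"
proof (induction n arbitrary: k)
  case (Suc n)
  have "stage e k (Suc n) = (\<Union>p\<in>I k. \<Union>L\<in>words (Suc k) n.
      (\<lambda>z. p + radius e k p * z) ` (\<lambda>z. centre e (Suc k) L + scale e (Suc k) L * z) ` cball (0::complex) 1)"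
    by (simp only: stage.simps Suc image_UN)
  also have "\<dots> = (\<Union>p\<in>I k. \<Union>L\<in>words (Suc k) n. (\<lambda>z. centre e k (p # L) + scale e k (p # L) * z) ` cball (0::complex) 1)"
    unfolding image_image by (simp add: algebra_simps)
  also have "\<dots> = (\<Union>L\<in>words k (Suc n). (\<lambda>z. centre e k L + scale e k L * z) ` cball (0::complex) 1)"
    by (simp only: words.simps UN_extend_simps) force
  finally show ?case .
qed (simp add: image_id[unfolded id_def])

lemma affine_image_cball:
  assumes "s > 0"
  shows "(\<lambda>z. c + complex_of_real s * z) ` cball 0 r = cball c (s * r)"
proof -
  have "(\<lambda>z. c + complex_of_real s * z) ` cball 0 r = (+) c ` ((*\<^sub>R) s ` cball 0 r)"
    by (simp add: image_image scaleR_conv_of_real)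
  thus ?thesis using assms by (simp add: cball_scale cball_translation)
qed

lemma stage_eq_cballs: "stage e k n = (\<Union>L\<in>words k n. cball (centre e k L) (scale e k L))"
  unfolding stage_eq using scale_pos by (intro SUP_cong) (simp_all add: affine_image_cball)

lemma compact_stage: "compact (stage e k n)"
  unfolding stage_eq_cballs by (intro compact_UN) auto

lemma stage_Suc_subset: "\<kappa> \<le> e \<Longrightarrow> stage e k (Suc n) \<subseteq> stage e k n"
proof (induction n arbitrary: k)
  case 0
  show ?case
  proof
    fix z assume "z \<in> stage e k (Suc 0)"
    then obtain p and y :: complex where p: "p \<in> I k" "norm y \<le> 1" "z = p + radius e k p * y" by auto
    have "norm z \<le> norm p + radius e k p * norm y"
      using norm_triangle_ineq[of p "radius e k p * y"] radius_pos[OF p(1), of e] by (simp add: p norm_mult)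
    also have "\<dots> \<le> norm p + radius e k p * 1"
      using p radius_pos[OF p(1), of e] by (intro add_left_mono mult_left_mono) auto
    also have "\<dots> \<le> 1"
      using norm_centre[OF p(1)] R_less[OF p(1)] radius_le[OF p(1) 0] R_pos[OF p(1)] by linarith
    finally show "z \<in> stage e k 0" by simp
  qed
next
  case (Suc n)
  show ?case
    unfolding stage.simps(2)[of e k "Suc n"] stage.simps(2)[of e k n]
    by (intro UN_mono image_mono Suc order_refl)
qed

lemma stage_antimono: "\<kappa> \<le> e \<Longrightarrow> m \<le> n \<Longrightarrow> stage e k n \<subseteq> stage e k m"
  by (rule lift_Suc_antimono_le[of "stage e k"]) (auto simp only: stage_Suc_subset)

lemma centre_in_stage: "L \<in> words k n \<Longrightarrow> centre e k L \<in> stage e k n"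
  unfolding stage_eq_cballs using scale_pos[of L k n e] by force

end

section \<open>The iterated radial stretching\<close>

lemma negligible_affine_image:
  fixes p :: complex
  assumes "negligible S"
  shows "negligible ((\<lambda>z. p + of_real s * z) ` S)"
proof (rule negligible_differentiable_image_negligible[OF order_refl assms])
  have "((\<lambda>z. p + of_real s * z) has_derivative (\<lambda>v. of_real s * v)) (at x within S)" for x
    by (auto intro!: derivative_eq_intros)
  thus "(\<lambda>z. p + of_real s * z) differentiable_on S"
    unfolding differentiable_on_def differentiable_def by blast
qed

text \<open>The coefficients of \<open>v\<close> and \<open>cnj v\<close> are the two complex
  derivatives. For \<open>a = 1 / K - 1\<close> their moduli are in the ratio
  \<open>1 + 1 / K\<close> to \<open>1 - 1 / K\<close>, which is the extremal Beltrami bound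
  \<open>(K - 1) / (K + 1)\<close>.\<close>

lemma radial_stretch_has_derivative:
  fixes p z :: complex and a \<rho> :: real
  assumes "z \<noteq> p" "\<rho> > 0"
  shows "((\<lambda>z. p + of_real ((dist p z / \<rho>) powr a) * (z - p)) has_derivative
     (\<lambda>v. of_real ((dist p z / \<rho>) powr a) *
        (of_real (1 + a / 2) * v + of_real (a / 2) * ((z - p) / cnj (z - p)) * cnj v))) (at z)"
proof -
  define x where "x = z - p"
  define r where "r = norm x"
  have x: "x \<noteq> 0" "0 < r" using assms by (auto simp: x_def r_def)
  have dr: "((\<lambda>z. norm (z - p)) has_derivative (\<lambda>v. v \<bullet> sgn x)) (at z)"
    unfolding x_def
    by (rule has_derivative_compose[OF _ has_derivative_norm, of "\<lambda>z. z - p" "\<lambda>v. v", simplified])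
      (use assms in \<open>auto intro!: derivative_eq_intros\<close>)
  have dp: "((\<lambda>t. (t / \<rho>) powr a) has_real_derivative (a * (r / \<rho>) powr a / r)) (at r)"
  proof -
    have "((\<lambda>t. (t / \<rho>) powr a) has_real_derivative (a * (r / \<rho>) powr (a - 1) * (1 / \<rho>))) (at r)"
      using x assms by (auto intro!: derivative_eq_intros)
    also have "(r / \<rho>) powr (a - 1) = (r / \<rho>) powr a / (r / \<rho>)" using x assms by (simp add: powr_diff)
    finally show ?thesis using x assms by (simp add: field_simps)
  qed
  have "((\<lambda>z. (norm (z - p) / \<rho>) powr a) has_derivative (\<lambda>v. a * (r / \<rho>) powr a / r * (v \<bullet> sgn x))) (at z)"
    using has_derivative_compose[OF dr dp[unfolded r_def x_def, THEN has_field_derivative_imp_has_derivative]]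
    by (simp add: r_def x_def)
  from has_derivative_add[OF has_derivative_const[of p] has_derivative_mult[OF has_derivative_of_real[OF this]
      has_derivative_diff[OF has_derivative_ident has_derivative_const[of p]]]]
  have "((\<lambda>z. p + of_real ((norm (z - p) / \<rho>) powr a) * (z - p)) has_derivative
     (\<lambda>v. of_real ((r / \<rho>) powr a) * v + of_real (a * (r / \<rho>) powr a / r * (v \<bullet> sgn x)) * x)) (at z)"
    by (simp add: r_def x_def)
  moreover have "of_real ((r / \<rho>) powr a) * v + of_real (a * (r / \<rho>) powr a / r * (v \<bullet> sgn x)) * x
     = of_real ((r / \<rho>) powr a) * (of_real (1 + a / 2) * v + of_real (a / 2) * (x / cnj x) * cnj v)" for v
  proof -
    have vx: "complex_of_real (v \<bullet> x) = (v * cnj x + cnj v * x) / 2"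
      by (simp add: complex_eq_iff inner_complex_def)
    have "v \<bullet> sgn x = (v \<bullet> x) / r" by (simp add: sgn_div_norm r_def inverse_eq_divide)
    hence i: "complex_of_real (v \<bullet> sgn x) = (v * cnj x + cnj v * x) / (2 * of_real r)"
      by (simp only: of_real_divide vx divide_divide_eq_left)
    have rr: "complex_of_real r * of_real r = x * cnj x"
      using complex_norm_square[of x] by (simp only: r_def power2_eq_square of_real_mult)
    have cancel: "(v * y + u * x) * x / (2 * (x * y)) = (v + u * (x / y)) / 2" if "x \<noteq> 0" "y \<noteq> 0"
      for x y u v :: complex using that by (simp add: field_simps)
    have "of_real (a * (r / \<rho>) powr a / r * (v \<bullet> sgn x)) * x
        = of_real ((r / \<rho>) powr a) * (of_real a * ((v * cnj x + cnj v * x) * x / (2 * (of_real r * of_real r))))"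
      by (simp add: i mult_ac)
    also have "(v * cnj x + cnj v * x) * x / (2 * (of_real r * of_real r)) = (v + cnj v * (x / cnj x)) / 2"
      unfolding rr using x by (intro cancel) auto
    finally have "of_real (a * (r / \<rho>) powr a / r * (v \<bullet> sgn x)) * x
        = of_real ((r / \<rho>) powr a) * (of_real a * ((v + cnj v * (x / cnj x)) / 2))" .
    moreover have "P * v + P * (of_real a * ((v + cnj v * q) / 2))
        = P * (of_real (1 + a / 2) * v + of_real (a / 2) * q * cnj v)" for P q
      by (simp add: field_simps)
    ultimately show ?thesis by metis
  qed
  ultimately show ?thesis by (simp add: dist_norm norm_minus_commute r_def x_def)
qed

context disc_packings
begin

abbreviation "src \<equiv> radius (K * \<kappa>)"
abbreviation "tgt \<equiv> radius \<kappa>"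

text \<open>The outermost packing is peeled off first, and its inner discs receive rescaled copies
  of the map built from the later packings; statements are thus proved by induction on
  \<open>n\<close> for all \<open>k\<close>. The choice by \<open>SOME\<close> is unique by
  \<open>disc_unique\<close>.\<close>

fun stretch :: "nat \<Rightarrow> nat \<Rightarrow> complex \<Rightarrow> complex" where
  "stretch k 0 z = z"
| "stretch k (Suc n) z =
    (if \<exists>p\<in>I k. dist p z < R k p then
       (let p = (SOME p. p \<in> I k \<and> dist p z < R k p) in
          p + (if dist p z \<le> src k p
               then of_real (tgt k p) * stretch (Suc k) n ((z - p) / of_real (src k p))
               else of_real ((dist p z / R k p) powr (1 / K - 1)) * (z - p)))
     else z)"

declare stretch.simps(2) [simp del]

text \<open>The factor by which the radial map multiplies \<open>z - p\<close> when the later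
  generations are replaced by a similarity: below \<open>src k p\<close> it is frozen at the value
  \<open>tgt k p / src k p\<close> (\<open>profile_inside\<close>).\<close>

definition profile :: "nat \<Rightarrow> complex \<Rightarrow> real \<Rightarrow> real" where
  "profile k p r = (max r (src k p) / R k p) powr (1 / K - 1)"

lemma K\<kappa>: "\<kappa> \<le> K * \<kappa>" "0 < K * \<kappa>"
  using \<kappa> K mult_right_mono[of 1 K \<kappa>] by auto

lemma src_le: "p \<in> I k \<Longrightarrow> src k p \<le> R k p / 3"
  using radius_le K\<kappa> by blast

lemma tgt_le: "p \<in> I k \<Longrightarrow> tgt k p \<le> R k p / 3"
  using radius_le by blast

lemma src_less: "p \<in> I k \<Longrightarrow> src k p < R k p"
  using src_le[of p k] R_pos[of p k] by linarith

lemma disc_unique: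
  fixes p q z :: complex
  assumes "p \<in> I k" "q \<in> I k" "dist p z < R k p" "dist q z < R k q"
  shows "p = q"
proof (rule ccontr)
  assume "p \<noteq> q"
  hence "R k p + R k q < dist p q" using separated assms by blast
  also have "\<dots> \<le> dist p z + dist q z" by metric
  finally show False using assms by linarith
qed

lemma stretch_outside: "(\<And>p. p \<in> I k \<Longrightarrow> R k p \<le> dist p z) \<Longrightarrow> stretch k n z = z"
  by (cases n) (auto simp: not_less[symmetric] stretch.simps(2))

lemma stretch_disc:
  fixes p z :: complex
  assumes "p \<in> I k" "dist p z < R k p"
  shows "stretch k (Suc n) z =
    p + (if dist p z \<le> src k p then tgt k p * stretch (Suc k) n ((z - p) / src k p)
         else (dist p z / R k p) powr (1 / K - 1) * (z - p))"
proof -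
  have "(SOME p. p \<in> I k \<and> dist p z < R k p) = p"
    using assms disc_unique by (intro some_equality) auto
  moreover have "\<exists>p\<in>I k. dist p z < R k p" using assms by blast
  ultimately show ?thesis by (simp only: stretch.simps Let_def if_True)
qed

lemma stretch_inside:
  fixes p z :: complex
  assumes "p \<in> I k" "dist p z \<le> src k p"
  shows "stretch k (Suc n) z = p + tgt k p * stretch (Suc k) n ((z - p) / src k p)"
proof -
  have "dist p z < R k p" using assms src_less[of p k] by linarith
  thus ?thesis using stretch_disc[of p k z n] assms by simp
qed

text \<open>The reason for pairing the exponents \<open>\<kappa>\<close> and
  \<open>K * \<kappa>\<close>: as
  \<open>K * \<kappa> * (1 / K - 1) = \<kappa> - K * \<kappa>\<close>, the radial branch meets the
  similarity on the inner circle.\<close>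

lemma src_profile: "p \<in> I k \<Longrightarrow> (src k p / R k p) powr (1 / K - 1) = tgt k p / src k p"
proof -
  assume p: "p \<in> I k"
  have R: "0 < R k p" by (rule R_pos[OF p])
  have "src k p / R k p = R k p powr (K * \<kappa>)" using R by (simp add: radius_def powr_add)
  hence "(src k p / R k p) powr (1 / K - 1) = R k p powr (K * \<kappa> * (1 / K - 1))" by (simp only: powr_powr)
  also have "K * \<kappa> * (1 / K - 1) = (1 + \<kappa>) - (1 + K * \<kappa>)" using K by (simp add: field_simps)
  also have "R k p powr \<dots> = tgt k p / src k p" unfolding radius_def by (rule powr_diff)
  finally show ?thesis .
qed

lemma profile_inside: "p \<in> I k \<Longrightarrow> r \<le> src k p \<Longrightarrow> profile k p r = tgt k p / src k p"
  by (simp add: profile_def max_absorb2 src_profile)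

lemma profile_nonneg: "0 \<le> profile k p r"
  by (simp add: profile_def)

lemma exponent_le: "1 / K - 1 \<le> 0" "- 1 < 1 / K - 1"
  using K by auto

lemma profile_antimono: "p \<in> I k \<Longrightarrow> r \<le> s \<Longrightarrow> profile k p s \<le> profile k p r"
  unfolding profile_def using exponent_le R_pos[of p k] radius_pos[of p k "K * \<kappa>"]
  by (intro powr_mono2') (auto simp: divide_simps less_max_iff_disj)

lemma profile_le: "p \<in> I k \<Longrightarrow> profile k p r \<le> tgt k p / src k p"
  using profile_antimono[of p k "min r (src k p)" r] profile_inside[of p k "min r (src k p)"] by simp

text \<open>The product is the image radius of the circle of radius \<open>r\<close>: linear up to
  \<open>src k p\<close>, and \<open>R k p * (r / R k p) powr (1 / K)\<close> beyond.\<close>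

lemma mult_profile_mono:
  assumes p: "p \<in> I k" and rs: "0 \<le> r" "r \<le> s"
  shows "r * profile k p r \<le> s * profile k p s"
proof -
  let ?a = "1 / K - 1"
  have R: "0 < R k p" "0 < src k p" using R_pos radius_pos p by blast+
  have *: "r * profile k p r \<le> s * profile k p s" if "0 \<le> r" "r \<le> s" "src k p \<le> r" for r s
  proof -
    have "t * profile k p t = R k p * (t / R k p) powr (1 / K)" if "src k p \<le> t" for t
    proof -
      have "t * profile k p t = R k p * ((t / R k p) powr 1 * (t / R k p) powr ?a)"
        using that R by (simp add: profile_def max_absorb1)
      thus ?thesis by (simp only: powr_add[symmetric]) simp
    qed
    moreover have "(r / R k p) powr (1 / K) \<le> (s / R k p) powr (1 / K)"
      using that R K by (intro powr_mono2 divide_right_mono divide_nonneg_nonneg) auto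
    ultimately show ?thesis using that R by (auto intro!: mult_left_mono)
  qed
  have c: "0 \<le> tgt k p / src k p" using R(2) radius_pos[OF p, of \<kappa>] by simp
  consider "src k p \<le> r" | "s \<le> src k p" | "r \<le> src k p" "src k p \<le> s" by linarith
  thus ?thesis
  proof cases
    case 2
    thus ?thesis using rs c by (simp only: profile_inside[OF p] order_trans[OF rs(2)] mult_right_mono)
  next
    case 3
    have "r * profile k p r \<le> src k p * profile k p (src k p)"
      using 3 c by (simp only: profile_inside[OF p] order_refl mult_right_mono)
    also have "\<dots> \<le> s * profile k p s" using 3 R by (intro *) auto
    finally show ?thesis .
  qed (use * rs in auto)
qed

text \<open>The multiplier on the right belongs to the outer point and is the smaller of the two;
  the Hoelder bound depends on this. The excess of the other multiplier is paid for by the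
  monotonicity of the image radius, \<open>mult_profile_mono\<close>.\<close>

lemma radial_Lipschitz:
  fixes x y :: complex
  assumes p: "p \<in> I k" and xy: "norm y \<le> norm x"
  shows "norm (profile k p (norm x) * x - profile k p (norm y) * y) \<le> 2 * profile k p (norm x) * norm (x - y)"
proof -
  let ?a = "profile k p (norm x)" and ?b = "profile k p (norm y)"
  have ab: "?a \<le> ?b" by (rule profile_antimono[OF p xy])
  have "norm y * ?b \<le> norm x * ?a" using xy by (intro mult_profile_mono[OF p]) auto
  hence "(?b - ?a) * norm y \<le> ?a * (norm x - norm y)" by (simp add: algebra_simps)
  also have "\<dots> \<le> ?a * norm (x - y)" using norm_triangle_ineq2 profile_nonneg by (intro mult_left_mono)
  finally have 1: "(?b - ?a) * norm y \<le> ?a * norm (x - y)" .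
  have "complex_of_real ?a * x - ?b * y = ?a * (x - y) - of_real (?b - ?a) * y" by (simp add: algebra_simps)
  hence "norm (complex_of_real ?a * x - ?b * y) \<le> norm (?a * (x - y)) + norm (of_real (?b - ?a) * y)"
    by (metis norm_triangle_ineq4)
  also have "\<dots> = ?a * norm (x - y) + (?b - ?a) * norm y"
    using ab profile_nonneg unfolding norm_mult norm_of_real by simp
  finally show ?thesis using 1 by simp
qed

text \<open>Isolates the later generations as a correction supported in the inner disc; by
  \<open>stretch_near_unit\<close> it fades out towards the inner circle.\<close>

lemma stretch_eq:
  fixes p z :: complex
  assumes p: "p \<in> I k" "dist p z < R k p"
  shows "stretch k (Suc n) z = p + profile k p (norm (z - p)) * (z - p) +
    (if dist p z \<le> src k p then tgt k p * (stretch (Suc k) n ((z - p) / src k p) - (z - p) / src k p) else 0)"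
proof (cases "dist p z \<le> src k p")
  case True
  thus ?thesis
    using stretch_inside[OF p(1) True, of n] profile_inside[OF p(1), of "norm (z - p)"] radius_pos[OF p(1), of "K * \<kappa>"]
    by (simp add: dist_norm norm_minus_commute algebra_simps)
next
  case False
  thus ?thesis using stretch_disc[OF p, of n]
    by (simp add: profile_def dist_norm norm_minus_commute max_absorb1)
qed

lemma norm_inside: "(p::complex) \<in> I k \<Longrightarrow> dist p (z::complex) \<le> src k p \<Longrightarrow> norm ((z - p) / src k p) \<le> 1"
  using radius_pos[of p k "K * \<kappa>"] by (simp add: norm_divide dist_norm norm_minus_commute)

text \<open>With \<open>\<rho> = dist p z / R k p\<close> the image has distance
  \<open>R k p * \<rho> powr (1 / K)\<close> from \<open>p\<close>, and \<open>\<rho>\<close> lies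
  between \<open>src k p / R k p\<close> and 1. The displacement is
  \<open>R k p * (\<rho> powr (1 / K) - \<rho>)\<close>.\<close>

lemma annulus_image:
  fixes p z :: complex
  assumes "p \<in> I k" "src k p < dist p z" "dist p z < R k p"
  shows "tgt k p < dist p (stretch k (Suc n) z)" "dist p (stretch k (Suc n) z) < R k p"
    "dist z (stretch k (Suc n) z) \<le> R k p - dist p z"
proof -
  let ?r = "norm (z - p)"
  define \<rho> where "\<rho> = ?r / R k p"
  have R: "0 < R k p" "0 < src k p" using R_pos radius_pos assms(1) by blast+
  have r: "src k p < ?r" "?r < R k p" "dist p z = ?r" using assms by (auto simp: dist_norm norm_minus_commute)
  have \<rho>: "0 < \<rho>" "\<rho> < 1" "?r = R k p * \<rho>"
    using r R unfolding \<rho>_def by (auto intro!: divide_pos_pos)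
  have eq: "stretch k (Suc n) z = p + (\<rho> powr (1 / K - 1)) * (z - p)"
    using stretch_disc[OF assms(1,3), of n] assms(2) by (simp add: \<rho>_def r(3)[symmetric])
  have pp: "\<rho> * \<rho> powr (1 / K - 1) = \<rho> powr (1 / K)"
    using \<rho> powr_add[of \<rho> 1 "1 / K - 1"] by simp
  have d: "dist p (stretch k (Suc n) z) = R k p * \<rho> powr (1 / K)"
    unfolding eq using pp \<rho>(3) by (simp add: dist_norm norm_mult mult.commute mult.left_commute)
  have "\<rho> powr (1 / K) < 1 powr (1 / K)" using \<rho> K by (intro powr_less_mono2) auto
  thus "dist p (stretch k (Suc n) z) < R k p" unfolding d using R by simp
  have "tgt k p = src k p * (src k p / R k p) powr (1 / K - 1)" using src_profile[OF assms(1)] R by simp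
  also have "\<dots> = R k p * ((src k p / R k p) * (src k p / R k p) powr (1 / K - 1))" using R by simp
  also have "\<dots> = R k p * (src k p / R k p) powr (1 / K)"
    using R powr_add[of "src k p / R k p" 1 "1 / K - 1"] by simp
  also have "\<dots> < R k p * \<rho> powr (1 / K)"
    using R r K unfolding \<rho>_def by (intro mult_strict_left_mono powr_less_mono2 divide_strict_right_mono) auto
  finally show "tgt k p < dist p (stretch k (Suc n) z)" unfolding d .
  have ge: "1 \<le> \<rho> powr (1 / K - 1)" using powr_mono'[of "1 / K - 1" 0 \<rho>] exponent_le \<rho> by simp
  have "stretch k (Suc n) z - z = of_real (\<rho> powr (1 / K - 1) - 1) * (z - p)" unfolding eq by (simp add: algebra_simps)
  hence "norm (stretch k (Suc n) z - z) = (\<rho> powr (1 / K - 1) - 1) * ?r"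
    using ge by (simp only: norm_mult norm_of_real)
  hence "dist z (stretch k (Suc n) z) = (\<rho> powr (1 / K - 1) - 1) * ?r"
    by (simp only: dist_norm norm_minus_commute)
  also have "\<dots> = R k p * (\<rho> powr (1 / K) - \<rho>)" unfolding \<rho>(3) pp[symmetric] by (simp add: algebra_simps)
  also have "\<dots> \<le> R k p * (1 - \<rho>)"
    using R \<rho> powr_le1[of "1 / K" \<rho>] K by (intro mult_left_mono) auto
  also have "\<dots> = R k p - dist p z" unfolding r \<rho>(3) by (simp add: algebra_simps)
  finally show "dist z (stretch k (Suc n) z) \<le> R k p - dist p z" .
qed

lemma norm_stretch_le_1: "norm z \<le> 1 \<Longrightarrow> norm (stretch k n z) \<le> 1"
proof (induction n arbitrary: k z)
  case (Suc n)
  show ?case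
  proof (cases "\<exists>p\<in>I k. dist p z < R k p")
    case True
    then obtain p where p: "p \<in> I k" "dist p z < R k p" by blast
    have "dist p (stretch k (Suc n) z) \<le> R k p"
    proof (cases "dist p z \<le> src k p")
      case True
      have t: "0 < tgt k p" by (rule radius_pos[OF p(1)])
      have "dist p (stretch k (Suc n) z) = tgt k p * norm (stretch (Suc k) n ((z - p) / src k p))"
        using stretch_inside[OF p(1) True, of n] t by (simp add: dist_norm norm_mult)
      also have "\<dots> \<le> tgt k p * 1" using Suc.IH[OF norm_inside[OF p(1) True]] t by (intro mult_left_mono) auto
      finally show ?thesis using tgt_le[OF p(1)] R_pos[OF p(1)] by linarith
    qed (use annulus_image(2)[OF p(1) _ p(2), of n] in auto)
    moreover have "norm (stretch k (Suc n) z) \<le> norm p + dist p (stretch k (Suc n) z)"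
      using norm_triangle_sub[of "stretch k (Suc n) z" p] by (simp add: dist_norm norm_minus_commute)
    ultimately show ?thesis using norm_centre[OF p(1)] R_less[OF p(1)] by linarith
  qed (use stretch_outside[of k z "Suc n"] Suc.prems in \<open>auto simp: not_less\<close>)
qed simp

text \<open>A point is moved by at most its distance to the boundary circle of its packing disc.
  Hence two points without a common packing disc are each moved by at most their mutual distance
  (\<open>stretch_near_outside\<close>).\<close>

lemma stretch_near:
  fixes p z :: complex
  assumes p: "p \<in> I k" "dist p z < R k p"
  shows "dist z (stretch k n z) \<le> R k p - dist p z"
proof (cases n)
  case (Suc m)
  show ?thesis
  proof (cases "dist p z \<le> src k p")
    case True
    have t: "0 < tgt k p" by (rule radius_pos[OF p(1)])
    have "dist p (stretch k n z) = tgt k p * norm (stretch (Suc k) m ((z - p) / src k p))"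
      using stretch_inside[OF p(1) True, of m] t Suc by (simp add: dist_norm norm_mult)
    also have "\<dots> \<le> tgt k p * 1" using norm_stretch_le_1[OF norm_inside[OF p(1) True]] t by (intro mult_left_mono) auto
    finally have "dist z (stretch k n z) \<le> dist p z + tgt k p"
      using dist_triangle[of z "stretch k n z" p] by (simp add: dist_commute)
    \<comment> \<open>This is \<open>2 * src k p + tgt k p \<le> R k p\<close>, both radii being at
      most a third of \<open>R k p\<close>.\<close>
    also have "\<dots> \<le> R k p - dist p z" using True src_le[OF p(1)] tgt_le[OF p(1)] by linarith
    finally show ?thesis .
  qed (use annulus_image(3)[OF p(1) _ p(2), of m] Suc in auto)
qed (use p in auto)

lemma stretch_near_outside:
  fixes z w :: complex
  assumes "\<And>p. p \<in> I k \<Longrightarrow> dist p z < R k p \<Longrightarrow> R k p \<le> dist p w"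
  shows "dist z (stretch k n z) \<le> dist z w"
proof (cases "\<exists>p\<in>I k. dist p z < R k p")
  case True
  then obtain p where p: "p \<in> I k" "dist p z < R k p" by blast
  have "dist z (stretch k n z) \<le> R k p - dist p z" by (rule stretch_near[OF p])
  also have "\<dots> \<le> dist z w" using assms[OF p] dist_triangle[of p w z] by simp
  finally show ?thesis .
qed (use stretch_outside[of k z n] in \<open>auto simp: not_less\<close>)

lemma stretch_near_unit:
  fixes z :: complex
  assumes "norm z \<le> 1"
  shows "dist z (stretch k n z) \<le> 1 - norm z"
proof (cases "\<exists>p\<in>I k. dist p z < R k p")
  case True
  then obtain p where p: "p \<in> I k" "dist p z < R k p" by blast
  have "norm z \<le> norm p + dist p z" by (metis dist_commute dist_norm norm_triangle_sub)
  thus ?thesis using stretch_near[OF p, of n] norm_centre[OF p(1)] R_less[OF p(1)] by linarith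
qed (use stretch_outside[of k z n] assms in \<open>auto simp: not_less\<close>)

text \<open>The common source of the Lipschitz and the Hoelder bound: no packing disc in common;
  both points in one inner disc, where the recursion applies; or the outer point, at distance
  \<open>r\<close> from \<open>p\<close>, in the ring. In the last case the later generations enter
  only through the correction of \<open>stretch_eq\<close>, bounded by the term with
  \<open>min\<close>.\<close>

lemma stretch_trichotomy:
  obtains "dist (stretch k (Suc n) z) (stretch k (Suc n) w) \<le> 3 * dist z w"
  | p where "p \<in> I k" "dist p z \<le> src k p" "dist p w \<le> src k p"
  | p r where "p \<in> I k" "src k p < r" "r < R k p" "dist z w \<le> 2 * r"
      "dist (stretch k (Suc n) z) (stretch k (Suc n) w)
        \<le> 2 * profile k p r * dist z w + tgt k p * min 1 (dist z w / src k p)"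
proof -
  let ?f = "stretch k (Suc n)"
  note cases = that
  show thesis
  proof (cases "\<exists>p\<in>I k. dist p z < R k p \<and> dist p w < R k p")
    case False
    have "dist z (?f z) \<le> dist z w" using False by (intro stretch_near_outside) (auto simp: not_less)
    moreover have "dist w (?f w) \<le> dist w z" using False by (intro stretch_near_outside) (auto simp: not_less)
    ultimately have "dist (?f z) (?f w) \<le> 3 * dist z w"
      using dist_triangle3[of "?f z" "?f w" z] dist_triangle[of z "?f w" w] by (simp add: dist_commute)
    thus thesis by (rule cases(1))
  next
    case True
    then obtain p where p: "p \<in> I k" "dist p z < R k p" "dist p w < R k p" by blast
    have s: "0 < src k p" "0 < tgt k p" using radius_pos p(1) by blast+
    \<comment> \<open>\<open>u\<close> stands for the point farther from \<open>p\<close>, in either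
      order of \<open>z\<close> and \<open>w\<close>.\<close>
    have main: thesis if uv: "{u, v} = {z, w}" "dist p v \<le> dist p u" "src k p < dist p u" for u v
    proof (rule cases(3)[OF p(1) uv(3)])
      have dz: "dist (?f z) (?f w) = dist (?f u) (?f v)" "dist z w = dist u v"
        using uv(1) by (auto simp: doubleton_eq_iff dist_commute)
      have pu: "dist p u < R k p" "dist p v < R k p" using uv(1) p by (auto simp: doubleton_eq_iff)
      show "dist p u < R k p" by fact
      show "dist z w \<le> 2 * dist p u" unfolding dz using uv(2) dist_triangle3[of u v p] by linarith
      define e where "e = (if dist p v \<le> src k p then
         tgt k p * (stretch (Suc k) n ((v - p) / src k p) - (v - p) / src k p) else 0)"
      have fu: "?f u = p + profile k p (norm (u - p)) * (u - p)" using stretch_eq[OF p(1) pu(1), of n] uv(3) by simp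
      have fv: "?f v = p + profile k p (norm (v - p)) * (v - p) + e" using stretch_eq[OF p(1) pu(2), of n] by (simp only: e_def)
      have "norm e \<le> tgt k p * min 1 (dist u v / src k p)"
      proof (cases "dist p v \<le> src k p")
        case True
        have nv: "norm ((v - p) / src k p) = dist p v / src k p" using s by (simp add: norm_divide dist_norm norm_minus_commute)
        have "norm e = tgt k p * dist ((v - p) / src k p) (stretch (Suc k) n ((v - p) / src k p))"
          using True s by (simp add: e_def norm_mult dist_norm norm_minus_commute)
        also have "\<dots> \<le> tgt k p * (1 - norm ((v - p) / src k p))"
          using s stretch_near_unit[OF norm_inside[OF p(1) True]] by (intro mult_left_mono) auto
        also have "\<dots> \<le> tgt k p * min 1 (dist u v / src k p)"
        proof (intro mult_left_mono)
          have "src k p \<le> dist p v + dist u v" using uv(3) dist_triangle[of p u v] by (simp add: dist_commute)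
          hence "1 \<le> (dist p v + dist u v) / src k p" using s by simp
          hence "1 - dist p v / src k p \<le> dist u v / src k p" by (simp add: add_divide_distrib)
          moreover have "0 \<le> dist p v / src k p" using s by simp
          ultimately show "1 - norm ((v - p) / src k p) \<le> min 1 (dist u v / src k p)" unfolding nv by simp
        qed (use s in auto)
        finally show ?thesis .
      qed (use s in \<open>auto simp: e_def\<close>)
      moreover have "norm (profile k p (norm (u - p)) * (u - p) - profile k p (norm (v - p)) * (v - p))
          \<le> 2 * profile k p (norm (u - p)) * norm ((u - p) - (v - p))"
        using uv(2) by (intro radial_Lipschitz[OF p(1)]) (simp add: dist_norm norm_minus_commute)
      moreover have "dist (?f u) (?f v) \<le>
          norm (profile k p (norm (u - p)) * (u - p) - profile k p (norm (v - p)) * (v - p)) + norm e"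
        unfolding fu fv dist_norm by (rule order_trans[OF _ norm_triangle_ineq4]) (simp add: algebra_simps)
      ultimately show "dist (?f z) (?f w) \<le> 2 * profile k p (dist p u) * dist z w + tgt k p * min 1 (dist z w / src k p)"
        unfolding dz by (simp add: dist_norm norm_minus_commute)
    qed
    consider "dist p z \<le> src k p" "dist p w \<le> src k p" | "src k p < dist p z" "dist p w \<le> dist p z"
      | "src k p < dist p w" "dist p z \<le> dist p w" by linarith
    thus thesis
    proof cases
      case 1 thus thesis by (rule cases(2)[OF p(1)])
    next
      case 2 thus thesis by (intro main[of z w]) auto
    next
      case 3 thus thesis by (intro main[of w z]) auto
    qed
  qed
qed

lemma dist_stretch_inside:
  fixes p z w :: complex
  assumes "p \<in> I k" "dist p z \<le> src k p" "dist p w \<le> src k p"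
  shows "dist (stretch k (Suc n) z) (stretch k (Suc n) w)
      = tgt k p * dist (stretch (Suc k) n ((z - p) / src k p)) (stretch (Suc k) n ((w - p) / src k p))"
    and "dist ((z - p) / src k p) ((w - p) / src k p) = dist z w / src k p"
proof -
  have "0 < tgt k p" "0 < src k p" using radius_pos assms(1) by blast+
  thus "dist (stretch k (Suc n) z) (stretch k (Suc n) w)
      = tgt k p * dist (stretch (Suc k) n ((z - p) / src k p)) (stretch (Suc k) n ((w - p) / src k p))"
    and "dist ((z - p) / src k p) ((w - p) / src k p) = dist z w / src k p"
    by (simp_all only: stretch_inside[OF assms(1,2)] stretch_inside[OF assms(1,3)] dist_norm
        add_diff_cancel_left right_diff_distrib[symmetric] norm_mult diff_divide_distrib[symmetric] norm_divide
        norm_of_real abs_of_pos diff_diff_eq2 diff_add_cancel)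
qed

text \<open>The constant depends on \<open>n\<close>; it serves for estimates on compact sets off
  \<open>E\<close>, where one \<open>n\<close> is enough.\<close>

lemma stretch_Lipschitz: "\<exists>M\<ge>0. \<forall>z w. dist (stretch k n z) (stretch k n w) \<le> M * dist z w"
proof (induction n arbitrary: k)
  case 0
  show ?case by (intro exI[of _ 1]) simp
next
  case (Suc n)
  obtain M where M: "M \<ge> 0" "\<And>z w. dist (stretch (Suc k) n z) (stretch (Suc k) n w) \<le> M * dist z w"
    using Suc by blast
  define c where "c p = tgt k p / src k p" for p
  define M' where "M' = 3 + (\<Sum>p\<in>I k. c p * (M + 3))"
  have c0: "0 \<le> c p" if "p \<in> I k" for p using radius_pos[OF that] by (simp add: c_def less_imp_le)
  have c: "c p * (M + 3) \<le> M'" if "p \<in> I k" for p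
    using member_le_sum[of p "I k" "\<lambda>p. c p * (M + 3)"] that c0 M(1) by (simp add: M'_def)
  have M': "3 \<le> M'" unfolding M'_def using c0 M(1) by (simp add: sum_nonneg)
  have "dist (stretch k (Suc n) z) (stretch k (Suc n) w) \<le> M' * dist z w" for z w
  proof (rule stretch_trichotomy[of k n z w])
    assume "dist (stretch k (Suc n) z) (stretch k (Suc n) w) \<le> 3 * dist z w"
    also have "\<dots> \<le> M' * dist z w" using M' by (intro mult_right_mono) auto
    finally show ?thesis .
  next
    fix p assume p: "p \<in> I k" "dist p z \<le> src k p" "dist p w \<le> src k p"
    have "dist (stretch k (Suc n) z) (stretch k (Suc n) w) \<le> tgt k p * (M * (dist z w / src k p))"
      unfolding dist_stretch_inside(1)[OF p] dist_stretch_inside(2)[OF p, symmetric]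
      using radius_pos[OF p(1), of \<kappa>] by (intro mult_left_mono M(2)) auto
    also have "\<dots> = c p * M * dist z w" by (simp add: c_def)
    also have "\<dots> \<le> M' * dist z w"
      using c[OF p(1)] c0[OF p(1)] by (intro mult_right_mono) (auto simp: algebra_simps)
    finally show ?thesis .
  next
    fix p r assume p: "p \<in> I k" and b: "dist (stretch k (Suc n) z) (stretch k (Suc n) w)
        \<le> 2 * profile k p r * dist z w + tgt k p * min 1 (dist z w / src k p)"
    have "2 * profile k p r * dist z w \<le> 2 * c p * dist z w"
      using profile_le[OF p, of r] by (intro mult_right_mono) (auto simp: c_def)
    moreover have "tgt k p * min 1 (dist z w / src k p) \<le> c p * dist z w"
      using radius_pos[OF p, of \<kappa>] mult_left_mono[of "min 1 (dist z w / src k p)" "dist z w / src k p" "tgt k p"]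
      by (simp add: c_def)
    ultimately have "dist (stretch k (Suc n) z) (stretch k (Suc n) w) \<le> (3 * c p) * dist z w"
      using b by (simp add: algebra_simps)
    also have "\<dots> \<le> M' * dist z w"
      using c[OF p(1)] c0[OF p(1)] M(1) by (intro mult_right_mono) (auto simp: algebra_simps intro: order_trans[rotated])
    finally show ?thesis .
  qed
  thus ?case using M' by (intro exI[of _ M']) auto
qed

text \<open>Both sides equal \<open>tgt k p / src k p\<close> at \<open>r = src k p\<close>. Beyond,
  the profile decays like \<open>r powr (1 / K - 1)\<close>, at least as fast as the right side
  because \<open>1 / K \<le> (1 + \<kappa>) / (1 + K * \<kappa>)\<close>.\<close>

lemma profile_le_powr:
  assumes p: "p \<in> I k" and r: "src k p \<le> r"
  shows "profile k p r \<le> r powr ((1 + \<kappa>) / (1 + K * \<kappa>) - 1)"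
proof -
  define \<gamma> where "\<gamma> = (1 + \<kappa>) / (1 + K * \<kappa>)"
  have R: "0 < R k p" "0 < src k p" using R_pos radius_pos p by blast+
  have r0: "0 < r" using r R by linarith
  have d: "1 + K * \<kappa> > 0" using K\<kappa> by simp
  have "1 / K \<le> \<gamma>" using K \<kappa> d by (simp add: \<gamma>_def field_simps)
  hence "src k p powr (\<gamma> - 1 / K) \<le> r powr (\<gamma> - 1 / K)" using r R by (intro powr_mono2) auto
  moreover have "src k p powr (\<gamma> - 1 / K) = R k p powr (1 - 1 / K)"
  proof -
    have "(1 + K * \<kappa>) * \<gamma> = 1 + \<kappa>" using d by (simp add: \<gamma>_def)
    moreover have "(1 + K * \<kappa>) * (1 / K) = 1 / K + \<kappa>" using K by (simp add: field_simps)
    ultimately have "(1 + K * \<kappa>) * (\<gamma> - 1 / K) = 1 - 1 / K" by (simp only: right_diff_distrib)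
    thus ?thesis by (simp only: radius_def powr_powr)
  qed
  ultimately have "R k p powr (1 - 1 / K) * r powr (1 / K - 1) \<le> r powr (\<gamma> - 1 / K) * r powr (1 / K - 1)"
    by (intro mult_right_mono) auto
  moreover have "profile k p r = R k p powr (1 - 1 / K) * r powr (1 / K - 1)"
  proof -
    have "1 - 1 / K = - (1 / K - 1)" by simp
    hence e: "R k p powr (1 - 1 / K) = inverse (R k p powr (1 / K - 1))" by (simp only: powr_minus)
    have "profile k p r = r powr (1 / K - 1) / R k p powr (1 / K - 1)"
      unfolding profile_def max_absorb1[OF r] by (rule powr_divide)
    thus ?thesis unfolding e by (simp add: divide_inverse[of _ "_ powr _"])
  qed
  ultimately show ?thesis unfolding \<gamma>_def[symmetric] powr_add[symmetric] by simp
qed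

text \<open>The exponent \<open>\<gamma>\<close> is the one with
  \<open>tgt k p = src k p powr \<gamma>\<close>, so rescaling to an inner disc reproduces the claim
  with the same constant, uniformly in \<open>n\<close>. Points without a common disc give the
  constant \<open>3 * 2\<close>, the ring gives \<open>2 * 2 + 1\<close>. The range 2 is the
  diameter of the unit disc.\<close>

lemma stretch_Hoelder:
  "dist z w \<le> 2 \<Longrightarrow> dist (stretch k n z) (stretch k n w) \<le> 6 * dist z w powr ((1 + \<kappa>) / (1 + K * \<kappa>))"
proof (induction n arbitrary: k z w)
  define \<gamma> where "\<gamma> = (1 + \<kappa>) / (1 + K * \<kappa>)"
  have d: "1 + K * \<kappa> > 0" using K\<kappa> by simp
  have \<gamma>: "0 < \<gamma>" "\<gamma> \<le> 1"
    unfolding \<gamma>_def pos_divide_le_eq[OF d] using \<kappa> K\<kappa>(1) divide_pos_pos[OF _ d, of "1 + \<kappa>"] by auto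
  have lin: "x \<le> 2 * x powr \<gamma>" if x: "0 \<le> x" "x \<le> 2" for x :: real
  proof (cases "x = 0")
    case False
    have "x = x powr (1 - \<gamma>) * x powr \<gamma>" using x False powr_add[of x "1 - \<gamma>" \<gamma>] by simp
    also have "x powr (1 - \<gamma>) \<le> 2 powr (1 - \<gamma>)" using x \<gamma> by (intro powr_mono2) auto
    also have "2 powr (1 - \<gamma>) \<le> 2 powr (1 :: real)" using \<gamma> by (intro powr_mono) auto
    finally show ?thesis by (simp add: mult_right_mono)
  qed simp
  {
    case 0
    hence "dist z w \<le> 2 * dist z w powr \<gamma>" by (intro lin) auto
    also have "\<dots> \<le> 6 * dist z w powr \<gamma>" by simp
    finally show ?case unfolding \<gamma>_def by simp
  next
    case (Suc n)
    show ?case unfolding \<gamma>_def[symmetric]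
    proof (rule stretch_trichotomy[of k n z w])
      assume "dist (stretch k (Suc n) z) (stretch k (Suc n) w) \<le> 3 * dist z w"
      thus "dist (stretch k (Suc n) z) (stretch k (Suc n) w) \<le> 6 * dist z w powr \<gamma>"
        using lin[of "dist z w"] Suc.prems by simp
    next
      fix p assume p: "p \<in> I k" "dist p z \<le> src k p" "dist p w \<le> src k p"
      have s: "0 < src k p" "0 < tgt k p" using radius_pos p(1) by blast+
      have st: "tgt k p = src k p powr \<gamma>" unfolding radius_def \<gamma>_def powr_powr using d by simp
      have "dist ((z - p) / src k p) ((w - p) / src k p) \<le> 2"
        using norm_inside[OF p(1,2)] norm_inside[OF p(1,3)]
          norm_triangle_ineq4[of "(z - p) / src k p" "(w - p) / src k p"] by (simp add: dist_norm)
      from Suc.IH[OF this, of "Suc k"]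
      have "dist (stretch k (Suc n) z) (stretch k (Suc n) w) \<le> tgt k p * (6 * (dist z w / src k p) powr \<gamma>)"
        unfolding dist_stretch_inside[OF p] \<gamma>_def[symmetric] using s by (intro mult_left_mono) auto
      also have "\<dots> = 6 * dist z w powr \<gamma>" unfolding st using s by (simp add: powr_divide)
      finally show "dist (stretch k (Suc n) z) (stretch k (Suc n) w) \<le> 6 * dist z w powr \<gamma>" .
    next
      fix p r assume p: "p \<in> I k" and r: "src k p < r" "r < R k p" "dist z w \<le> 2 * r"
        and b: "dist (stretch k (Suc n) z) (stretch k (Suc n) w)
          \<le> 2 * profile k p r * dist z w + tgt k p * min 1 (dist z w / src k p)"
      have s: "0 < src k p" "0 < tgt k p" using radius_pos p(1) by blast+
      have st: "tgt k p = src k p powr \<gamma>" unfolding radius_def \<gamma>_def powr_powr using d by simp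
      show "dist (stretch k (Suc n) z) (stretch k (Suc n) w) \<le> 6 * dist z w powr \<gamma>"
      proof (cases "z = w")
        case False
        hence \<delta>: "0 < dist z w" by simp
        have "profile k p r * dist z w \<le> r powr (\<gamma> - 1) * dist z w"
          unfolding \<gamma>_def using profile_le_powr[OF p, of r] r by (intro mult_right_mono) auto
        also have "\<dots> = r powr (\<gamma> - 1) * (dist z w powr (1 - \<gamma>) * dist z w powr \<gamma>)"
          using \<delta> by (simp add: powr_add[symmetric])
        also have "\<dots> \<le> r powr (\<gamma> - 1) * ((2 * r powr (1 - \<gamma>)) * dist z w powr \<gamma>)"
        proof (intro mult_left_mono mult_right_mono)
          have "dist z w powr (1 - \<gamma>) \<le> (2 * r) powr (1 - \<gamma>)" using r \<gamma> by (intro powr_mono2) auto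
          also have "\<dots> = 2 powr (1 - \<gamma>) * r powr (1 - \<gamma>)" using r s by (simp add: powr_mult)
          also have "\<dots> \<le> 2 powr 1 * r powr (1 - \<gamma>)" using \<gamma> by (intro mult_right_mono powr_mono) auto
          finally show "dist z w powr (1 - \<gamma>) \<le> 2 * r powr (1 - \<gamma>)" by simp
        qed auto
        also have "\<dots> = 2 * (r powr (\<gamma> - 1) * r powr (1 - \<gamma>)) * dist z w powr \<gamma>" by simp
        also have "r powr (\<gamma> - 1) * r powr (1 - \<gamma>) = 1" using r s by (simp add: powr_add[symmetric])
        finally have 1: "profile k p r * dist z w \<le> 2 * dist z w powr \<gamma>" by simp
        have "min 1 x \<le> x powr \<gamma>" if "0 < x" for x :: real
        proof (cases "x \<le> 1")
          case True
          thus ?thesis using that \<gamma> powr_mono'[of \<gamma> 1 x] by simp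
        qed (use \<gamma> in \<open>simp add: ge_one_powr_ge_zero\<close>)
        hence "tgt k p * min 1 (dist z w / src k p) \<le> tgt k p * (dist z w / src k p) powr \<gamma>"
          using s \<delta> by (intro mult_left_mono) auto
        also have "\<dots> = dist z w powr \<gamma>" unfolding st using s by (simp add: powr_divide)
        finally show ?thesis using b 1 powr_ge_zero[of "dist z w" \<gamma>] by linarith
      qed simp
    qed
  }
qed

text \<open>Rings go into rings by \<open>annulus_image\<close> and points outside all packing discs
  are fixed, so only images of inner discs can reach the target stage. This keeps the values of the
  map where the limit potential is holomorphic.\<close>

lemma stretch_avoids_stage: "z \<notin> stage (K * \<kappa>) k n \<Longrightarrow> stretch k n z \<notin> stage \<kappa> k n"
proof (induction n arbitrary: k z)
  case (Suc n)
  have in_disc: "dist q y \<le> tgt k q" if q: "q \<in> I k" and y: "y \<in> (\<lambda>z. q + tgt k q * z) ` stage \<kappa> (Suc k) n" for q y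
  proof -
    obtain x :: complex where x: "y = q + tgt k q * x" "x \<in> stage \<kappa> (Suc k) n" using y by blast
    moreover have "norm x \<le> 1" using x(2) stage_antimono[of \<kappa> 0 n "Suc k"] by auto
    ultimately show ?thesis using radius_pos[OF q, of \<kappa>] by (simp add: dist_norm norm_mult mult_left_le)
  qed
  show ?case
  proof (rule ccontr)
    assume "\<not> ?case"
    then obtain q where q: "q \<in> I k" "stretch k (Suc n) z \<in> (\<lambda>z. q + tgt k q * z) ` stage \<kappa> (Suc k) n" by auto
    hence dq: "dist q (stretch k (Suc n) z) \<le> tgt k q" by (rule in_disc)
    hence dq': "dist q (stretch k (Suc n) z) < R k q" using tgt_le[OF q(1)] R_pos[OF q(1)] by linarith
    show False
    proof (cases "\<exists>p\<in>I k. dist p z < R k p")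
      case False
      hence "stretch k (Suc n) z = z" by (intro stretch_outside) (auto simp: not_less)
      thus False using dq' False q(1) by auto
    next
      case True
      then obtain p where p: "p \<in> I k" "dist p z < R k p" by blast
      have s: "0 < src k p" "0 < tgt k p" using radius_pos p(1) by blast+
      show False
      proof (cases "dist p z \<le> src k p")
        case True
        note fz = stretch_inside[OF p(1) True, of n]
        have "dist p (stretch k (Suc n) z) \<le> tgt k p * 1"
          unfolding fz dist_norm using norm_stretch_le_1[OF norm_inside[OF p(1) True], of "Suc k" n] s
          by (simp add: norm_mult)
        hence "dist p (stretch k (Suc n) z) < R k p" using tgt_le[OF p(1)] R_pos[OF p(1)] by linarith
        hence "p = q" using disc_unique p(1) q(1) dq' by blast
        hence "stretch (Suc k) n ((z - p) / src k p) \<in> stage \<kappa> (Suc k) n"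
          using q(2) s unfolding fz by auto
        moreover have "(z - p) / src k p \<notin> stage (K * \<kappa>) (Suc k) n"
        proof
          assume a: "(z - p) / src k p \<in> stage (K * \<kappa>) (Suc k) n"
          have "z = p + src k p * ((z - p) / src k p)" using s by simp
          with a have "z \<in> (\<lambda>z. p + src k p * z) ` stage (K * \<kappa>) (Suc k) n" by (rule_tac image_eqI)
          thus False using Suc.prems p(1) by auto
        qed
        ultimately show False using Suc.IH by blast
      next
        case False
        hence "tgt k p < dist p (stretch k (Suc n) z)" "dist p (stretch k (Suc n) z) < R k p"
          using annulus_image(1,2)[OF p(1) _ p(2), of n] by auto
        moreover from this have "p = q" using disc_unique p(1) q(1) dq' by blast
        ultimately show False using dq by simp
      qed
    qed
  qed
qed simp

text \<open>The packing added last alters the map only inside the discs of stage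
  \<open>n\<close>.\<close>

lemma stretch_stable_Suc: "z \<notin> stage (K * \<kappa>) k n \<Longrightarrow> stretch k (Suc n) z = stretch k n z"
proof (induction n arbitrary: k z)
  case 0
  have "R k p \<le> dist p z" if p: "p \<in> I k" for p
  proof -
    have "norm z \<le> norm p + dist p z" by (metis dist_commute dist_norm norm_triangle_sub)
    thus ?thesis using 0 norm_centre[OF p] R_less[OF p] by simp
  qed
  thus ?case by (simp only: stretch_outside)
next
  case (Suc n)
  show ?case
  proof (cases "\<exists>p\<in>I k. dist p z < R k p")
    case True
    then obtain p where p: "p \<in> I k" "dist p z < R k p" by blast
    show ?thesis
    proof (cases "dist p z \<le> src k p")
      case True
      have s: "0 < src k p" using radius_pos p(1) by blast
      have "(z - p) / src k p \<notin> stage (K * \<kappa>) (Suc k) n"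
      proof
        assume a: "(z - p) / src k p \<in> stage (K * \<kappa>) (Suc k) n"
        have "z = p + src k p * ((z - p) / src k p)" using s by simp
        with a have "z \<in> (\<lambda>z. p + src k p * z) ` stage (K * \<kappa>) (Suc k) n" by (rule_tac image_eqI)
        thus False using Suc.prems p(1) by auto
      qed
      from Suc.IH[OF this] show ?thesis using stretch_inside[OF p(1) True] by simp
    next
      case False
      thus ?thesis using stretch_disc[OF p] by simp
    qed
  next
    case False
    hence *: "\<And>p. p \<in> I k \<Longrightarrow> R k p \<le> dist p z" by (auto simp: not_less)
    show ?thesis by (simp only: stretch_outside[OF *])
  qed
qed

lemma stretch_stable:
  assumes "z \<notin> stage (K * \<kappa>) k n" "n \<le> m"
  shows "stretch k m z = stretch k n z"
  using assms(2)
proof (induction m rule: dec_induct)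
  case (step m)
  have "z \<notin> stage (K * \<kappa>) k m" using assms(1) stage_antimono[OF K\<kappa>(1) step(1)] by blast
  thus ?case using stretch_stable_Suc step by simp
qed simp

text \<open>The circles of the first \<open>n\<close> generations, where the branches of the map
  meet.\<close>

fun critical :: "nat \<Rightarrow> nat \<Rightarrow> complex set" where
  "critical k 0 = {}"
| "critical k (Suc n) = (\<Union>p\<in>I k. sphere p (R k p) \<union> sphere p (src k p) \<union>
     (\<lambda>z. p + of_real (src k p) * z) ` critical (Suc k) n)"

lemma negligible_critical: "negligible (critical k n)"
proof (induction n arbitrary: k)
  case (Suc n)
  show ?case unfolding critical.simps
    by (intro negligible_Union finite_imageI finite_I)
      (auto intro!: negligible_Un negligible_affine_image Suc negligible_sphere)
qed simp

text \<open>\<open>a\<close> and \<open>b\<close> are the two complex derivatives, and the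
  inequality is the Beltrami bound. Similarities leave it unchanged, so only the ring containing
  \<open>z\<close>, if there is one, matters.\<close>

lemma stretch_has_derivative:
  "z \<notin> critical k n \<Longrightarrow> \<exists>a b. norm b \<le> (K - 1) / (K + 1) * norm a \<and>
      (stretch k n has_derivative (\<lambda>v. a * v + b * cnj v)) (at z)"
proof (induction n arbitrary: k z)
  case 0
  have "(stretch k 0 has_derivative (\<lambda>v. 1 * v + 0 * cnj v)) (at z)"
    by (rule has_derivative_transform_within_open[OF has_derivative_ident open_UNIV, THEN has_derivative_eq_rhs]) auto
  thus ?case using K by (intro exI[of _ 1] exI[of _ 0]) auto
next
  case (Suc n)
  have off: "dist p z \<noteq> R k p" "dist p z \<noteq> src k p" if "p \<in> I k" for p
    using Suc.prems that by auto
  consider "\<And>p. p \<in> I k \<Longrightarrow> R k p < dist p z" | p where "p \<in> I k" "src k p < dist p z" "dist p z < R k p"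
    | p where "p \<in> I k" "dist p z < src k p"
    using off by (meson linorder_neqE_linordered_idom not_le)
  thus ?case
  proof cases
    case 1
    have "(stretch k (Suc n) has_derivative (\<lambda>v. v)) (at z)"
    proof (rule has_derivative_transform_within_open[OF has_derivative_ident])
      show "open (- (\<Union>p\<in>I k. cball p (R k p)))" by (intro open_Compl closed_UN) auto
      show "z \<in> - (\<Union>p\<in>I k. cball p (R k p))" using 1 by force
      show "w = stretch k (Suc n) w" if "w \<in> - (\<Union>p\<in>I k. cball p (R k p))" for w
        using that by (intro stretch_outside[symmetric]) (auto simp: not_le intro: less_imp_le)
    qed
    thus ?thesis using K by (intro exI[of _ 1] exI[of _ 0]) auto
  next
    case (2 p)
    let ?a = "1 / K - 1"
    define c where "c = (dist p z / R k p) powr ?a"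
    have "((\<lambda>z. p + of_real ((dist p z / R k p) powr ?a) * (z - p)) has_derivative
     (\<lambda>v. of_real c * (of_real (1 + ?a / 2) * v + of_real (?a / 2) * ((z - p) / cnj (z - p)) * cnj v))) (at z)"
      unfolding c_def using 2 radius_pos[OF 2(1), of "K * \<kappa>"] R_pos[OF 2(1)]
      by (intro radial_stretch_has_derivative) auto
    hence "(stretch k (Suc n) has_derivative
     (\<lambda>v. of_real c * (of_real (1 + ?a / 2) * v + of_real (?a / 2) * ((z - p) / cnj (z - p)) * cnj v))) (at z)"
    proof (rule has_derivative_transform_within_open)
      show "open (ball p (R k p) - cball p (src k p))" by (intro open_Diff) auto
      show "z \<in> ball p (R k p) - cball p (src k p)" using 2 by auto
      show "p + of_real ((dist p w / R k p) powr ?a) * (w - p) = stretch k (Suc n) w"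
        if "w \<in> ball p (R k p) - cball p (src k p)" for w
        using that stretch_disc[OF 2(1), of w n] by auto
    qed
    moreover have "(\<lambda>v. of_real c * (of_real (1 + ?a / 2) * v + of_real (?a / 2) * ((z - p) / cnj (z - p)) * cnj v))
      = (\<lambda>v. of_real (c * (1 + ?a / 2)) * v + of_real (c * (?a / 2)) * ((z - p) / cnj (z - p)) * cnj v)"
      by (simp add: fun_eq_iff algebra_simps)
    moreover have "norm (of_real (c * (?a / 2)) * ((z - p) / cnj (z - p)))
        \<le> (K - 1) / (K + 1) * norm (complex_of_real (c * (1 + ?a / 2)))"
    proof -
      have "z - p \<noteq> 0" using 2 radius_pos[OF 2(1), of "K * \<kappa>"] by auto
      hence "norm ((z - p) / cnj (z - p)) = 1" unfolding norm_divide complex_mod_cnj by simp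
      hence l: "norm (of_real (c * (?a / 2)) * ((z - p) / cnj (z - p))) = c * ((1 - 1 / K) / 2)"
        using exponent_le unfolding norm_mult norm_of_real by (simp add: abs_mult c_def)
      have r: "norm (complex_of_real (c * (1 + ?a / 2))) = c * ((1 + 1 / K) / 2)"
      proof -
        have e: "1 + ?a / 2 = (1 + 1 / K) / 2" by (simp add: field_simps)
        have "0 \<le> c * ((1 + 1 / K) / 2)" using K by (simp add: c_def)
        thus ?thesis unfolding norm_of_real e by (rule abs_of_nonneg)
      qed
      have "1 + 1 / K = (K + 1) / K" "1 - 1 / K = (K - 1) / K"
        using K by (simp_all add: add_divide_distrib diff_divide_distrib)
      hence "(K - 1) / (K + 1) * ((1 + 1 / K) / 2) = (1 - 1 / K) / 2" using K by simp
      thus ?thesis unfolding l r by (metis (no_types, lifting) mult.left_commute order_refl)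
    qed
    ultimately show ?thesis by metis
  next
    case (3 p)
    let ?s = "src k p" and ?t = "tgt k p"
    have s: "0 < ?s" "0 < ?t" using radius_pos 3(1) by blast+
    have "(z - p) / of_real ?s \<notin> critical (Suc k) n"
    proof
      assume a: "(z - p) / of_real ?s \<in> critical (Suc k) n"
      have "z = p + of_real ?s * ((z - p) / of_real ?s)" using s by simp
      with a have "z \<in> (\<lambda>z. p + of_real ?s * z) ` critical (Suc k) n" by (rule_tac image_eqI)
      thus False using Suc.prems 3(1) by auto
    qed
    then obtain a b where ab: "norm b \<le> (K - 1) / (K + 1) * norm a"
      and d: "(stretch (Suc k) n has_derivative (\<lambda>v. a * v + b * cnj v)) (at ((z - p) / of_real ?s))"
      using Suc.IH by blast
    have "((\<lambda>z. (z - p) * c) has_derivative (\<lambda>v. v * c)) (at z)" for c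
      by (auto intro!: derivative_eq_intros)
    from this[of "1 / of_real ?s"] have "((\<lambda>z. (z - p) / of_real ?s) has_derivative (\<lambda>v. v / of_real ?s)) (at z)" by simp
    from has_derivative_compose[OF this d]
    have "((\<lambda>z. p + of_real ?t * stretch (Suc k) n ((z - p) / of_real ?s)) has_derivative
      (\<lambda>v. of_real ?t * (a * (v / of_real ?s) + b * cnj (v / of_real ?s)))) (at z)"
      by (auto intro!: derivative_eq_intros)
    hence "(stretch k (Suc n) has_derivative
      (\<lambda>v. of_real ?t * (a * (v / of_real ?s) + b * cnj (v / of_real ?s)))) (at z)"
    proof (rule has_derivative_transform_within_open[OF _ open_ball])
      show "z \<in> ball p ?s" using 3 by simp
      show "p + of_real ?t * stretch (Suc k) n ((w - p) / of_real ?s) = stretch k (Suc n) w" if "w \<in> ball p ?s" for w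
        using that stretch_inside[OF 3(1), of w n] by simp
    qed
    moreover have "(\<lambda>v. of_real ?t * (a * (v / of_real ?s) + b * cnj (v / of_real ?s)))
       = (\<lambda>v. (of_real (?t / ?s) * a) * v + (of_real (?t / ?s) * b) * cnj v)"
      using s by (simp add: fun_eq_iff field_simps)
    moreover have "norm (of_real (?t / ?s) * b) \<le> (K - 1) / (K + 1) * norm (of_real (?t / ?s) * a)"
      using mult_left_mono[OF ab, of "?t / ?s"] s by (simp add: norm_mult norm_divide mult_ac)
    ultimately show ?thesis by metis
  qed
qed

section \<open>The Cauchy transform of the limit measure\<close>

text \<open>The Cauchy transform of point masses at the centres of generation \<open>n\<close>, see
  \<open>potential_eq\<close>. The recursive form exhibits the rescaling to child discs on which
  \<open>potential_step\<close> rests.\<close>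

fun potential :: "nat \<Rightarrow> nat \<Rightarrow> complex \<Rightarrow> complex" where
  "potential k 0 w = 1 / w"
| "potential k (Suc n) w = (\<Sum>p\<in>I k. of_real ((R k p)\<^sup>2 / area k) / of_real (tgt k p) *
      potential (Suc k) n ((w - p) / of_real (tgt k p)))"

lemma potential_eq: "potential k n w = (\<Sum>L\<in>words k n. of_real (mass k L) / (w - centre \<kappa> k L))"
proof (induction n arbitrary: k w)
  case (Suc n)
  show ?case unfolding sum_words_Suc potential.simps Suc sum_distrib_left
  proof (intro sum.cong refl)
    fix p L assume p: "p \<in> I k"
    have t: "0 < tgt k p" by (rule radius_pos[OF p])
    have "(w - p) / of_real (tgt k p) - centre \<kappa> (Suc k) L = (w - centre \<kappa> k (p # L)) / of_real (tgt k p)"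
      using t by (simp add: field_simps)
    thus "of_real ((R k p)\<^sup>2 / area k) / of_real (tgt k p) *
       (of_real (mass (Suc k) L) / ((w - p) / of_real (tgt k p) - centre \<kappa> (Suc k) L)) =
       of_real (mass k (p # L)) / (w - centre \<kappa> k (p # L))"
      using t by simp
  qed
qed simp

text \<open>Passing to generation \<open>n + 1\<close> moves mass only within the discs of
  generation \<open>n\<close>. In the induction a child disc sees the distance
  \<open>\<delta> / tgt k p\<close>, and the powers of \<open>tgt k p\<close> combine to a single
  factor, at most 1/3.\<close>

lemma potential_step:
  "\<delta> > 0 \<Longrightarrow> (\<And>u. u \<in> stage \<kappa> k n \<Longrightarrow> \<delta> \<le> dist w u) \<Longrightarrow>
    norm (potential k (Suc n) w - potential k n w) \<le> (1 / 3) ^ n / \<delta>\<^sup>2"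
proof (induction n arbitrary: k w \<delta>)
  case 0
  define a where "a p = (R k p)\<^sup>2 / area k" for p
  have a0: "0 \<le> a p" for p using area_pos[of k] by (simp add: a_def)
  have sa: "(\<Sum>p\<in>I k. a p) = 1"
    using area_pos[of k] by (simp add: a_def sum_divide_distrib[symmetric] area_def[symmetric])
  have w0: "\<delta> \<le> norm w" using 0(2)[of 0] by (simp add: dist_norm)
  have "potential k (Suc 0) w - potential k 0 w = (\<Sum>p\<in>I k. of_real (a p) * (1 / (w - p) - 1 / w))"
  proof -
    have "potential k (Suc 0) w = (\<Sum>p\<in>I k. of_real (a p) * (1 / (w - p)))"
      unfolding potential.simps
    proof (intro sum.cong refl)
      fix p assume "p \<in> I k"
      hence "0 < tgt k p" by (rule radius_pos)
      thus "of_real ((R k p)\<^sup>2 / area k) / of_real (tgt k p) * (1 / ((w - p) / of_real (tgt k p))) = of_real (a p) * (1 / (w - p))"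
        by (simp add: a_def)
    qed
    moreover have "(\<Sum>p\<in>I k. of_real (a p) * (1 / w)) = 1 / w"
      unfolding sum_distrib_right[symmetric] of_real_sum[symmetric] sa by simp
    ultimately show ?thesis by (simp add: right_diff_distrib sum_subtractf)
  qed
  hence "norm (potential k (Suc 0) w - potential k 0 w) \<le> (\<Sum>p\<in>I k. norm (of_real (a p) * (1 / (w - p) - 1 / w)))"
    by (simp only: norm_sum)
  also have "\<dots> \<le> (\<Sum>p\<in>I k. a p * (1 / \<delta>\<^sup>2))"
  proof (rule sum_mono)
    fix p assume p: "p \<in> I k"
    have np: "norm p \<le> 1" using norm_centre[OF p] R_less[OF p] R_pos[OF p] by linarith
    hence wp: "\<delta> \<le> norm (w - p)" using 0(2)[of p] by (simp add: dist_norm)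
    have nz: "w \<noteq> 0" "w - p \<noteq> 0" using w0 wp 0(1) by auto
    have "1 / (w - p) - 1 / w = p / ((w - p) * w)" using nz by (simp add: field_simps)
    hence "norm (1 / (w - p) - 1 / w) = norm p / (norm (w - p) * norm w)" by (simp add: norm_divide norm_mult)
    also have "\<dots> \<le> 1 / (\<delta> * \<delta>)" using np wp w0 0(1) by (intro frac_le mult_mono) auto
    finally have "norm (1 / (w - p) - 1 / w) \<le> 1 / \<delta>\<^sup>2" by (simp add: power2_eq_square)
    thus "norm (of_real (a p) * (1 / (w - p) - 1 / w)) \<le> a p * (1 / \<delta>\<^sup>2)"
      unfolding norm_mult norm_of_real abs_of_nonneg[OF a0] by (intro mult_left_mono a0)
  qed
  also have "\<dots> = (1 / 3) ^ 0 / \<delta>\<^sup>2" unfolding sum_distrib_right[symmetric] sa by simp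
  finally show ?case .
next
  case (Suc n)
  define a where "a p = (R k p)\<^sup>2 / area k" for p
  have a0: "0 \<le> a p" for p using area_pos[of k] by (simp add: a_def)
  have sa: "(\<Sum>p\<in>I k. a p) = 1"
    using area_pos[of k] by (simp add: a_def sum_divide_distrib[symmetric] area_def[symmetric])
  define v where "v p = (w - p) / of_real (tgt k p)" for p
  have "potential k (Suc (Suc n)) w - potential k (Suc n) w
     = (\<Sum>p\<in>I k. of_real (a p) / of_real (tgt k p) * (potential (Suc k) (Suc n) (v p) - potential (Suc k) n (v p)))"
    by (simp only: potential.simps(2)[of k] right_diff_distrib sum_subtractf a_def v_def)
  hence "norm (potential k (Suc (Suc n)) w - potential k (Suc n) w) \<le>
     (\<Sum>p\<in>I k. norm (of_real (a p) / of_real (tgt k p) * (potential (Suc k) (Suc n) (v p) - potential (Suc k) n (v p))))"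
    by (simp only: norm_sum)
  also have "\<dots> \<le> (\<Sum>p\<in>I k. a p * ((1 / 3) ^ Suc n / \<delta>\<^sup>2))"
  proof (rule sum_mono)
    fix p assume p: "p \<in> I k"
    have t: "0 < tgt k p" "tgt k p \<le> 1 / 3" using radius_pos[OF p] radius_le_third[OF p] by auto
    have "norm (potential (Suc k) (Suc n) (v p) - potential (Suc k) n (v p)) \<le> (1 / 3) ^ n / (\<delta> / tgt k p)\<^sup>2"
    proof (rule Suc.IH)
      show "0 < \<delta> / tgt k p" using t Suc.prems by simp
      fix u assume u: "u \<in> stage \<kappa> (Suc k) n"
      hence "p + of_real (tgt k p) * u \<in> stage \<kappa> k (Suc n)" using p by auto
      hence "\<delta> \<le> dist w (p + of_real (tgt k p) * u)" using Suc.prems(2) by blast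
      also have "w - (p + of_real (tgt k p) * u) = of_real (tgt k p) * (v p - u)"
        using t by (simp add: v_def field_simps)
      hence "dist w (p + of_real (tgt k p) * u) = tgt k p * dist (v p) u"
        using t by (simp add: dist_norm norm_mult)
      finally show "\<delta> / tgt k p \<le> dist (v p) u" using t by (simp add: pos_divide_le_eq mult.commute)
    qed
    hence "norm (of_real (a p) / of_real (tgt k p) * (potential (Suc k) (Suc n) (v p) - potential (Suc k) n (v p)))
       \<le> a p / tgt k p * ((1 / 3) ^ n / (\<delta> / tgt k p)\<^sup>2)"
      unfolding norm_mult norm_divide norm_of_real abs_of_nonneg[OF a0] abs_of_pos[OF t(1)]
      using t a0 by (intro mult_left_mono) auto
    also have "\<dots> = a p * (tgt k p * ((1 / 3) ^ n / \<delta>\<^sup>2))" using t by (simp add: power2_eq_square)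
    also have "\<dots> \<le> a p * ((1 / 3) * ((1 / 3) ^ n / \<delta>\<^sup>2))" using t by (intro mult_left_mono mult_right_mono a0) auto
    also have "\<dots> = a p * ((1 / 3) ^ Suc n / \<delta>\<^sup>2)" by simp
    finally show "norm (of_real (a p) / of_real (tgt k p) * (potential (Suc k) (Suc n) (v p) - potential (Suc k) n (v p)))
       \<le> a p * ((1 / 3) ^ Suc n / \<delta>\<^sup>2)" .
  qed
  also have "\<dots> = (1 / 3) ^ Suc n / \<delta>\<^sup>2" unfolding sum_distrib_right[symmetric] sa by simp
  finally show ?case .
qed

definition potential_lim :: "complex \<Rightarrow> complex" where
  "potential_lim w = lim (\<lambda>n. potential 0 n w)"

definition limit_set :: "real \<Rightarrow> complex set" where
  "limit_set e = (\<Inter>n. stage e 0 n)"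

lemma dist_stage_pos:
  assumes "w \<notin> stage e k n"
  shows "\<exists>\<delta>>0. \<forall>u\<in>stage e k n. \<delta> \<le> dist w u"
proof (cases "stage e k n = {}")
  case False
  show ?thesis
    using setdist_gt_0_compact_closed[of "{w}" "stage e k n"] compact_imp_closed[OF compact_stage] assms False
    by (intro exI[of _ "setdist {w} (stage e k n)"]) (auto intro: setdist_le_dist)
qed (auto intro: exI[of _ 1])

lemma potential_uniform_limit:
  assumes \<delta>: "\<delta> > 0" and S: "\<And>w u. w \<in> S \<Longrightarrow> u \<in> stage \<kappa> 0 N \<Longrightarrow> \<delta> \<le> dist w u"
  shows "uniform_limit S (potential 0) potential_lim sequentially"
proof -
  have bound: "norm (potential 0 (Suc n) w - potential 0 n w) \<le> (1 / 3) ^ n / \<delta>\<^sup>2" if "w \<in> S" "n \<ge> N" for w n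
    using that S stage_antimono[of \<kappa> N n 0] by (intro potential_step[OF \<delta>]) auto
  have "uniformly_Cauchy_on S (\<lambda>n. potential 0 n)"
  proof (rule uniformly_Cauchy_onI')
    fix e :: real assume e: "e > 0"
    have "(\<lambda>n. (1 / 3) ^ n * (3 / 2 / \<delta>\<^sup>2)) \<longlonglongrightarrow> 0 * (3 / 2 / \<delta>\<^sup>2)"
      by (intro tendsto_mult tendsto_const LIMSEQ_realpow_zero) auto
    hence "\<forall>\<^sub>F n in sequentially. (1 / 3) ^ n * (3 / 2 / \<delta>\<^sup>2) < e" using e by (intro order_tendstoD(2)) auto
    then obtain M where M: "\<And>n. n \<ge> M \<Longrightarrow> (1 / 3) ^ n * (3 / 2 / \<delta>\<^sup>2) < e" by (auto simp: eventually_sequentially)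
    have "dist (potential 0 m w) (potential 0 n w) < e" if "w \<in> S" "m \<ge> max M N" "m < n" for w m n
    proof -
      \<comment> \<open>The geometric sum in closed form, with
        \<open>3 / 2 = 1 / (1 - 1 / 3)\<close>; in this form the induction telescopes.\<close>
      have "norm (potential 0 n w - potential 0 m w) \<le> ((1 / 3) ^ m - (1 / 3) ^ n) * (3 / 2 / \<delta>\<^sup>2)"
        using less_imp_le[OF that(3)]
      proof (induction n rule: dec_induct)
        case (step n)
        have "norm (potential 0 (Suc n) w - potential 0 m w)
          \<le> norm (potential 0 (Suc n) w - potential 0 n w) + norm (potential 0 n w - potential 0 m w)"
          by (metis diff_add_cancel add_diff_eq norm_triangle_ineq diff_add_eq)
        also have "\<dots> \<le> (1 / 3) ^ n / \<delta>\<^sup>2 + ((1 / 3) ^ m - (1 / 3) ^ n) * (3 / 2 / \<delta>\<^sup>2)"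
          using step bound[OF that(1), of n] that(2) by (intro add_mono) auto
        also have "\<dots> = ((1 / 3) ^ m - (1 / 3) ^ Suc n) * (3 / 2 / \<delta>\<^sup>2)" using \<delta> by (simp add: field_simps)
        finally show ?case .
      qed simp
      also have "\<dots> \<le> (1 / 3) ^ m * (3 / 2 / \<delta>\<^sup>2)" by (intro mult_right_mono) auto
      also have "\<dots> < e" using M that by auto
      finally show ?thesis by (simp add: dist_norm norm_minus_commute)
    qed
    thus "\<exists>M. \<forall>x\<in>S. \<forall>m\<ge>M. \<forall>n>m. dist (potential 0 m x) (potential 0 n x) < e" by blast
  qed
  hence "uniformly_convergent_on S (\<lambda>n. potential 0 n)" by (rule Cauchy_uniformly_convergent)
  thus ?thesis unfolding uniformly_convergent_uniform_limit_iff potential_lim_def by simp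
qed

lemma potential_tendsto:
  assumes "w \<notin> stage \<kappa> 0 N"
  shows "(\<lambda>n. potential 0 n w) \<longlonglongrightarrow> potential_lim w"
proof -
  obtain \<delta> where "\<delta> > 0" "\<And>u. u \<in> stage \<kappa> 0 N \<Longrightarrow> \<delta> \<le> dist w u" using dist_stage_pos[OF assms] by blast
  hence "uniform_limit {w} (potential 0) potential_lim sequentially"
    by (intro potential_uniform_limit[of \<delta> _ N]) auto
  thus ?thesis by (rule tendsto_uniform_limitI) simp
qed

lemma potential_lim_holomorphic: "potential_lim holomorphic_on - stage \<kappa> 0 N"
proof (rule holomorphic_uniform_sequence)
  show "open (- stage \<kappa> 0 N)" using compact_imp_closed[OF compact_stage] by auto
  \<comment> \<open>From index \<open>N\<close> on, all poles lie in stage \<open>N\<close>.\<close>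
  define f where "f n = potential 0 (n + N)" for n
  have fn: "f n holomorphic_on - stage \<kappa> 0 N" for n
    unfolding f_def potential_eq[abs_def]
  proof (intro holomorphic_intros)
    fix L w assume "L \<in> words 0 (n + N)" "w \<in> - stage \<kappa> 0 N"
    thus "w - centre \<kappa> 0 L \<noteq> 0"
      using centre_in_stage[of L 0 "n + N" \<kappa>] stage_antimono[of \<kappa> N "n + N" 0] by auto
  qed
  show "f n holomorphic_on - stage \<kappa> 0 N" for n by (rule fn)
  fix w assume w: "w \<in> - stage \<kappa> 0 N"
  obtain \<delta> where \<delta>: "\<delta> > 0" "\<And>u. u \<in> stage \<kappa> 0 N \<Longrightarrow> \<delta> \<le> dist w u" using dist_stage_pos[of w] w by blast
  have near: "\<delta> / 2 \<le> dist v u" if "v \<in> cball w (\<delta> / 2)" "u \<in> stage \<kappa> 0 N" for v u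
    using that \<delta>(2)[of u] dist_triangle[of w u v] by simp
  have "uniform_limit (cball w (\<delta> / 2)) (potential 0) potential_lim sequentially"
    by (rule potential_uniform_limit[of "\<delta> / 2" _ N]) (use \<delta>(1) near in auto)
  hence "uniform_limit (cball w (\<delta> / 2)) f potential_lim sequentially"
    unfolding f_def by (rule filterlim_compose) (rule filterlim_add_const_nat_at_top)
  moreover have "cball w (\<delta> / 2) \<subseteq> - stage \<kappa> 0 N"
  proof
    fix v assume "v \<in> cball w (\<delta> / 2)"
    thus "v \<in> - stage \<kappa> 0 N" using near[of v v] \<delta>(1) by auto
  qed
  ultimately show "\<exists>d>0. cball w d \<subseteq> - stage \<kappa> 0 N \<and> uniform_limit (cball w d) f potential_lim sequentially"
    using \<delta>(1) by (intro exI[of _ "\<delta> / 2"]) auto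
qed

text \<open>The finite potentials satisfy the bound with one constant for all large
  \<open>n\<close>. For radii \<open>s \<ge> \<delta>\<close> the growth condition is
  \<open>mass_growth\<close>, as the discs of generation \<open>n\<close> are smaller than
  \<open>s\<close>; smaller balls about \<open>u\<close> and \<open>v\<close> contain no centre at
  all.\<close>

lemma potential_lim_Hoelder:
  assumes \<kappa>1: "\<kappa> < 1"
  obtains M where "\<And>u v. u \<notin> limit_set \<kappa> \<Longrightarrow> v \<notin> limit_set \<kappa> \<Longrightarrow>
    norm (potential_lim u - potential_lim v) \<le> M * norm (u - v) powr (2 / (1 + \<kappa>) - 1)"
proof -
  define \<beta> where "\<beta> = 2 / (1 + \<kappa>) - 1"
  have \<beta>: "0 < \<beta>" "\<beta> < 1" using \<kappa> \<kappa>1 by (auto simp: \<beta>_def field_simps)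
  define C where "C = 9 * exp ((1 / 2) ^ 0 :: real)"
  define M where "M = 10 * C / (1 - 2 powr - \<beta>) + 8 * C / (1 - 2 powr (\<beta> - 1))"
  have "norm (potential_lim u - potential_lim v) \<le> M * norm (u - v) powr \<beta>"
    if u: "u \<notin> limit_set \<kappa>" and v: "v \<notin> limit_set \<kappa>" for u v
  proof -
    obtain N1 N2 where N12: "u \<notin> stage \<kappa> 0 N1" "v \<notin> stage \<kappa> 0 N2" using u v by (auto simp: limit_set_def)
    define N where "N = max N1 N2"
    have N: "u \<notin> stage \<kappa> 0 N" "v \<notin> stage \<kappa> 0 N"
      using N12 stage_antimono[of \<kappa> N1 N 0] stage_antimono[of \<kappa> N2 N 0] by (auto simp: N_def)
    obtain \<delta>1 \<delta>2 where \<delta>12: "\<delta>1 > 0" "\<And>x. x \<in> stage \<kappa> 0 N \<Longrightarrow> \<delta>1 \<le> dist u x"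
      "\<delta>2 > 0" "\<And>x. x \<in> stage \<kappa> 0 N \<Longrightarrow> \<delta>2 \<le> dist v x"
      using dist_stage_pos[OF N(1)] dist_stage_pos[OF N(2)] by blast
    define \<delta> where "\<delta> = min \<delta>1 \<delta>2"
    have \<delta>: "\<delta> > 0" "\<And>x y. y \<in> {u, v} \<Longrightarrow> x \<in> stage \<kappa> 0 N \<Longrightarrow> \<delta> \<le> dist y x"
      using \<delta>12 by (auto simp: \<delta>_def min.coboundedI1 min.coboundedI2)
    obtain n0 where n0: "(1 / 3 :: real) ^ n0 < \<delta>" using real_arch_pow_inv[OF \<delta>(1), of "1 / 3"] by auto
    have "norm (potential 0 n u - potential 0 n v) \<le> M * norm (u - v) powr \<beta>" if n: "n \<ge> max n0 N" for n
      unfolding potential_eq M_def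
    proof (rule discrete_Cauchy_transform_Hoelder[OF finite_words mass_nonneg \<beta>])
      show "0 \<le> C" by (simp add: C_def)
      have cs: "centre \<kappa> 0 L \<in> stage \<kappa> 0 N" if "L \<in> words 0 n" for L
        using centre_in_stage[OF that, of \<kappa>] stage_antimono[of \<kappa> N n 0] n by auto
      fix x s assume x: "x \<in> {u, v}" and s: "(s::real) > 0"
      show "(\<Sum>L | L \<in> words 0 n \<and> dist x (centre \<kappa> 0 L) < s. mass 0 L) \<le> C * s powr (1 + \<beta>)"
      proof (cases "\<delta> \<le> s")
        case True
        have le: "scale \<kappa> 0 L \<le> s" if "L \<in> words 0 n" for L
        proof -
          have "scale \<kappa> 0 L \<le> (1 / 3) ^ n" by (rule scale_le[OF that]) simp
          also have "\<dots> \<le> (1 / 3) ^ n0" using n by (intro power_decreasing) auto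
          finally show ?thesis using n0 True by linarith
        qed
        have "(\<Sum>L | L \<in> words 0 n \<and> dist x (centre \<kappa> 0 L) < s. mass 0 L)
          = (\<Sum>L\<in>words 0 n. if dist x (centre \<kappa> 0 L) < s then mass 0 L else 0)"
          by (rule sum.inter_filter) simp
        also have "\<dots> \<le> (\<Sum>L\<in>words 0 n. if dist x (centre \<kappa> 0 L) < s + scale \<kappa> 0 L then mass 0 L else 0)"
          using scale_pos[of _ 0 n \<kappa>] by (intro sum_mono) (auto simp: mass_nonneg, smt (verit))
        also have "\<dots> \<le> 9 * exp ((1 / 2) ^ 0) * s powr (2 / (1 + \<kappa>))"
          by (rule mass_growth[OF order_refl s le])
        finally show ?thesis by (simp add: C_def \<beta>_def)
      next
        case False
        have "{L. L \<in> words 0 n \<and> dist x (centre \<kappa> 0 L) < s} = {}"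
          using \<delta>(2)[OF x cs] False by fastforce
        thus ?thesis by (simp only: sum.empty) (simp add: C_def)
      qed
    next
      fix L assume L: "L \<in> words 0 n"
      have "centre \<kappa> 0 L \<in> stage \<kappa> 0 N"
        using centre_in_stage[OF L, of \<kappa>] stage_antimono[of \<kappa> N n 0] n by auto
      thus "centre \<kappa> 0 L \<noteq> u \<and> centre \<kappa> 0 L \<noteq> v" using N by metis
    qed
    hence "\<forall>\<^sub>F n in sequentially. norm (potential 0 n u - potential 0 n v) \<le> M * norm (u - v) powr \<beta>"
      unfolding eventually_sequentially by blast
    thus ?thesis
      by (intro tendsto_upperbound[OF tendsto_norm[OF tendsto_diff[OF potential_tendsto[OF N(1)] potential_tendsto[OF N(2)]]]]) auto
  qed
  thus thesis using that[of M] unfolding \<beta>_def by blast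
qed

section \<open>Hausdorff measure of the limit set\<close>

lemma stage_intersect_empty:
  assumes e: "\<kappa> \<le> e" and C: "compact C" "C \<inter> limit_set e = {}"
  shows "\<exists>n. C \<inter> stage e 0 n = {}"
proof (rule ccontr)
  assume "\<not> ?thesis"
  hence "(\<Inter>n. C \<inter> stage e 0 n) \<noteq> {}"
  proof (intro compact_nest)
    show "C \<inter> stage e 0 n \<subseteq> C \<inter> stage e 0 m" if "m \<le> n" for m n
      using stage_antimono[OF e that] by blast
  qed (use C(1) compact_stage in \<open>auto intro: compact_Int\<close>)
  thus False using C(2) by (auto simp: limit_set_def)
qed

lemma compact_limit_set: "compact (limit_set e)"
proof -
  have "limit_set e = stage e 0 0 \<inter> (\<Inter>n. stage e 0 n)" unfolding limit_set_def by blast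
  moreover have "closed (\<Inter>n. stage e 0 n)" by (intro closed_INT ballI compact_imp_closed compact_stage)
  ultimately show ?thesis using compact_Int_closed[OF compact_stage] by metis
qed

lemma stage_subset_open:
  assumes e: "\<kappa> \<le> e" and V: "open V" "limit_set e \<subseteq> V"
  shows "\<exists>n. stage e 0 n \<subseteq> V"
proof -
  have "compact (cball 0 1 - V)" using V(1) by (intro compact_diff) auto
  then obtain n where "(cball 0 1 - V) \<inter> stage e 0 n = {}" using stage_intersect_empty[OF e] V(2) by blast
  moreover have "stage e 0 n \<subseteq> cball 0 1" using stage_antimono[OF e, of 0 n 0] by simp
  ultimately show ?thesis by blast
qed

lemma hausdorff_measure_limit_set_le:
  assumes e: "\<kappa> \<le> e"
  shows "hausdorff_measure (2 / (1 + e)) (limit_set e) \<le> ennreal (2 powr (2 / (1 + e)))"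
  unfolding hausdorff_measure_def
proof (rule SUP_least)
  define D where "D = 2 / (1 + e)"
  have e0: "0 < e" using e \<kappa> by linarith
  fix \<delta> :: real assume "\<delta> \<in> {0<..}"
  hence \<delta>: "0 < \<delta>" by simp
  obtain n where n: "(1 / 3 :: real) ^ n < \<delta> / 2" using real_arch_pow_inv[of "\<delta> / 2" "1 / 3"] \<delta> by auto
  obtain h where h: "bij_betw h {0..<card (words 0 n)} (words 0 n)"
    using ex_bij_betw_nat_finite[OF finite_words] by blast
  define B where "B L = cball (centre e 0 L) (scale e 0 L)" for L
  \<comment> \<open>The finite cover is padded with empty sets, which contribute
    \<open>0 powr D = 0\<close>.\<close>
  define U where "U i = (if i < card (words 0 n) then B (h i) else {})" for i
  have hW: "h i \<in> words 0 n" if "i < card (words 0 n)" for i using h that by (auto simp: bij_betw_def)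
  have dB: "diameter (B L) = 2 * scale e 0 L" if "L \<in> words 0 n" for L
    using scale_pos[OF that, of e] by (simp add: B_def)
  have "limit_set e \<subseteq> stage e 0 n" by (auto simp: limit_set_def)
  also have "\<dots> \<subseteq> (\<Union>i. U i)"
  proof
    fix z assume "z \<in> stage e 0 n"
    then obtain L where L: "L \<in> words 0 n" "z \<in> B L" by (auto simp: stage_eq_cballs B_def)
    then obtain i where "i < card (words 0 n)" "h i = L" using h by (force simp: bij_betw_def image_iff)
    thus "z \<in> (\<Union>i. U i)" using L by (auto simp: U_def intro!: exI[of _ i])
  qed
  finally have "U \<in> {U. limit_set e \<subseteq> (\<Union>i. U i) \<and> (\<forall>i. bounded (U i) \<and> diameter (U i) \<le> \<delta>)}"
    using n scale_le[OF hW e] dB[OF hW] \<delta> by (auto simp: U_def B_def) (smt (verit))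
  hence "hausdorff_premeasure D \<delta> (limit_set e) \<le> (\<Sum>i. ennreal (diameter (U i) powr D))"
    unfolding hausdorff_premeasure_def by (rule INF_lower)
  also have "\<dots> = (\<Sum>i\<in>{0..<card (words 0 n)}. ennreal (diameter (U i) powr D))"
    by (rule suminf_finite) (auto simp: U_def)
  also have "\<dots> = (\<Sum>i\<in>{0..<card (words 0 n)}. ennreal (diameter (B (h i)) powr D))"
    by (intro sum.cong) (auto simp: U_def)
  also have "\<dots> = (\<Sum>L\<in>words 0 n. ennreal (diameter (B L) powr D))"
    by (rule sum.reindex_bij_betw[OF h])
  also have "\<dots> = (\<Sum>L\<in>words 0 n. ennreal (2 powr D * scale e 0 L powr D))"
    using scale_pos[of _ 0 n e] by (intro sum.cong refl) (simp add: dB powr_mult less_imp_le)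
  also have "\<dots> = ennreal (2 powr D * (\<Sum>L\<in>words 0 n. scale e 0 L powr D))"
    by (simp add: sum_distrib_left)
  also have "\<dots> \<le> ennreal (2 powr D)"
    using sum_scale_powr_le[OF e0, of 0 n] by (intro ennreal_leI) (simp add: D_def mult_left_le)
  finally show "hausdorff_premeasure (2 / (1 + e)) \<delta> (limit_set e) \<le> ennreal (2 powr (2 / (1 + e)))"
    by (simp add: D_def)
qed

text \<open>Mass distribution principle, with compactness replacing the construction of a limit measure.\<close>

lemma hausdorff_measure_limit_set_pos:
  assumes e: "\<kappa> \<le> e"
  shows "0 < hausdorff_measure (2 / (1 + e)) (limit_set e)"
proof -
  define D where "D = 2 / (1 + e)"
  have e0: "0 < e" using e \<kappa> by linarith
  have D: "0 < D" using e0 by (simp add: D_def)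
  define C where "C = 9 * exp ((1 / 2) ^ 0 :: real) * 2 powr D"
  have C: "0 < C" by (simp add: C_def)
  define c where "c = 1 / (2 * C)"
  have "ennreal c \<le> hausdorff_premeasure D 1 (limit_set e)"
    unfolding hausdorff_premeasure_def
  proof (rule INF_greatest)
    fix U :: "nat \<Rightarrow> complex set"
    assume "U \<in> {U. limit_set e \<subseteq> (\<Union>i. U i) \<and> (\<forall>i. bounded (U i) \<and> diameter (U i) \<le> 1)}"
    hence U: "limit_set e \<subseteq> (\<Union>i. U i)" "\<And>i. bounded (U i)" by auto
    show "ennreal c \<le> (\<Sum>i. ennreal (diameter (U i) powr D))"
    proof (rule ccontr)
      assume "\<not> ?thesis"
      hence S: "(\<Sum>i. ennreal (diameter (U i) powr D)) \<le> ennreal c" by simp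
      \<comment> \<open>Positive enlargements turn the cover into one by open balls. Their powers
        sum to at most \<open>1 / (4 * C)\<close>; together with \<open>c = 1 / (2 * C)\<close> this
        bounds the total mass by \<open>1/2 + 1/4 < 1\<close>.\<close>
      define b where "b i = ((1 / 2) ^ Suc i / (4 * C)) powr (1 / D)" for i :: nat
      have b: "0 < b i" "b i powr D = (1 / 2) ^ Suc i / (4 * C)" for i
        using C D by (auto simp: b_def powr_powr)
      define r where "r i = diameter (U i) + b i" for i
      have d0: "0 \<le> diameter (U i)" for i by (rule diameter_ge_0[OF U(2)])
      have r: "0 < r i" for i using d0[of i] b(1)[of i] by (simp add: r_def)
      have rD: "r i powr D \<le> 2 powr D * (diameter (U i) powr D + b i powr D)" for i
      proof -
        have "r i powr D \<le> (2 * max (diameter (U i)) (b i)) powr D"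
          using r[of i] D by (intro powr_mono2) (auto simp: r_def)
        also have "\<dots> = 2 powr D * max (diameter (U i)) (b i) powr D" by (simp add: powr_mult)
        also have "max (diameter (U i)) (b i) powr D \<le> diameter (U i) powr D + b i powr D" by (simp add: max_def)
        finally show ?thesis by simp
      qed
      define x where "x i = (SOME x. x \<in> U i)" for i
      have cover: "U i \<subseteq> ball (x i) (r i)" for i
      proof
        fix y assume y: "y \<in> U i"
        hence "x i \<in> U i" unfolding x_def by (rule someI)
        hence "dist (x i) y \<le> diameter (U i)" using y U(2) by (intro diameter_bounded_bound) auto
        thus "y \<in> ball (x i) (r i)" using b(1)[of i] by (simp add: r_def)
      qed
      have "limit_set e \<subseteq> (\<Union>i. ball (x i) (r i))" using U(1) cover by blast
      then obtain F where F: "finite F" "limit_set e \<subseteq> (\<Union>i\<in>F. ball (x i) (r i))"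
        using compactE_image[OF compact_limit_set, of UNIV "\<lambda>i. ball (x i) (r i)" e] by auto
      obtain n1 where n1: "stage e 0 n1 \<subseteq> (\<Union>i\<in>F. ball (x i) (r i))"
        using stage_subset_open[OF e _ F(2)] by auto
      obtain \<rho> where \<rho>: "\<rho> > 0" "\<And>i. i \<in> F \<Longrightarrow> \<rho> \<le> r i"
      proof (cases "F = {}")
        case False
        thus ?thesis using F(1) r by (intro that[of "Min (r ` F)"]) auto
      qed (use that[of 1] in auto)
      \<comment> \<open>From this generation on the discs are smaller than all balls of the finite
        subcover, as \<open>mass_growth\<close> demands.\<close>
      obtain n2 where n2: "(1 / 3 :: real) ^ n2 < \<rho>" using real_arch_pow_inv[OF \<rho>(1), of "1 / 3"] by auto
      define n where "n = max n1 n2"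
      have sub: "stage e 0 n \<subseteq> (\<Union>i\<in>F. ball (x i) (r i))"
        using n1 stage_antimono[OF e, of n1 n 0] by (auto simp: n_def)
      have small: "scale e 0 L \<le> r i" if "L \<in> words 0 n" "i \<in> F" for L i
      proof -
        have "scale e 0 L \<le> (1 / 3) ^ n" by (rule scale_le[OF that(1) e])
        also have "\<dots> \<le> (1 / 3) ^ n2" by (intro power_decreasing) (auto simp: n_def)
        finally show ?thesis using n2 \<rho>(2)[OF that(2)] by linarith
      qed
      define hit where "hit i L = (if dist (x i) (centre e 0 L) < r i + scale e 0 L then mass 0 L else 0)" for i L
      have hit0: "0 \<le> hit i L" for i L by (simp add: hit_def mass_nonneg)
      have "1 = (\<Sum>L\<in>words 0 n. mass 0 L)" by (simp add: sum_mass)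
      also have "\<dots> \<le> (\<Sum>L\<in>words 0 n. \<Sum>i\<in>F. hit i L)"
      proof (rule sum_mono)
        fix L assume L: "L \<in> words 0 n"
        then obtain i where i: "i \<in> F" "dist (x i) (centre e 0 L) < r i"
          using centre_in_stage[OF L, of e] sub by auto
        hence "mass 0 L = hit i L" using scale_pos[OF L, of e] by (simp add: hit_def)
        also have "\<dots> \<le> (\<Sum>i\<in>F. hit i L)" using F(1) i(1) hit0 by (intro member_le_sum) auto
        finally show "mass 0 L \<le> (\<Sum>i\<in>F. hit i L)" .
      qed
      also have "\<dots> = (\<Sum>i\<in>F. \<Sum>L\<in>words 0 n. hit i L)" by (rule sum.swap)
      also have "\<dots> \<le> (\<Sum>i\<in>F. 9 * exp ((1 / 2) ^ 0) * r i powr D)"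
        unfolding hit_def D_def by (intro sum_mono mass_growth e r small)
      also have "\<dots> \<le> (\<Sum>i\<in>F. C * (diameter (U i) powr D + b i powr D))"
      proof (rule sum_mono)
        fix i
        have "9 * exp ((1 / 2) ^ 0) * r i powr D \<le> 9 * exp ((1 / 2) ^ 0) * (2 powr D * (diameter (U i) powr D + b i powr D))"
          by (intro mult_left_mono rD) auto
        thus "9 * exp ((1 / 2) ^ 0) * r i powr D \<le> C * (diameter (U i) powr D + b i powr D)"
          by (simp add: C_def mult.assoc)
      qed
      also have "\<dots> = C * (\<Sum>i\<in>F. diameter (U i) powr D) + C * (\<Sum>i\<in>F. b i powr D)"
        by (simp add: sum_distrib_left[symmetric] sum.distrib distrib_left)
      also have "\<dots> \<le> C * c + C * (1 / (4 * C))"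
      proof (intro add_mono mult_left_mono)
        have "ennreal (\<Sum>i\<in>F. diameter (U i) powr D) = (\<Sum>i\<in>F. ennreal (diameter (U i) powr D))" by simp
        also have "\<dots> \<le> (\<Sum>i. ennreal (diameter (U i) powr D))" using F(1) by (intro sum_le_suminf) auto
        also note S
        finally show "(\<Sum>i\<in>F. diameter (U i) powr D) \<le> c" using C by (simp add: c_def ennreal_le_iff)
        have "(\<Sum>i\<in>F. b i powr D) = (\<Sum>i\<in>F. (1 / 2) ^ Suc i) / (4 * C)" by (simp only: b(2) sum_divide_distrib)
        also have "(\<Sum>i\<in>F. (1 / 2 :: real) ^ Suc i) \<le> (\<Sum>i. (1 / 2) ^ Suc i)"
          using F(1) power_half_series by (intro sum_le_suminf) (auto simp: sums_iff)
        also have "\<dots> = 1" using power_half_series by (simp add: sums_iff)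
        finally show "(\<Sum>i\<in>F. b i powr D) \<le> 1 / (4 * C)" using C by (simp add: divide_right_mono)
      qed (use C in auto)
      also have "\<dots> < 1" using C by (simp add: c_def)
      finally show False by simp
    qed
  qed
  also have "\<dots> \<le> hausdorff_measure D (limit_set e)"
    unfolding hausdorff_measure_def by (rule SUP_upper) simp
  finally show ?thesis using C by (simp add: D_def c_def less_le_trans[rotated])
qed

lemma sum_scale_square_le: "\<kappa> \<le> e \<Longrightarrow> (\<Sum>L\<in>words k n. (scale e k L)\<^sup>2) \<le> (1 / 9) ^ n"
proof (induction n arbitrary: k)
  case (Suc n)
  have "(\<Sum>L\<in>words k (Suc n). (scale e k L)\<^sup>2) = (\<Sum>p\<in>I k. (radius e k p)\<^sup>2 * (\<Sum>L\<in>words (Suc k) n. (scale e (Suc k) L)\<^sup>2))"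
    unfolding sum_words_Suc by (simp add: power_mult_distrib sum_distrib_left)
  also have "\<dots> \<le> (\<Sum>p\<in>I k. (R k p)\<^sup>2 / 9 * (1 / 9) ^ n)"
  proof (intro sum_mono mult_mono Suc)
    fix p assume p: "p \<in> I k"
    have "(radius e k p)\<^sup>2 \<le> (R k p / 3)\<^sup>2"
      using radius_le[OF p Suc.prems] radius_pos[OF p, of e] by (intro power_mono) auto
    thus "(radius e k p)\<^sup>2 \<le> (R k p)\<^sup>2 / 9" by (simp add: power_divide)
  qed (auto intro: sum_nonneg)
  also have "\<dots> = area k * (1 / 9) ^ Suc n" by (simp add: area_def sum_distrib_right)
  also have "\<dots> \<le> (1 / 9) ^ Suc n" using area_le_1[of k] area_pos[of k] by (intro mult_left_le_one_le) auto
  finally show ?case .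
qed simp

lemma negligible_limit_set: "\<kappa> \<le> e \<Longrightarrow> negligible (limit_set e)"
proof -
  assume e: "\<kappa> \<le> e"
  have m: "measure lebesgue (limit_set e) \<le> pi * (1 / 9) ^ n" for n
  proof -
    have "measure lebesgue (limit_set e) \<le> measure lebesgue (stage e 0 n)"
      using compact_limit_set[of e] compact_stage[of e 0 n]
      by (intro measure_mono_fmeasurable) (auto simp: limit_set_def lmeasurable_compact fmeasurableD)
    also have "\<dots> \<le> (\<Sum>L\<in>words 0 n. measure lebesgue (cball (centre e 0 L) (scale e 0 L)))"
      unfolding stage_eq_cballs by (intro measure_UNION_le) auto
    also have "\<dots> = (\<Sum>L\<in>words 0 n. pi * (scale e 0 L)\<^sup>2)"
      using scale_pos[of _ 0 n e] content_cball[of "scale e 0 _" "centre e 0 _"]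
      by (intro sum.cong refl) (simp add: unit_ball_vol_2 less_imp_le)
    also have "\<dots> \<le> pi * (1 / 9) ^ n"
      unfolding sum_distrib_left[symmetric] using sum_scale_square_le[OF e, of 0 n] by (intro mult_left_mono) auto
    finally show ?thesis .
  qed
  have "(\<lambda>n. pi * (1 / 9) ^ n) \<longlonglongrightarrow> pi * 0"
    by (intro tendsto_mult tendsto_const LIMSEQ_realpow_zero) auto
  hence "measure lebesgue (limit_set e) \<le> pi * 0" by (rule LIMSEQ_le_const) (use m in blast)
  hence "measure lebesgue (limit_set e) \<le> 0" by simp
  moreover have "limit_set e \<in> lmeasurable" by (rule lmeasurable_compact[OF compact_limit_set])
  ultimately show ?thesis by (simp add: negligible_iff_measure measure_le_0_iff)
qed

section \<open>The quasiregular function\<close>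

abbreviation "E \<equiv> limit_set (K * \<kappa>)"

text \<open>By \<open>stretch_stable\<close> the maps \<open>stretch 0 n\<close> agree at
  \<open>z\<close> once \<open>z\<close> has left stage \<open>n\<close>, so the least such
  \<open>n\<close> already gives the value of the limit map off \<open>E\<close>. On
  \<open>E\<close> the value is unspecified.\<close>

definition prefun :: "complex \<Rightarrow> complex" where
  "prefun z = potential_lim (stretch 0 (LEAST n. z \<notin> stage (K * \<kappa>) 0 n) z)"

lemma prefun_eq:
  assumes "z \<notin> stage (K * \<kappa>) 0 n"
  shows "prefun z = potential_lim (stretch 0 n z)"
proof -
  define m where "m = (LEAST n. z \<notin> stage (K * \<kappa>) 0 n)"
  have "z \<notin> stage (K * \<kappa>) 0 m" unfolding m_def using assms by (rule LeastI)
  moreover have "m \<le> n" unfolding m_def using assms by (rule Least_le)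
  ultimately show ?thesis using stretch_stable[of z 0 m n] by (simp add: prefun_def m_def)
qed

lemma not_in_E:
  assumes "z \<notin> E" "w \<notin> E"
  obtains n where "z \<notin> stage (K * \<kappa>) 0 n" "w \<notin> stage (K * \<kappa>) 0 n"
proof -
  obtain n1 n2 where "z \<notin> stage (K * \<kappa>) 0 n1" "w \<notin> stage (K * \<kappa>) 0 n2" using assms by (auto simp: limit_set_def)
  thus thesis using stage_antimono[OF K\<kappa>(1), of n1 "max n1 n2" 0] stage_antimono[OF K\<kappa>(1), of n2 "max n1 n2" 0]
    by (intro that[of "max n1 n2"]) auto
qed

lemma stretch_notin_limit_set: "z \<notin> stage (K * \<kappa>) 0 n \<Longrightarrow> stretch 0 n z \<notin> limit_set \<kappa>"
  using stretch_avoids_stage[of z 0 n] unfolding limit_set_def by blast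

lemma prefun_Hoelder:
  assumes \<kappa>1: "\<kappa> < 1"
  obtains M where "M \<ge> 0" "\<And>z w. z \<notin> E \<Longrightarrow> w \<notin> E \<Longrightarrow> dist z w \<le> 2 \<Longrightarrow>
    dist (prefun z) (prefun w) \<le> M * dist z w powr ((1 - \<kappa>) / (1 + K * \<kappa>))"
proof -
  define \<beta> \<gamma> where "\<beta> = 2 / (1 + \<kappa>) - 1" and "\<gamma> = (1 + \<kappa>) / (1 + K * \<kappa>)"
  have \<beta>: "0 < \<beta>" using \<kappa> \<kappa>1 by (simp add: \<beta>_def field_simps)
  have cancel: "c * (d / c) = d" if "c > 0" for c d :: real using that by simp
  have "(1 + \<kappa>) * (2 / (1 + \<kappa>)) = 2" by (rule cancel) (use \<kappa> in simp)
  hence "(1 + \<kappa>) * \<beta> = 1 - \<kappa>" unfolding \<beta>_def right_diff_distrib by simp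
  hence \<gamma>\<beta>: "\<gamma> * \<beta> = (1 - \<kappa>) / (1 + K * \<kappa>)" by (simp add: \<gamma>_def)
  obtain M where M: "\<And>u v. u \<notin> limit_set \<kappa> \<Longrightarrow> v \<notin> limit_set \<kappa> \<Longrightarrow>
    norm (potential_lim u - potential_lim v) \<le> M * norm (u - v) powr \<beta>"
    using potential_lim_Hoelder[OF \<kappa>1] unfolding \<beta>_def by blast
  have "dist (prefun z) (prefun w) \<le> \<bar>M\<bar> * 6 powr \<beta> * dist z w powr ((1 - \<kappa>) / (1 + K * \<kappa>))"
    if zw: "z \<notin> E" "w \<notin> E" "dist z w \<le> 2" for z w
  proof -
    obtain n where n: "z \<notin> stage (K * \<kappa>) 0 n" "w \<notin> stage (K * \<kappa>) 0 n" using not_in_E[OF zw(1,2)] .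
    have "dist (prefun z) (prefun w) \<le> M * dist (stretch 0 n z) (stretch 0 n w) powr \<beta>"
      unfolding prefun_eq[OF n(1)] prefun_eq[OF n(2)] dist_norm
      by (intro M stretch_notin_limit_set n)
    also have "\<dots> \<le> \<bar>M\<bar> * dist (stretch 0 n z) (stretch 0 n w) powr \<beta>" by (intro mult_right_mono) auto
    also have "\<dots> \<le> \<bar>M\<bar> * (6 * dist z w powr \<gamma>) powr \<beta>"
      unfolding \<gamma>_def using \<beta> by (intro mult_left_mono powr_mono2 stretch_Hoelder zw) auto
    also have "\<dots> = \<bar>M\<bar> * 6 powr \<beta> * dist z w powr (\<gamma> * \<beta>)" by (simp add: powr_mult powr_powr)
    finally show ?thesis unfolding \<gamma>\<beta> .
  qed
  thus thesis using that[of "\<bar>M\<bar> * 6 powr \<beta>"] by simp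
qed

lemma closure_compl_E: "closure (- E) = UNIV"
proof -
  have "interior E = {}"
    using negligible_limit_set[OF K\<kappa>(1)] open_interior interior_subset negligible_subset
      open_not_negligible by metis
  thus ?thesis by (simp add: closure_complement)
qed

lemma potential_lim_local_Lipschitz:
  assumes \<delta>: "\<delta> > 0" and u: "\<And>c. c \<in> stage \<kappa> 0 N \<Longrightarrow> \<delta> \<le> dist u c" and v: "\<And>c. c \<in> stage \<kappa> 0 N \<Longrightarrow> \<delta> \<le> dist v c"
  shows "dist (potential_lim u) (potential_lim v) \<le> dist u v / \<delta>\<^sup>2"
proof -
  have N: "u \<notin> stage \<kappa> 0 N" "v \<notin> stage \<kappa> 0 N" using u[of u] v[of v] \<delta> by auto
  have "norm (potential 0 n u - potential 0 n v) \<le> dist u v / \<delta>\<^sup>2" if n: "n \<ge> N" for n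
  proof -
    have "norm (potential 0 n u - potential 0 n v)
      \<le> (\<Sum>L\<in>words 0 n. norm (of_real (mass 0 L) / (u - centre \<kappa> 0 L) - of_real (mass 0 L) / (v - centre \<kappa> 0 L)))"
      unfolding potential_eq sum_subtractf[symmetric] by (rule norm_sum)
    also have "\<dots> \<le> (\<Sum>L\<in>words 0 n. mass 0 L * (dist u v / \<delta>\<^sup>2))"
    proof (rule sum_mono)
      fix L assume L: "L \<in> words 0 n"
      define c where "c = centre \<kappa> 0 L"
      have "c \<in> stage \<kappa> 0 N" using centre_in_stage[OF L, of \<kappa>] stage_antimono[of \<kappa> N n 0] n by (auto simp: c_def)
      hence d: "\<delta> \<le> norm (u - c)" "\<delta> \<le> norm (v - c)" using u v by (auto simp: dist_norm)
      have nz: "u - c \<noteq> 0" "v - c \<noteq> 0" using d \<delta> by auto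
      have "of_real (mass 0 L) / (u - c) - of_real (mass 0 L) / (v - c) = of_real (mass 0 L) * ((v - u) / ((u - c) * (v - c)))"
        using nz by (simp add: field_simps)
      hence "norm (of_real (mass 0 L) / (u - c) - of_real (mass 0 L) / (v - c))
         = mass 0 L * (dist u v / (norm (u - c) * norm (v - c)))"
        using mass_nonneg[of 0 L] by (simp add: norm_mult norm_divide dist_norm norm_minus_commute)
      also have "\<dots> \<le> mass 0 L * (dist u v / (\<delta> * \<delta>))"
        using d \<delta> mass_nonneg by (intro mult_left_mono frac_le mult_mono) auto
      finally show "norm (of_real (mass 0 L) / (u - centre \<kappa> 0 L) - of_real (mass 0 L) / (v - centre \<kappa> 0 L)) \<le> mass 0 L * (dist u v / \<delta>\<^sup>2)"
        by (simp add: c_def power2_eq_square)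
    qed
    also have "\<dots> = dist u v / \<delta>\<^sup>2" unfolding sum_distrib_right[symmetric] sum_mass by simp
    finally show ?thesis .
  qed
  hence "\<forall>\<^sub>F n in sequentially. norm (potential 0 n u - potential 0 n v) \<le> dist u v / \<delta>\<^sup>2"
    unfolding eventually_sequentially by blast
  thus ?thesis unfolding dist_norm[of "potential_lim u"]
    by (intro tendsto_upperbound[OF tendsto_norm[OF tendsto_diff[OF potential_tendsto[OF N(1)] potential_tendsto[OF N(2)]]]]) auto
qed

text \<open>The clause \<open>w \<notin> E\<close> lets the extension \<open>f\<close> be exchanged
  for \<open>prefun\<close> at all points near \<open>L\<close>.\<close>

lemma prefun_locally_Lipschitz:
  assumes L: "compact L" "L \<subseteq> - E"
  shows "\<exists>\<epsilon>>0. \<exists>C. \<forall>z\<in>L. \<forall>w. dist z w < \<epsilon> \<longrightarrow> w \<notin> E \<and> norm (prefun w - prefun z) \<le> C * dist z w"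
proof -
  obtain n where n: "L \<inter> stage (K * \<kappa>) 0 n = {}" using stage_intersect_empty[OF K\<kappa>(1) L(1)] L(2) by blast
  obtain e where e: "e > 0" "\<And>z y. z \<in> L \<Longrightarrow> y \<in> stage (K * \<kappa>) 0 n \<Longrightarrow> e \<le> dist z y"
    using separate_compact_closed[OF L(1) compact_imp_closed[OF compact_stage] n] by blast
  obtain M where M: "M \<ge> 0" "\<And>z w. dist (stretch 0 n z) (stretch 0 n w) \<le> M * dist z w"
    using stretch_Lipschitz by blast
  have "continuous_on UNIV (stretch 0 n)"
    using M by (intro lipschitz_on_continuous_on[of M] lipschitz_onI) auto
  hence "compact (stretch 0 n ` L)" using L(1) by (intro compact_continuous_image) (auto intro: continuous_on_subset)
  moreover have "stretch 0 n ` L \<inter> stage \<kappa> 0 n = {}" using n stretch_avoids_stage[of _ 0 n] by auto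
  ultimately have "\<exists>\<delta>>0. \<forall>x\<in>stretch 0 n ` L. \<forall>y\<in>stage \<kappa> 0 n. \<delta> \<le> dist x y"
    by (intro separate_compact_closed compact_imp_closed[OF compact_stage])
  then obtain \<delta> where \<delta>: "\<delta> > 0" "\<And>z y. z \<in> L \<Longrightarrow> y \<in> stage \<kappa> 0 n \<Longrightarrow> \<delta> \<le> dist (stretch 0 n z) y"
    by auto
  \<comment> \<open>\<open>e\<close> keeps \<open>w\<close> out of the source stage; the other bound
    keeps the image of \<open>w\<close> at distance at least \<open>\<delta> / 2\<close> from the
    target stage.\<close>
  define \<epsilon> where "\<epsilon> = min e (\<delta> / (2 * (M + 1)))"
  have \<epsilon>: "\<epsilon> > 0" using e \<delta> M by (simp add: \<epsilon>_def)
  have "w \<notin> E \<and> norm (prefun w - prefun z) \<le> M / (\<delta> / 2)\<^sup>2 * dist z w" if z: "z \<in> L" and zw: "dist z w < \<epsilon>" for z w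
  proof -
    have wn: "w \<notin> stage (K * \<kappa>) 0 n" using e(2)[OF z, of w] zw by (auto simp: \<epsilon>_def)
    have zn: "z \<notin> stage (K * \<kappa>) 0 n" using n z by auto
    have "M * dist z w \<le> (M + 1) * (\<delta> / (2 * (M + 1)))"
      using zw M(1) by (intro mult_mono) (auto simp: \<epsilon>_def)
    also have "\<dots> = \<delta> / 2"
    proof -
      have "c * (\<delta> / (2 * c)) = \<delta> / 2" if "c > 0" for c using that by simp
      from this[of "M + 1"] show ?thesis using M(1) by linarith
    qed
    finally have d: "dist (stretch 0 n z) (stretch 0 n w) \<le> \<delta> / 2" using M(2)[of z w] by linarith
    have "dist (potential_lim (stretch 0 n w)) (potential_lim (stretch 0 n z)) \<le> dist (stretch 0 n w) (stretch 0 n z) / (\<delta> / 2)\<^sup>2"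
    proof (rule potential_lim_local_Lipschitz[of _ n])
      fix c assume c: "c \<in> stage \<kappa> 0 n"
      show "\<delta> / 2 \<le> dist (stretch 0 n z) c" using \<delta>(2)[OF z c] \<delta>(1) by linarith
      show "\<delta> / 2 \<le> dist (stretch 0 n w) c"
        using \<delta>(2)[OF z c] d dist_triangle[of "stretch 0 n z" c "stretch 0 n w"] by linarith
    qed (use \<delta> in auto)
    also have "\<dots> \<le> M * dist w z / (\<delta> / 2)\<^sup>2" by (intro divide_right_mono M(2)) auto
    finally have "norm (prefun w - prefun z) \<le> M / (\<delta> / 2)\<^sup>2 * dist z w"
      unfolding prefun_eq[OF wn] prefun_eq[OF zn] by (simp add: dist_norm norm_minus_commute)
    moreover have "w \<notin> E" using wn by (auto simp: limit_set_def)
    ultimately show ?thesis by blast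
  qed
  thus ?thesis using \<epsilon> by blast
qed

text \<open>The outer function is holomorphic, so both complex derivatives are multiplied by the
  same number \<open>h\<close> and the Beltrami bound is inherited.\<close>

lemma prefun_has_derivative:
  assumes "z \<notin> E" "\<And>n. z \<notin> critical 0 n"
  shows "\<exists>a b. norm b \<le> (K - 1) / (K + 1) * norm a \<and> (prefun has_derivative (\<lambda>v. a * v + b * cnj v)) (at z)"
proof -
  obtain n where n: "z \<notin> stage (K * \<kappa>) 0 n" using assms(1) by (auto simp: limit_set_def)
  obtain a b where ab: "norm b \<le> (K - 1) / (K + 1) * norm a"
    "(stretch 0 n has_derivative (\<lambda>v. a * v + b * cnj v)) (at z)"
    using stretch_has_derivative[OF assms(2)] by blast
  define h where "h = deriv potential_lim (stretch 0 n z)"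
  have "(potential_lim has_field_derivative h) (at (stretch 0 n z))"
    unfolding h_def using potential_lim_holomorphic[of n] compact_imp_closed[OF compact_stage] stretch_avoids_stage[OF n]
    by (intro holomorphic_derivI[of _ "- stage \<kappa> 0 n"]) auto
  hence "(potential_lim has_derivative (*) h) (at (stretch 0 n z))" by (simp add: has_field_derivative_def)
  from has_derivative_compose[OF ab(2) this]
  have "((\<lambda>z. potential_lim (stretch 0 n z)) has_derivative (\<lambda>v. h * (a * v + b * cnj v))) (at z)" .
  hence "(prefun has_derivative (\<lambda>v. h * (a * v + b * cnj v))) (at z)"
  proof (rule has_derivative_transform_within_open)
    show "open (- stage (K * \<kappa>) 0 n)" using compact_imp_closed[OF compact_stage] by auto
    show "z \<in> - stage (K * \<kappa>) 0 n" using n by simp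
    show "potential_lim (stretch 0 n w) = prefun w" if "w \<in> - stage (K * \<kappa>) 0 n" for w
      using prefun_eq[of w n] that by simp
  qed
  moreover have "(\<lambda>v. h * (a * v + b * cnj v)) = (\<lambda>v. (h * a) * v + (h * b) * cnj v)" by (simp add: fun_eq_iff algebra_simps)
  moreover have "norm (h * b) \<le> (K - 1) / (K + 1) * norm (h * a)"
    using mult_left_mono[OF ab(1), of "norm h"] by (simp add: norm_mult mult_ac)
  ultimately show ?thesis by metis
qed

lemma AE_regular: "AE z in lebesgue. z \<notin> E \<and> (\<forall>n. z \<notin> critical 0 n)"
proof -
  have "negligible (E \<union> (\<Union>n. critical 0 n))"
    using negligible_limit_set[OF K\<kappa>(1)] negligible_critical
    by (intro negligible_Un negligible_countable_Union) auto
  hence "E \<union> (\<Union>n. critical 0 n) \<in> null_sets lebesgue" by (simp only: negligible_iff_null_sets)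
  hence "AE z in lebesgue. z \<notin> E \<union> (\<Union>n. critical 0 n)" by (rule AE_not_in)
  thus ?thesis by eventually_elim auto
qed

lemma quasiregular_off_E:
  assumes f: "continuous_on UNIV f" and fp: "\<And>z. z \<notin> E \<Longrightarrow> f z = prefun z"
  shows "quasiregular K (- E) f"
proof -
  \<comment> \<open>A \<open>lim\<close> of continuous functions is Borel on the whole plane; off a
    null set it is the directional derivative.\<close>
  define D where "D v z = lim (\<lambda>n. real (Suc n) *\<^sub>R (f (z + v /\<^sub>R real (Suc n)) - f z))" for v z
  have oE: "open (- E)" using compact_imp_closed[OF compact_limit_set] by auto
  have Dm: "D v \<in> borel_measurable borel" for v
    unfolding D_def[abs_def]
  proof (rule borel_measurable_lim_metric)
    fix n
    have "continuous_on UNIV (\<lambda>z. real (Suc n) *\<^sub>R (f (z + v /\<^sub>R real (Suc n)) - f z))"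
      by (intro continuous_intros continuous_on_compose2[OF f]) (auto intro: f)
    thus "(\<lambda>z. real (Suc n) *\<^sub>R (f (z + v /\<^sub>R real (Suc n)) - f z)) \<in> borel_measurable borel"
      by (rule borel_measurable_continuous_onI)
  qed
  have der: "\<exists>a b. norm b \<le> (K - 1) / (K + 1) * norm a \<and> (\<forall>v. D v z = a * v + b * cnj v \<and>
      (\<lambda>n. real (Suc n) *\<^sub>R (f (z + v /\<^sub>R real (Suc n)) - f z)) \<longlonglongrightarrow> D v z)"
    if z: "z \<notin> E" "\<And>n. z \<notin> critical 0 n" for z
  proof -
    obtain a b where ab: "norm b \<le> (K - 1) / (K + 1) * norm a" "(prefun has_derivative (\<lambda>v. a * v + b * cnj v)) (at z)"
      using prefun_has_derivative[OF z] by blast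
    have "(f has_derivative (\<lambda>v. a * v + b * cnj v)) (at z)"
      by (rule has_derivative_transform_within_open[OF ab(2) oE]) (use z fp in auto)
    from difference_quotient_tendsto[OF this]
    have *: "(\<lambda>n. real (Suc n) *\<^sub>R (f (z + v /\<^sub>R real (Suc n)) - f z)) \<longlonglongrightarrow> a * v + b * cnj v" for v .
    hence "D v z = a * v + b * cnj v" for v unfolding D_def by (rule limI)
    thus ?thesis using * ab(1) by metis
  qed
  have wd: "weak_derivative (- E) v f (D v)" "locally_Lp q (- E) f" "locally_Lp q (- E) (D v)" for v q
  proof -
    have lip: "\<exists>\<epsilon>>0. \<exists>C. \<forall>z\<in>L. \<forall>w. dist z w < \<epsilon> \<longrightarrow> norm (f w - f z) \<le> C * dist z w"
      if L: "compact L" "L \<subseteq> - E" for L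
    proof -
      obtain \<epsilon> C where "\<epsilon> > 0" and "\<And>z w. z \<in> L \<Longrightarrow> dist z w < \<epsilon> \<Longrightarrow> w \<notin> E \<and> norm (prefun w - prefun z) \<le> C * dist z w"
        using prefun_locally_Lipschitz[OF L] by metis
      moreover have "z \<notin> E" if "z \<in> L" for z using that L by auto
      ultimately show ?thesis using fp by (intro exI[of _ \<epsilon>] conjI exI[of _ C]) auto
    qed
    have ae: "AE z in lebesgue. z \<in> - E \<longrightarrow> (\<lambda>n. real (Suc n) *\<^sub>R (f (z + v /\<^sub>R real (Suc n)) - f z)) \<longlonglongrightarrow> D v z"
      using AE_regular by eventually_elim (use der in blast)
    show "weak_derivative (- E) v f (D v)" "locally_Lp q (- E) f" "locally_Lp q (- E) (D v)"
      by (rule weak_derivativeI[OF oE f lip Dm ae]; assumption)+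
  qed
  \<comment> \<open>Where the denominator vanishes, the Beltrami bound makes
    \<open>wirtinger_bar\<close> vanish too, for almost every \<open>z\<close>; so 0 is a correct
    value there.\<close>
  define \<mu> where "\<mu> z = (if wirtinger (D 1 z) (D \<i> z) = 0 then 0
      else wirtinger_bar (D 1 z) (D \<i> z) / wirtinger (D 1 z) (D \<i> z))" for z
  have mm: "\<mu> \<in> borel_measurable borel"
    using Dm[of 1] Dm[of \<i>] unfolding \<mu>_def[abs_def] wirtinger_def wirtinger_bar_def by measurable
  have "set_borel_measurable lebesgue (- E) \<mu>"
    unfolding set_borel_measurable_def using oE mm
    by (intro borel_measurable_scaleR borel_measurable_indicator) (auto intro: measurable_completion)
  moreover have "AE z in lebesgue. norm (\<mu> z) \<le> (K - 1) / (K + 1) \<and>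
      wirtinger_bar (D 1 z) (D \<i> z) = \<mu> z * wirtinger (D 1 z) (D \<i> z)"
    using AE_regular
  proof eventually_elim
    case (elim z)
    then obtain a b where ab: "norm b \<le> (K - 1) / (K + 1) * norm a" "\<And>v. D v z = a * v + b * cnj v"
      using der[of z] by blast
    have w: "wirtinger (D 1 z) (D \<i> z) = a" "wirtinger_bar (D 1 z) (D \<i> z) = b"
      unfolding ab(2) wirtinger_def wirtinger_bar_def by (simp_all add: field_simps)
    have "0 \<le> (K - 1) / (K + 1)" using K by simp
    thus ?case
      using ab(1) unfolding \<mu>_def w by (cases "a = 0") (auto simp: norm_divide pos_divide_le_eq)
  qed
  ultimately show ?thesis
    unfolding quasiregular_def W12_loc_def
    using wd(1)[of 1] wd(1)[of \<i>] wd(2)[of 2] wd(3)[of 2]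
    by (intro conjI exI[of _ "D 1"] exI[of _ "D \<i>"] exI[of _ \<mu>]) auto
qed

section \<open>Infinite energy\<close>

text \<open>The similarity of the unit disc onto the disc with address \<open>J\<close>.\<close>

definition place :: "real \<Rightarrow> nat \<Rightarrow> complex list \<Rightarrow> complex \<Rightarrow> complex" where
  "place e k J z = centre e k J + of_real (scale e k J) * z"

lemma place_Nil [simp]: "place e k [] z = z"
  by (simp add: place_def)

lemma place_Cons [simp]: "place e k (p # J) z = p + of_real (radius e k p) * place e (Suc k) J z"
  by (simp add: place_def algebra_simps)

lemma norm_place:
  assumes "J \<in> words k n" "\<kappa> \<le> e" "norm z \<le> 1"
  shows "norm (place e k J z) \<le> 1"
proof -
  have s: "0 < scale e k J" by (rule scale_pos[OF assms(1)])
  have "norm (place e k J z) \<le> norm (centre e k J) + scale e k J * norm z"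
    unfolding place_def using norm_triangle_ineq[of "centre e k J" "of_real (scale e k J) * z"] s
    by (simp add: norm_mult)
  also have "\<dots> \<le> norm (centre e k J) + scale e k J * 1" using s assms(3) by (intro add_left_mono mult_left_mono) auto
  finally show ?thesis using norm_centre_scale[OF assms(1,2)] by simp
qed

lemma place_in_child:
  assumes "p \<in> I k" "J \<in> words (Suc k) n" "\<kappa> \<le> e" "norm z \<le> 1"
  shows "dist p (place e k (p # J) z) \<le> radius e k p"
  using norm_place[OF assms(2,3,4)] radius_pos[OF assms(1), of e] by (simp add: dist_norm norm_mult mult_left_le)

text \<open>Discs of equal generation are disjoint, so a point of such a disc determines the address
  letter by letter.\<close>

lemma place_inj:
  assumes "\<kappa> \<le> e" "J \<in> words k n" "J' \<in> words k n" "norm z \<le> 1" "norm z' \<le> 1" "place e k J z = place e k J' z'"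
  shows "J = J'"
  using assms
proof (induction n arbitrary: k J J')
  case (Suc n)
  obtain p M where L: "J = p # M" "p \<in> I k" "M \<in> words (Suc k) n" using words_SucE[OF Suc.prems(2)] .
  obtain p' M' where L': "J' = p' # M'" "p' \<in> I k" "M' \<in> words (Suc k) n" using words_SucE[OF Suc.prems(3)] .
  have "dist p (place e k J z) \<le> radius e k p" "dist p' (place e k J z) \<le> radius e k p'"
    using place_in_child[OF L(2,3) Suc.prems(1,4)] place_in_child[OF L'(2,3) Suc.prems(1,5)] Suc.prems(6)
    unfolding L(1) L'(1) by auto
  hence "dist p (place e k J z) < R k p" "dist p' (place e k J z) < R k p'"
    using radius_le[OF L(2) Suc.prems(1)] radius_le[OF L'(2) Suc.prems(1)] R_pos[OF L(2)] R_pos[OF L'(2)] by linarith+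
  hence pp: "p = p'" using disc_unique L(2) L'(2) by blast
  hence "place e (Suc k) M z = place e (Suc k) M' z'"
    using Suc.prems(6) radius_pos[OF L(2), of e] unfolding L L' by simp
  hence "M = M'" using Suc.IH[OF Suc.prems(1) L(3) L'(3) Suc.prems(4,5)] by blast
  thus ?case using pp L L' by simp
qed auto

text \<open>Self-similarity over \<open>n\<close> generations. With \<open>m = 1\<close> it shows
  that the map is a similarity on the rings used in \<open>disc_energy\<close>, where the remaining
  stretching is the identity.\<close>

lemma stretch_place:
  "J \<in> words k n \<Longrightarrow> norm z \<le> 1 \<Longrightarrow> stretch k (n + m) (place (K * \<kappa>) k J z) = place \<kappa> k J (stretch (k + n) m z)"
proof (induction n arbitrary: k J)
  case (Suc n)
  obtain p M where L: "J = p # M" "p \<in> I k" "M \<in> words (Suc k) n" using words_SucE[OF Suc.prems(1)] .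
  have s: "0 < src k p" by (rule radius_pos[OF L(2)])
  have "stretch k (Suc (n + m)) (place (K * \<kappa>) k J z)
      = p + of_real (tgt k p) * stretch (Suc k) (n + m) ((place (K * \<kappa>) k J z - p) / of_real (src k p))"
    unfolding L(1) using place_in_child[OF L(2,3) K\<kappa>(1) Suc.prems(2)] by (intro stretch_inside L(2))
  also have "(place (K * \<kappa>) k J z - p) / of_real (src k p) = place (K * \<kappa>) (Suc k) M z" using s unfolding L by simp
  also have "stretch (Suc k) (n + m) (place (K * \<kappa>) (Suc k) M z) = place \<kappa> (Suc k) M (stretch (Suc k + n) m z)"
    by (rule Suc.IH[OF L(3) Suc.prems(2)])
  finally show ?case unfolding L by simp
qed auto

lemma stage_add: "stage e k (n + m) = (\<Union>J\<in>words k n. place e k J ` stage e (k + n) m)"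
proof (induction n arbitrary: k)
  case (Suc n)
  have "stage e k (Suc n + m) = (\<Union>p\<in>I k. \<Union>J\<in>words (Suc k) n.
      (\<lambda>z. p + of_real (radius e k p) * z) ` place e (Suc k) J ` stage e (Suc k + n) m)"
    by (simp only: add_Suc stage.simps Suc image_UN)
  also have "\<dots> = (\<Union>p\<in>I k. \<Union>J\<in>words (Suc k) n. place e k (p # J) ` stage e (Suc k + n) m)"
    by (simp add: image_image)
  also have "\<dots> = (\<Union>J\<in>words k (Suc n). place e k J ` stage e (k + Suc n) m)"
    by (simp only: words.simps UN_extend_simps add_Suc add_Suc_right) force
  finally show ?case .
qed simp

section \<open>Concatenation of addresses\<close>

lemma words_append_I: "J \<in> words k n \<Longrightarrow> M \<in> words (k + n) m \<Longrightarrow> J @ M \<in> words k (n + m)"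
proof (induction n arbitrary: k J)
  case (Suc n)
  obtain p L where L: "J = p # L" "p \<in> I k" "L \<in> words (Suc k) n" using words_SucE[OF Suc.prems(1)] .
  have "L @ M \<in> words (Suc k) (n + m)" using L(3) Suc.prems(2) by (intro Suc.IH) auto
  hence "(p, L @ M) \<in> I k \<times> words (Suc k) (n + m)" using L(2) by blast
  hence "p # (L @ M) \<in> words k (Suc (n + m))" unfolding words.simps by (rule rev_image_eqI) simp
  thus ?case using L(1) by simp
qed simp

lemma words_append_E:
  assumes "L \<in> words k (n + m)"
  obtains J M where "J \<in> words k n" "M \<in> words (k + n) m" "L = J @ M"
  using assms
proof (induction n arbitrary: k L thesis)
  case (Suc n)
  obtain p L' where L: "L = p # L'" "p \<in> I k" "L' \<in> words (Suc k) (n + m)"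
    using Suc.prems(2) words_SucE[of L k "n + m"] by auto
  obtain J M where "J \<in> words (Suc k) n" "M \<in> words (Suc k + n) m" "L' = J @ M"
    using Suc.IH[OF _ L(3)] by blast
  thus ?case using L by (intro Suc.prems(1)[of "p # J" M]) auto
qed auto

lemma words_length: "L \<in> words k n \<Longrightarrow> length L = n"
  by (induction n arbitrary: k L) auto

lemma mass_append: "J \<in> words k n \<Longrightarrow> mass k (J @ M) = mass k J * mass (k + n) M"
  by (induction n arbitrary: k J) auto

lemma centre_append: "J \<in> words k n \<Longrightarrow> centre e k (J @ M) = place e k J (centre e (k + n) M)"
  by (induction n arbitrary: k J) auto

lemma norm_centre_le: "L \<in> words k n \<Longrightarrow> \<kappa> \<le> e \<Longrightarrow> norm (centre e k L) \<le> 1"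
  using norm_centre_scale[of L k n e] scale_pos[of L k n e] by linarith

text \<open>Around each disc of each generation the function is the Cauchy transform of the limit measure
  in the target, precomposed with a similarity. Testing against a plateau function that is constant on
  the disc reads off the mass inside it, and hence forces a definite energy there.\<close>

lemma disc_energy:
  fixes f p q g :: "complex \<Rightarrow> complex"
  assumes J: "J \<in> words 0 n" and j: "j \<in> I n"
    and f: "\<And>z. z \<notin> E \<Longrightarrow> f z = prefun z" and fm: "f \<in> borel_measurable borel"
    and p: "weak_derivative UNIV 1 f p" and q: "weak_derivative UNIV \<i> f q"
    and g: "\<And>z. g z = p z + \<i> * q z"
    and g2: "\<And>C. compact C \<Longrightarrow> set_integrable lebesgue C (\<lambda>z. (norm (g z))\<^sup>2)"
  shows "pi * (mass 0 J)\<^sup>2 * (R n j)\<^sup>2 / (scale \<kappa> 0 J * area n)\<^sup>2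
    \<le> (LINT z:cball (place (K * \<kappa>) 0 J j) (scale (K * \<kappa>) 0 J * R' n j)|lebesgue. (norm (g z))\<^sup>2)"
proof -
  define s t where "s = scale (K * \<kappa>) 0 J" and "t = scale \<kappa> 0 J"
  have st: "0 < s" "0 < t" unfolding s_def t_def by (rule scale_pos[OF J])+
  define a where "a = place (K * \<kappa>) 0 J j"
  define r r' where "r = s * R n j" and "r' = s * R' n j"
  have r: "0 < r" "r < r'" "r' \<le> 2 * r"
    using st R_pos[OF j] R_less[OF j] R'_le[OF j] by (auto simp: r_def r'_def)
  have r0: "0 \<le> r" using r by simp
  define \<eta> where "\<eta> = plateau a r r'"
  define W where "W = test_gradient \<eta>"
  have tf: "test_function UNIV \<eta>" unfolding \<eta>_def by (rule test_function_plateau[OF r0 r(2)])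
  \<comment> \<open>The ring that carries the gradient of the plateau function, between the packing
    disc \<open>j\<close> and its enlargement.\<close>
  define S where "S = {z. r \<le> norm (z - a) \<and> norm (z - a) \<le> r'}"
  have W0: "W z = 0" if "z \<notin> S" for z
    using that unfolding W_def \<eta>_def S_def by (intro test_gradient_plateau_0[OF r0 r(2)]) auto
  have cS: "compact S"
  proof -
    have "S = cball a r' - ball a r" by (auto simp: S_def dist_norm norm_minus_commute)
    thus ?thesis by (simp add: compact_diff)
  qed
  define c where "c z = (z - centre (K * \<kappa>) 0 J) / of_real s" for z
  have zc: "place (K * \<kappa>) 0 J (c z) = z" for z using st by (simp add: place_def c_def s_def[symmetric])
  have za: "z - a = of_real s * (c z - j)" for z
    using st by (simp add: a_def place_def c_def s_def[symmetric] field_simps)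
  have cz: "R n j \<le> dist j (c z)" "dist j (c z) \<le> R' n j" "norm (c z) \<le> 1" if "z \<in> S" for z
  proof -
    have "norm (z - a) = s * dist j (c z)" unfolding za norm_mult using st by (simp add: dist_norm norm_minus_commute)
    thus *: "R n j \<le> dist j (c z)" "dist j (c z) \<le> R' n j" using that st by (auto simp: S_def r_def r'_def)
    show "norm (c z) \<le> 1"
      using norm_centre[OF j] * norm_triangle_ineq[of "c z - j" j] by (simp add: dist_norm norm_minus_commute)
  qed
  have sep: "R n i < dist i (c z)" if "z \<in> S" "i \<in> I n" "i \<noteq> j" for z i
    using separated'[OF that(2) j that(3)] cz(2)[OF that(1)] R_less[OF that(2)]
      dist_triangle[of i j "c z"] by (simp add: dist_commute)
  define lm where "lm z = place \<kappa> 0 J (c z)" for z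
  have stage1: "z \<notin> stage (K * \<kappa>) 0 (n + 1)" if z: "z \<in> S" for z
  proof
    assume "z \<in> stage (K * \<kappa>) 0 (n + 1)"
    then obtain J' y where J': "J' \<in> words 0 n" "y \<in> stage (K * \<kappa>) n 1" "z = place (K * \<kappa>) 0 J' y"
      unfolding stage_add by auto
    have "stage (K * \<kappa>) n 1 \<subseteq> stage (K * \<kappa>) n 0" by (rule stage_antimono[OF K\<kappa>(1)]) simp
    from subsetD[OF this J'(2)] have y1: "norm y \<le> 1" by (simp only: stage.simps(1) mem_cball_0)
    have "place (K * \<kappa>) 0 J' y = place (K * \<kappa>) 0 J (c z)" using J'(3) zc[of z] by simp
    hence "J' = J" using place_inj[OF K\<kappa>(1) J'(1) J y1 cz(3)[OF z]] by blast
    hence "c z = y" using J'(3) st by (simp add: place_def c_def s_def[symmetric])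
    then obtain i x where i: "i \<in> I n" "norm x \<le> 1" "c z = i + of_real (src n i) * x"
      using J'(2) by (auto simp: numeral_eq_Suc One_nat_def)
    hence "dist i (c z) \<le> src n i" using radius_pos[OF i(1), of "K * \<kappa>"] by (simp add: dist_norm norm_mult mult_left_le)
    hence "dist i (c z) < R n i" using src_less[OF i(1)] by linarith
    thus False using sep[OF z i(1)] cz(1)[OF z] by (cases "i = j") auto
  qed
  have lam: "stretch 0 (n + 1) z = lm z" if z: "z \<in> S" for z
  proof -
    have "stretch 0 (n + 1) (place (K * \<kappa>) 0 J (c z)) = place \<kappa> 0 J (stretch (0 + n) 1 (c z))"
      by (rule stretch_place[OF J cz(3)[OF z]])
    moreover have "stretch n 1 (c z) = c z"
    proof (rule stretch_outside)
      fix i assume "i \<in> I n"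
      thus "R n i \<le> dist i (c z)" using sep[OF z, of i] cz(1)[OF z] by (cases "i = j") auto
    qed
    ultimately show ?thesis unfolding zc lm_def by simp
  qed
  have lam_stage: "lm z \<notin> stage \<kappa> 0 (n + 1)" if z: "z \<in> S" for z
    using stretch_avoids_stage[OF stage1[OF z]] lam[OF z] by simp
  have fS: "f z = potential_lim (lm z)" if z: "z \<in> S" for z
  proof -
    have "z \<notin> E" using stage1[OF z] unfolding limit_set_def by blast
    thus ?thesis using f prefun_eq[OF stage1[OF z]] unfolding lam[OF z] by simp
  qed
  define m where "m = mass 0 J * ((R n j)\<^sup>2 / area n)"
  have m0: "0 \<le> m" using mass_nonneg[of 0 J] area_pos[of n] by (simp add: m_def)
  \<comment> \<open>Potentials of generation at least \<open>n + 1\<close>, whose addresses reach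
    past \<open>J\<close> and tell the disc \<open>j\<close> from its siblings.\<close>
  define F where "F N z = potential 0 (n + Suc N) (lm z)" for N z
  \<comment> \<open>Pulling the kernel back by the similarity turns each target mass into a pole in
    the source plane, at the price of the factor \<open>s / t\<close>; all integrals stay in the
    source plane.\<close>
  have kern: "1 / (lm z - place \<kappa> 0 J y) = of_real (s / t) * (1 / (z - place (K * \<kappa>) 0 J y))" for z y
  proof -
    have "lm z - place \<kappa> 0 J y = of_real t * (c z - y)" by (simp add: lm_def place_def t_def algebra_simps)
    moreover have "z - place (K * \<kappa>) 0 J y = of_real s * (c z - y)"
      using zc[of z] by (simp add: place_def s_def algebra_simps)
    ultimately show ?thesis using st by simp
  qed
  have IF: "(LINT z|lebesgue. W z * F N z) = of_real (- 2 * pi * (s / t) * m)"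
      "integrable lebesgue (\<lambda>z. W z * F N z)" for N
  proof -
    let ?T = "words 0 (n + Suc N)"
    define y where "y L = (centre \<kappa> 0 L - centre \<kappa> 0 J) / of_real t" for L
    have cy: "centre \<kappa> 0 L = place \<kappa> 0 J (y L)" for L using st by (simp add: y_def place_def t_def[symmetric])
    have dya: "norm (place (K * \<kappa>) 0 J (y L) - a) = s * dist j (y L)" for L
    proof -
      have "place (K * \<kappa>) 0 J (y L) - a = of_real s * (y L - j)" by (simp add: a_def place_def s_def algebra_simps)
      thus ?thesis using st by (simp add: norm_mult dist_norm norm_minus_commute)
    qed
    have Jy: "y (J @ M) = centre \<kappa> n M" for M
      using centre_append[OF J, of \<kappa> M] st by (simp add: y_def place_def t_def[symmetric])
    have iny: "dist j (y (J @ j # M)) < R n j" if "M \<in> words (Suc n) N" for M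
      using place_in_child[OF j that order_refl, of 0] tgt_le[OF j] R_pos[OF j] unfolding Jy by (simp add: place_def)
    have outy: "R' n j < dist j (y (J @ i # M))" if "i \<in> I n" "i \<noteq> j" "M \<in> words (Suc n) N" for i M
    proof -
      have "dist i (y (J @ i # M)) \<le> tgt n i"
        using place_in_child[OF that(1,3) order_refl, of 0] unfolding Jy by (simp add: place_def)
      thus ?thesis using separated'[OF j that(1)] that(2) tgt_le[OF that(1)] R_pos[OF that(1)] R_less[OF that(1)]
          dist_triangle[of j i "y (J @ i # M)"] by (simp add: dist_commute)
    qed
    have outy': "R' n j < dist j (y (J' @ M))" if "J' \<in> words 0 n" "J' \<noteq> J" "M \<in> words n (Suc N)" for J' M
    proof (rule ccontr)
      assume "\<not> ?thesis"
      hence "norm (y (J' @ M)) \<le> 1"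
        using norm_centre[OF j] norm_triangle_ineq[of "y (J' @ M) - j" j] by (simp add: dist_norm norm_minus_commute)
      moreover have "place \<kappa> 0 J (y (J' @ M)) = place \<kappa> 0 J' (centre \<kappa> n M)"
        using centre_append[OF that(1), of \<kappa> M] cy by simp
      ultimately show False
        using place_inj[OF order_refl J that(1) _ norm_centre_le[OF that(3) order_refl]] that(2) by blast
    qed
    \<comment> \<open>Masses below \<open>j\<close> in the disc \<open>J\<close> have their poles
      inside the inner circle of the ring, all others outside the outer circle; so
      \<open>integral_plateau_Cauchy\<close> selects exactly the mass \<open>m\<close>.\<close>
    define inside where "inside L \<longleftrightarrow> (\<exists>M\<in>words (Suc n) N. L = J @ j # M)" for L
    have cls: "if inside L then dist j (y L) < R n j else R' n j < dist j (y L)" if L: "L \<in> ?T" for L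
    proof -
      obtain J' M where JM: "J' \<in> words 0 n" "M \<in> words n (Suc N)" "L = J' @ M"
        using words_append_E[OF L] unfolding add_0 by blast
      obtain i M' where M: "M = i # M'" "i \<in> I n" "M' \<in> words (Suc n) N" using words_SucE[OF JM(2)] .
      show ?thesis
      proof (cases "J' = J")
        case True
        show ?thesis
        proof (cases "i = j")
          case True
          thus ?thesis using iny[OF M(3)] \<open>J' = J\<close> JM M by (auto simp: inside_def)
        next
          case False
          thus ?thesis using outy[OF M(2) _ M(3)] \<open>J' = J\<close> JM M by (auto simp: inside_def)
        qed
      next
        case False
        have "length J' = length J" using words_length[OF JM(1)] words_length[OF J] by simp
        hence "\<not> inside L" using False JM(3) by (auto simp: inside_def)
        thus ?thesis using outy'[OF JM(1) False JM(2)] JM(3) by simp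
      qed
    qed
    define b where "b L = place (K * \<kappa>) 0 J (y L)" for L
    have cls': "if inside L then norm (b L - a) < r else norm (b L - a) > r'" if "L \<in> ?T" for L
      using cls[OF that] st unfolding b_def dya r_def r'_def by simp
    have WF: "W z * F N z = (\<Sum>L\<in>?T. of_real (mass 0 L * (s / t)) * (W z * (1 / (z - b L))))" for z
    proof -
      have "F N z = (\<Sum>L\<in>?T. of_real (mass 0 L) * (1 / (lm z - place \<kappa> 0 J (y L))))"
        unfolding F_def potential_eq cy[symmetric] by simp
      also have "\<dots> = (\<Sum>L\<in>?T. of_real (mass 0 L) * (of_real (s / t) * (1 / (z - b L))))"
        unfolding kern b_def ..
      finally show ?thesis by (simp add: sum_distrib_left mult_ac)
    qed
    have iL: "integrable lebesgue (\<lambda>z. W z * (1 / (z - b L)))" if "L \<in> ?T" for L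
      unfolding W_def \<eta>_def using cls'[OF that] by (intro integrable_plateau_Cauchy r) (auto split: if_splits)
    show "integrable lebesgue (\<lambda>z. W z * F N z)"
      unfolding WF by (intro Bochner_Integration.integrable_sum integrable_mult_right iL)
    have "(LINT z|lebesgue. W z * F N z)
        = (\<Sum>L\<in>?T. of_real (mass 0 L * (s / t)) * (LINT z|lebesgue. W z * (1 / (z - b L))))"
    proof -
      have "(LINT z|lebesgue. W z * F N z)
          = (\<Sum>L\<in>?T. LINT z|lebesgue. of_real (mass 0 L * (s / t)) * (W z * (1 / (z - b L))))"
        unfolding WF by (rule Bochner_Integration.integral_sum) (intro integrable_mult_right iL)
      thus ?thesis by (simp only: integral_mult_right_zero)
    qed
    also have "\<dots> = (\<Sum>L\<in>?T. of_real (mass 0 L * (s / t)) * of_real (if inside L then - 2 * pi else 0))"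
    proof (intro sum.cong refl)
      fix L assume L: "L \<in> ?T"
      have "(LINT z|lebesgue. W z * (1 / (z - b L))) = of_real (if norm (b L - a) < r then - 2 * pi else 0)"
        unfolding W_def \<eta>_def using cls'[OF L] by (intro integral_plateau_Cauchy r) (auto split: if_splits)
      moreover have "norm (b L - a) < r \<longleftrightarrow> inside L" using cls'[OF L] r by (auto split: if_splits)
      ultimately show "of_real (mass 0 L * (s / t)) * (LINT z|lebesgue. W z * (1 / (z - b L)))
        = of_real (mass 0 L * (s / t)) * complex_of_real (if inside L then - 2 * pi else 0)" by simp
    qed
    also have "\<dots> = of_real (\<Sum>L\<in>?T. mass 0 L * (s / t) * (if inside L then - 2 * pi else 0))" by simp
    also have "(\<Sum>L\<in>?T. mass 0 L * (s / t) * (if inside L then - 2 * pi else 0))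
       = - 2 * pi * (s / t) * (\<Sum>L\<in>{L\<in>?T. inside L}. mass 0 L)"
      unfolding sum.inter_filter[OF finite_words] sum_distrib_left by (intro sum.cong) auto
    also have "(\<Sum>L\<in>{L\<in>?T. inside L}. mass 0 L) = (\<Sum>M\<in>words (Suc n) N. mass 0 (J @ j # M))"
    proof (rule sum.reindex_cong[where l = "\<lambda>M. J @ j # M"])
      show "{L \<in> ?T. inside L} = (\<lambda>M. J @ j # M) ` words (Suc n) N"
        using words_append_I[OF J, of _ "Suc N"] j by (auto simp: inside_def)
    qed (auto simp: inj_on_def)
    also have "\<dots> = m" unfolding mass_append[OF J]
      by (simp only: add_0 mass.simps sum_distrib_left[symmetric] sum_mass mult_1_right m_def)
    finally show "(LINT z|lebesgue. W z * F N z) = of_real (- 2 * pi * (s / t) * m)" .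
  qed
  have Wc: "continuous_on UNIV W" unfolding W_def by (rule continuous_test_gradient[OF tf])
  have If: "(LINT z|lebesgue. W z * f z) = of_real (- 2 * pi * (s / t) * m)"
  proof -
    have "continuous_on S lm"
      unfolding lm_def[abs_def] place_def c_def using st by (intro continuous_intros) auto
    hence "compact (lm ` S)" using cS by (rule compact_continuous_image)
    moreover have "lm ` S \<inter> stage \<kappa> 0 (n + 1) = {}" using lam_stage by auto
    ultimately have "\<exists>\<delta>>0. \<forall>x\<in>lm ` S. \<forall>y\<in>stage \<kappa> 0 (n + 1). \<delta> \<le> dist x y"
      by (intro separate_compact_closed compact_imp_closed[OF compact_stage])
    then obtain \<delta> where \<delta>: "\<delta> > 0" "\<And>z y. z \<in> S \<Longrightarrow> y \<in> stage \<kappa> 0 (n + 1) \<Longrightarrow> \<delta> \<le> dist (lm z) y" by auto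
    \<comment> \<open>Uniform in \<open>N\<close>, for dominated convergence: all poles of these
      potentials keep the distance \<open>\<delta>\<close> from the image of the ring.\<close>
    have FB: "norm (F N z) \<le> 1 / \<delta>" if z: "z \<in> S" for N z
    proof -
      have "norm (F N z) \<le> (\<Sum>L\<in>words 0 (n + Suc N). norm (of_real (mass 0 L) / (lm z - centre \<kappa> 0 L)))"
        unfolding F_def potential_eq by (rule norm_sum)
      also have "\<dots> \<le> (\<Sum>L\<in>words 0 (n + Suc N). mass 0 L * (1 / \<delta>))"
      proof (rule sum_mono)
        fix L assume L: "L \<in> words 0 (n + Suc N)"
        have "centre \<kappa> 0 L \<in> stage \<kappa> 0 (n + 1)"
          by (rule subsetD[OF stage_antimono centre_in_stage[OF L]]) auto
        hence "\<delta> \<le> norm (lm z - centre \<kappa> 0 L)" using \<delta>(2)[OF z] by (simp add: dist_norm)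
        hence "1 / norm (lm z - centre \<kappa> 0 L) \<le> 1 / \<delta>" using \<delta>(1) by (intro frac_le) auto
        hence "mass 0 L * (1 / norm (lm z - centre \<kappa> 0 L)) \<le> mass 0 L * (1 / \<delta>)"
          by (rule mult_left_mono[OF _ mass_nonneg])
        thus "norm (of_real (mass 0 L) / (lm z - centre \<kappa> 0 L)) \<le> mass 0 L * (1 / \<delta>)"
          by (simp add: norm_divide mass_nonneg)
      qed
      also have "\<dots> = 1 / \<delta>" unfolding sum_distrib_right[symmetric] sum_mass by simp
      finally show ?thesis .
    qed
    have Ft: "(\<lambda>N. F N z) \<longlonglongrightarrow> f z" if z: "z \<in> S" for z
    proof -
      have "(\<lambda>N. potential 0 (N + Suc n) (lm z)) \<longlonglongrightarrow> potential_lim (lm z)"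
        by (rule LIMSEQ_ignore_initial_segment[OF potential_tendsto[OF lam_stage[OF z]]])
      thus ?thesis unfolding F_def fS[OF z] by (simp add: add.commute)
    qed
    obtain B where B: "\<And>z. z \<in> S \<Longrightarrow> norm (W z) \<le> B"
      using compact_imp_bounded[OF compact_continuous_image[OF continuous_on_subset[OF Wc subset_UNIV] cS]]
      by (auto simp: bounded_iff)
    have "(\<lambda>N. LINT z|lebesgue. W z * F N z) \<longlonglongrightarrow> (LINT z|lebesgue. W z * f z)"
    proof (rule integral_dominated_convergence[where w = "\<lambda>z. \<bar>B\<bar> / \<delta> * indicator S z"])
      show "(\<lambda>z. W z * f z) \<in> borel_measurable lebesgue"
        using borel_measurable_continuous_onI[OF Wc] fm by (intro borel_measurable_times) (auto intro: measurable_completion)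
      show "(\<lambda>z. W z * F N z) \<in> borel_measurable lebesgue" for N by (rule borel_measurable_integrable[OF IF(2)])
      show "integrable lebesgue (\<lambda>z. \<bar>B\<bar> / \<delta> * indicator S z)"
        using lmeasurable_compact[OF cS] by (intro integrable_mult_right integrable_real_indicator) (auto simp: fmeasurable_def)
      show "AE z in lebesgue. (\<lambda>N. W z * F N z) \<longlonglongrightarrow> W z * f z"
      proof (rule AE_I2)
        fix z show "(\<lambda>N. W z * F N z) \<longlonglongrightarrow> W z * f z"
          using Ft[of z] W0[of z] by (cases "z \<in> S") (auto intro!: tendsto_intros)
      qed
      show "AE z in lebesgue. norm (W z * F N z) \<le> \<bar>B\<bar> / \<delta> * indicator S z" for N
      proof (rule AE_I2)
        fix z show "norm (W z * F N z) \<le> \<bar>B\<bar> / \<delta> * indicator S z"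
        proof (cases "z \<in> S")
          case True
          have "norm (W z) * norm (F N z) \<le> \<bar>B\<bar> * (1 / \<delta>)"
            using B[OF True] FB[OF True, of N] \<delta> by (intro mult_mono) auto
          thus ?thesis using True by (simp add: norm_mult)
        qed (simp add: W0)
      qed
    qed
    thus ?thesis unfolding IF(1) by (simp only: LIMSEQ_const_iff)
  qed
  have wd: "(LINT z|lebesgue. frechet_derivative \<eta> (at z) v *\<^sub>R f z) = - (LINT z|lebesgue. \<eta> z *\<^sub>R h z)"
    if "weak_derivative UNIV v f h" for v h
    using that tf unfolding weak_derivative_def by (simp add: set_lebesgue_integral_def)
  have \<eta>0: "\<eta> z = 0" if "z \<notin> cball a r'" for z
    unfolding \<eta>_def using that by (intro plateau_eq_0[OF r0 r(2)]) (simp add: dist_norm norm_minus_commute)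
  have fd0: "frechet_derivative \<eta> (at z) v = 0" if "z \<notin> cball a r'" for z v
    by (rule frechet_derivative_locally_const[of "- cball a r'" _ _ 0]) (use that \<eta>0 in auto)
  have loc: "set_integrable lebesgue (cball a r') h" if "locally_Lp 1 UNIV h" for h
  proof -
    have "set_integrable lebesgue (cball a r') (\<lambda>z. norm (h z))" "h \<in> borel_measurable lebesgue"
      using that by (auto simp: locally_Lp_def set_borel_measurable_def)
    moreover have "(\<lambda>z. indicator (cball a r') z *\<^sub>R h z) \<in> borel_measurable lebesgue"
      by (intro borel_measurable_scaleR borel_measurable_indicator calculation(2)) auto
    ultimately show ?thesis
      unfolding set_integrable_def by (subst integrable_norm_iff[symmetric]) (auto simp: abs_mult)
  qed
  have prod: "integrable lebesgue (\<lambda>z. k z *\<^sub>R h z)"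
    if A: "locally_Lp 1 UNIV h" "continuous_on UNIV k" "\<And>z. z \<notin> cball a r' \<Longrightarrow> k z = 0" for k :: "complex \<Rightarrow> real" and h
  proof -
    obtain B where B: "\<And>z. z \<in> cball a r' \<Longrightarrow> norm (k z) \<le> B"
      using compact_imp_bounded[OF compact_continuous_image[OF continuous_on_subset[OF A(2) subset_UNIV] compact_cball]]
      by (auto simp: bounded_iff) (metis mem_cball)
    show ?thesis
    proof (rule Bochner_Integration.integrable_bound)
      show "integrable lebesgue (\<lambda>z. \<bar>B\<bar> * norm (indicator (cball a r') z *\<^sub>R h z))"
        using loc[OF A(1)] unfolding set_integrable_def by (intro integrable_mult_right integrable_norm)
      have "h \<in> borel_measurable lebesgue" using A(1) by (auto simp: locally_Lp_def set_borel_measurable_def)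
      thus "(\<lambda>z. k z *\<^sub>R h z) \<in> borel_measurable lebesgue"
        using borel_measurable_continuous_onI[OF A(2)] by (intro borel_measurable_scaleR) (auto intro: measurable_completion)
      show "AE z in lebesgue. norm (k z *\<^sub>R h z) \<le> norm (\<bar>B\<bar> * norm (indicator (cball a r') z *\<^sub>R h z))"
      proof (rule AE_I2)
        fix z show "norm (k z *\<^sub>R h z) \<le> norm (\<bar>B\<bar> * norm (indicator (cball a r') z *\<^sub>R h z))"
        proof (cases "z \<in> cball a r'")
          case True
          hence "norm (k z) \<le> \<bar>B\<bar>" using B[of z] by linarith
          thus ?thesis using True by (simp add: mult_right_mono)
        qed (simp add: A(3))
      qed
    qed
  qed
  have lp: "locally_Lp 1 UNIV f" "locally_Lp 1 UNIV p" "locally_Lp 1 UNIV q"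
    using p q by (auto simp: weak_derivative_def)
  note ti = test_functionD(2,3)[OF tf]
  have "(LINT z|lebesgue. W z * f z)
      = (LINT z|lebesgue. frechet_derivative \<eta> (at z) 1 *\<^sub>R f z + \<i> * (frechet_derivative \<eta> (at z) \<i> *\<^sub>R f z))"
    by (simp add: W_def test_gradient_def scaleR_conv_of_real algebra_simps)
  also have "\<dots> = (LINT z|lebesgue. frechet_derivative \<eta> (at z) 1 *\<^sub>R f z)
      + \<i> * (LINT z|lebesgue. frechet_derivative \<eta> (at z) \<i> *\<^sub>R f z)"
    using prod[OF lp(1) ti(2) fd0] by (subst Bochner_Integration.integral_add) (simp_all del: mult_scaleR_right)
  also have "\<dots> = - ((LINT z|lebesgue. \<eta> z *\<^sub>R p z) + \<i> * (LINT z|lebesgue. \<eta> z *\<^sub>R q z))"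
    unfolding wd[OF p] wd[OF q] by simp
  also have "(LINT z|lebesgue. \<eta> z *\<^sub>R p z) + \<i> * (LINT z|lebesgue. \<eta> z *\<^sub>R q z)
      = (LINT z|lebesgue. \<eta> z *\<^sub>R p z + \<i> * (\<eta> z *\<^sub>R q z))"
    using prod[OF lp(2) ti(1) \<eta>0] prod[OF lp(3) ti(1) \<eta>0]
    by (subst Bochner_Integration.integral_add) (simp_all del: mult_scaleR_right)
  also have "\<dots> = (LINT z|lebesgue. \<eta> z *\<^sub>R g z)" by (simp add: g scaleR_conv_of_real algebra_simps)
  finally have "(LINT z|lebesgue. \<eta> z *\<^sub>R g z) = of_real (2 * pi * (s / t) * m)" unfolding If by simp
  hence "norm (LINT z|lebesgue. \<eta> z *\<^sub>R g z) = \<bar>2 * pi * (s / t) * m\<bar>" by (simp only: norm_of_real)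
  also have "\<dots> = 2 * pi * (s / t * m)" using st m0 by (simp add: abs_mult)
  finally have low: "2 * pi * (s / t * m) \<le> norm (LINT z|lebesgue. plateau a r r' z *\<^sub>R g z)" unfolding \<eta>_def by simp
  have gi: "set_integrable lebesgue (cball a r') g"
  proof -
    have "set_integrable lebesgue (cball a r') (\<lambda>z. p z + \<i> * q z)"
      by (intro set_integral_add set_integrable_mult_right loc lp)
    moreover have "g = (\<lambda>z. p z + \<i> * q z)" using g by auto
    ultimately show ?thesis by simp
  qed
  have "pi * (s / t * m)\<^sup>2 / r\<^sup>2 \<le> (LINT z:cball a r'|lebesgue. (norm (g z))\<^sup>2)"
    using st m0 by (intro energy_lower_bound r g2 gi low) auto
  \<comment> \<open>Since \<open>r = s * R n j\<close>, the source scale cancels.\<close>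
  moreover have "pi * (s / t * m)\<^sup>2 / r\<^sup>2 = pi * (mass 0 J)\<^sup>2 * (R n j)\<^sup>2 / (t * area n)\<^sup>2"
    using st R_pos[OF j] area_pos[of n] by (simp add: m_def r_def power2_eq_square)
  ultimately show ?thesis unfolding a_def r'_def s_def t_def by simp
qed

lemma not_W12_loc:
  fixes f :: "complex \<Rightarrow> complex"
  assumes f: "\<And>z. z \<notin> E \<Longrightarrow> f z = prefun z" and fm: "f \<in> borel_measurable borel"
  shows "\<not> W12_loc UNIV f"
proof
  assume "W12_loc UNIV f"
  then obtain p q where p: "weak_derivative UNIV 1 f p" "locally_Lp 2 UNIV p"
    and q: "weak_derivative UNIV \<i> f q" "locally_Lp 2 UNIV q"
    by (auto simp: W12_loc_def)
  \<comment> \<open>Twice the weak conjugate complex derivative, the quantity that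
    \<open>disc_energy\<close> bounds from below.\<close>
  define g where "g z = p z + \<i> * q z" for z
  have pq: "p \<in> borel_measurable lebesgue" "q \<in> borel_measurable lebesgue"
    using p(2) q(2) by (auto simp: locally_Lp_def set_borel_measurable_def)
  hence gm: "g \<in> borel_measurable lebesgue" unfolding g_def[abs_def] by measurable
  have g2: "set_integrable lebesgue C (\<lambda>z. (norm (g z))\<^sup>2)" if C: "compact C" for C
  proof -
    have Cs: "C \<in> sets lebesgue" using lmeasurable_compact[OF C] by blast
    have "set_integrable lebesgue C (\<lambda>z. 2 * (norm (p z))\<^sup>2 + 2 * (norm (q z))\<^sup>2)"
      using p(2) q(2) C unfolding locally_Lp_def
      by (intro set_integral_add set_integrable_mult_right) auto
    thus ?thesis
      unfolding set_integrable_def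
    proof (rule Bochner_Integration.integrable_bound)
      show "(\<lambda>z. indicat_real C z *\<^sub>R (norm (g z))\<^sup>2) \<in> borel_measurable lebesgue"
        using gm Cs by measurable
      have "(norm (g z))\<^sup>2 \<le> 2 * (norm (p z))\<^sup>2 + 2 * (norm (q z))\<^sup>2" for z
      proof -
        have "(norm (g z))\<^sup>2 \<le> (norm (p z) + norm (q z))\<^sup>2"
          unfolding g_def using norm_triangle_ineq[of "p z" "\<i> * q z"] by (intro power_mono) (auto simp: norm_mult)
        also have "\<dots> \<le> 2 * (norm (p z))\<^sup>2 + 2 * (norm (q z))\<^sup>2"
          using sum_squares_bound[of "norm (p z)" "norm (q z)"] by (simp add: power2_sum)
        finally show ?thesis .
      qed
      thus "AE z in lebesgue. norm (indicat_real C z *\<^sub>R (norm (g z))\<^sup>2)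
          \<le> norm (indicat_real C z *\<^sub>R (2 * (norm (p z))\<^sup>2 + 2 * (norm (q z))\<^sup>2))"
        by (intro AE_I2) (auto simp: indicator_def)
    qed
  qed
  define G where "G n z = indicat_real (stage (K * \<kappa>) 0 n) z *\<^sub>R (norm (g z))\<^sup>2" for n z
  have Gi: "integrable lebesgue (G n)" for n
    using g2[OF compact_stage] unfolding set_integrable_def G_def .
  have lower: "pi \<le> integral\<^sup>L lebesgue (G n)" for n
  proof -
    define B where "B J j = cball (place (K * \<kappa>) 0 J j) (scale (K * \<kappa>) 0 J * R' n j)" for J j
    define X where "X J j = (LINT z:B J j|lebesgue. (norm (g z))\<^sup>2)" for J j
    have Bplace: "\<exists>y. norm y \<le> 1 \<and> dist j y \<le> R' n j \<and> z = place (K * \<kappa>) 0 J y"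
      if J: "J \<in> words 0 n" and j: "j \<in> I n" and z: "z \<in> B J j" for J j z
    proof -
      define s where "s = scale (K * \<kappa>) 0 J"
      have s: "0 < s" unfolding s_def by (rule scale_pos[OF J])
      define y where "y = (z - centre (K * \<kappa>) 0 J) / of_real s"
      have zy: "z = place (K * \<kappa>) 0 J y" using s by (simp add: y_def place_def s_def[symmetric])
      have "place (K * \<kappa>) 0 J j - z = of_real s * (j - y)" unfolding zy by (simp add: place_def s_def algebra_simps)
      hence "dist (place (K * \<kappa>) 0 J j) z = s * dist j y" using s by (simp add: dist_norm norm_mult)
      hence d: "dist j y \<le> R' n j" using z s by (simp add: B_def s_def[symmetric])
      have "norm y \<le> 1"
        using norm_centre[OF j] d norm_triangle_ineq[of "y - j" j] by (simp add: dist_norm norm_minus_commute)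
      thus ?thesis using d zy by blast
    qed
    \<comment> \<open>The discs \<open>B J j\<close> lie in stage \<open>n\<close> and are pairwise
      disjoint, since even the radii \<open>R'\<close> are separated; so their energies add up to at
      most that of the stage.\<close>
    have "(\<Sum>J\<in>words 0 n. \<Sum>j\<in>I n. indicat_real (B J j) z) \<le> indicat_real (stage (K * \<kappa>) 0 n) z" for z
    proof (cases "\<exists>J\<in>words 0 n. \<exists>j\<in>I n. z \<in> B J j")
      case False
      hence "(\<Sum>J\<in>words 0 n. \<Sum>j\<in>I n. indicat_real (B J j) z) = 0" by (intro sum.neutral ballI) auto
      thus ?thesis by simp
    next
      case True
      then obtain J0 j0 where J0: "J0 \<in> words 0 n" "j0 \<in> I n" "z \<in> B J0 j0" by blast
      obtain y0 where y0: "norm y0 \<le> 1" "dist j0 y0 \<le> R' n j0" "z = place (K * \<kappa>) 0 J0 y0"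
        using Bplace[OF J0] by blast
      have uniq: "J = J0 \<and> j = j0" if h: "J \<in> words 0 n" "j \<in> I n" "z \<in> B J j" for J j
      proof -
        obtain y where y: "norm y \<le> 1" "dist j y \<le> R' n j" "z = place (K * \<kappa>) 0 J y"
          using Bplace[OF h] by blast
        have eq: "place (K * \<kappa>) 0 J y = place (K * \<kappa>) 0 J0 y0" using y y0 by simp
        have JJ: "J = J0" by (rule place_inj[OF K\<kappa>(1) h(1) J0(1) y(1) y0(1) eq])
        hence "y = y0" using eq scale_pos[OF J0(1), of "K * \<kappa>"] by (simp add: place_def)
        hence "dist j j0 \<le> R' n j + R' n j0" using y(2) y0(2) dist_triangle[of j j0 y] by (simp add: dist_commute)
        hence "j = j0" using separated'[OF h(2) J0(2)] by fastforce
        thus ?thesis using JJ by simp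
      qed
      have "(\<Sum>J\<in>words 0 n. \<Sum>j\<in>I n. indicat_real (B J j) z)
          = (\<Sum>(J, j)\<in>words 0 n \<times> I n. indicat_real (B J j) z)" by (simp add: sum.cartesian_product)
      also have "\<dots> = (\<Sum>(J, j)\<in>{(J0, j0)}. indicat_real (B J j) z)"
      proof (rule sum.mono_neutral_right)
        show "{(J0, j0)} \<subseteq> words 0 n \<times> I n" using J0 by blast
        show "\<forall>x\<in>words 0 n \<times> I n - {(J0, j0)}. (case x of (J, j) \<Rightarrow> indicat_real (B J j) z) = 0"
          using uniq by (fastforce simp: indicator_def)
      qed simp
      also have "\<dots> \<le> 1" by simp
      also have "z \<in> stage (K * \<kappa>) 0 n"
        unfolding y0(3) stage_eq place_def using y0(1) by (intro UN_I[OF J0(1)] imageI) simp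
      hence "1 = indicat_real (stage (K * \<kappa>) 0 n) z" by simp
      finally show ?thesis .
    qed
    hence ptw: "(\<Sum>J\<in>words 0 n. \<Sum>j\<in>I n. indicat_real (B J j) z *\<^sub>R (norm (g z))\<^sup>2) \<le> G n z" for z
      unfolding G_def real_scaleR_def sum_distrib_right[symmetric] by (intro mult_right_mono) auto
    have Bi: "integrable lebesgue (\<lambda>z. indicat_real (B J j) z *\<^sub>R (norm (g z))\<^sup>2)" for J j
      using g2[of "B J j"] unfolding set_integrable_def by (simp add: B_def)
    \<comment> \<open>Cauchy-Schwarz for masses with sum 1 and squared scales with sum at most 1,
      obtained by summing \<open>2 * mass - scale^2 \<le> mass^2 / scale^2\<close>.\<close>
    have "1 \<le> (\<Sum>J\<in>words 0 n. (mass 0 J)\<^sup>2 / (scale \<kappa> 0 J)\<^sup>2)"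
    proof -
      have "(\<Sum>J\<in>words 0 n. (scale \<kappa> 0 J)\<^sup>2) \<le> 1"
        using sum_scale_square_le[of \<kappa> 0 n] power_le_one[of "1 / 9 :: real" n] by simp
      hence "1 \<le> (\<Sum>J\<in>words 0 n. 2 * mass 0 J - (scale \<kappa> 0 J)\<^sup>2)"
        by (simp add: sum_subtractf sum_distrib_left[symmetric] sum_mass)
      also have "\<dots> \<le> (\<Sum>J\<in>words 0 n. (mass 0 J)\<^sup>2 / (scale \<kappa> 0 J)\<^sup>2)"
      proof (rule sum_mono)
        fix J assume "J \<in> words 0 n"
        hence t: "0 < scale \<kappa> 0 J" by (rule scale_pos)
        have "0 \<le> (mass 0 J / scale \<kappa> 0 J - scale \<kappa> 0 J)\<^sup>2" by simp
        also have "\<dots> = (mass 0 J)\<^sup>2 / (scale \<kappa> 0 J)\<^sup>2 - 2 * mass 0 J + (scale \<kappa> 0 J)\<^sup>2"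
          using t by (simp add: power2_diff power_divide)
        finally show "2 * mass 0 J - (scale \<kappa> 0 J)\<^sup>2 \<le> (mass 0 J)\<^sup>2 / (scale \<kappa> 0 J)\<^sup>2" by simp
      qed
      finally show ?thesis .
    qed
    \<comment> \<open>Summing over \<open>j\<close> leaves the factor
      \<open>area n / (area n)^2 \<ge> 1\<close>.\<close>
    also have "\<dots> \<le> (\<Sum>J\<in>words 0 n. (\<Sum>j\<in>I n. (mass 0 J)\<^sup>2 * (R n j)\<^sup>2 / (scale \<kappa> 0 J * area n)\<^sup>2))"
    proof (rule sum_mono)
      fix J
      have "(\<Sum>j\<in>I n. (mass 0 J)\<^sup>2 * (R n j)\<^sup>2 / (scale \<kappa> 0 J * area n)\<^sup>2)
          = (mass 0 J)\<^sup>2 * area n / (scale \<kappa> 0 J * area n)\<^sup>2"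
        by (simp add: area_def sum_distrib_left sum_divide_distrib)
      also have "\<dots> = (mass 0 J)\<^sup>2 / (scale \<kappa> 0 J)\<^sup>2 * (1 / area n)"
        using area_pos[of n] by (simp add: power2_eq_square)
      also have "\<dots> \<ge> (mass 0 J)\<^sup>2 / (scale \<kappa> 0 J)\<^sup>2 * 1"
        using area_pos[of n] area_le_1[of n] by (intro mult_left_mono) auto
      finally show "(mass 0 J)\<^sup>2 / (scale \<kappa> 0 J)\<^sup>2 \<le> (\<Sum>j\<in>I n. (mass 0 J)\<^sup>2 * (R n j)\<^sup>2 / (scale \<kappa> 0 J * area n)\<^sup>2)"
        by simp
    qed
    finally have "pi * 1 \<le> pi * (\<Sum>J\<in>words 0 n. (\<Sum>j\<in>I n. (mass 0 J)\<^sup>2 * (R n j)\<^sup>2 / (scale \<kappa> 0 J * area n)\<^sup>2))"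
      by (intro mult_left_mono) auto
    also have "\<dots> = (\<Sum>J\<in>words 0 n. (\<Sum>j\<in>I n. pi * (mass 0 J)\<^sup>2 * (R n j)\<^sup>2 / (scale \<kappa> 0 J * area n)\<^sup>2))"
      by (simp add: sum_distrib_left mult.assoc)
    also have "\<dots> \<le> (\<Sum>J\<in>words 0 n. \<Sum>j\<in>I n. X J j)"
      unfolding X_def B_def by (intro sum_mono disc_energy[OF _ _ f fm p(1) q(1) g_def g2])
    also have "\<dots> = (LINT z|lebesgue. (\<Sum>J\<in>words 0 n. \<Sum>j\<in>I n. indicat_real (B J j) z *\<^sub>R (norm (g z))\<^sup>2))"
      unfolding X_def set_lebesgue_integral_def
      by (simp only: Bochner_Integration.integral_sum Bochner_Integration.integrable_sum Bi)
    also have "\<dots> \<le> integral\<^sup>L lebesgue (G n)"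
      by (intro integral_mono Bochner_Integration.integrable_sum Bi Gi ptw)
    finally show ?thesis by simp
  qed
  have "(\<lambda>n. integral\<^sup>L lebesgue (G n)) \<longlonglongrightarrow> integral\<^sup>L (lebesgue :: complex measure) (\<lambda>_. 0 :: real)"
  proof (rule integral_dominated_convergence[where w = "G 0"])
    show "AE z in lebesgue. (\<lambda>n. G n z) \<longlonglongrightarrow> 0"
      using AE_regular
    proof eventually_elim
      case (elim z)
      then obtain N where N: "z \<notin> stage (K * \<kappa>) 0 N" by (auto simp: limit_set_def)
      have "G n z = 0" if "n \<ge> N" for n
      proof -
        have "z \<notin> stage (K * \<kappa>) 0 n" using N stage_antimono[OF K\<kappa>(1) that] by blast
        thus ?thesis by (simp add: G_def)
      qed
      hence "\<forall>\<^sub>F n in sequentially. 0 = G n z" unfolding eventually_sequentially by metis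
      thus ?case by (rule Lim_transform_eventually[OF tendsto_const])
    qed
    show "AE z in lebesgue. norm (G n z) \<le> G 0 z" for n
    proof (rule AE_I2)
      fix z
      have "indicat_real (stage (K * \<kappa>) 0 n) z \<le> indicat_real (stage (K * \<kappa>) 0 0) z"
        using subsetD[OF stage_antimono[OF K\<kappa>(1) le0], of z 0 n] by (auto simp: indicator_def simp del: stage.simps)
      thus "norm (G n z) \<le> G 0 z" by (simp add: G_def mult_right_mono del: stage.simps)
    qed
  qed (use Gi in \<open>auto intro: borel_measurable_integrable\<close>)
  hence "pi \<le> integral\<^sup>L (lebesgue :: complex measure) (\<lambda>_. 0 :: real)" by (rule LIMSEQ_le_const) (use lower in blast)
  thus False using pi_gt_zero by simp
qed

lemma nonremovable_E:
  assumes \<kappa>1: "\<kappa> < 1"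
  shows "\<not> removable ((1 - \<kappa>) / (1 + K * \<kappa>)) K E"
proof -
  define \<alpha> where "\<alpha> = (1 - \<kappa>) / (1 + K * \<kappa>)"
  have \<alpha>: "0 < \<alpha>" unfolding \<alpha>_def using \<kappa>1 K\<kappa> by (intro divide_pos_pos) auto
  obtain M where M: "M \<ge> 0" "\<And>z w. z \<notin> E \<Longrightarrow> w \<notin> E \<Longrightarrow> dist z w \<le> 2 \<Longrightarrow>
    dist (prefun z) (prefun w) \<le> M * dist z w powr \<alpha>"
    using prefun_Hoelder[OF \<kappa>1] unfolding \<alpha>_def by blast
  obtain f where f: "continuous_on UNIV f" "\<And>z. z \<in> - E \<Longrightarrow> f z = prefun z" "Lip \<alpha> f"
    using Hoelder_extension[OF \<alpha> M(1) closure_compl_E, of prefun] M(2) by (metis ComplD)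
  have fE: "f z = prefun z" if "z \<notin> E" for z using f(2) that by simp
  have "quasiregular K (- E) f" by (rule quasiregular_off_E[OF f(1) fE])
  moreover have "\<not> quasiregular K UNIV f"
    using not_W12_loc[OF fE borel_measurable_continuous_onI[OF f(1)]] by (simp add: quasiregular_def)
  ultimately show ?thesis using f(3) unfolding removable_def \<alpha>_def by blast
qed

end

theorem theorem1p1:
  fixes \<alpha> K d :: real
  assumes "0 < \<alpha>" and "\<alpha> < 1" and "K \<ge> 1"
    and "d = 2 * ((1 + \<alpha> * K) / (1 + K))"
  shows "\<exists>E :: complex set. compact E \<and>
           0 < hausdorff_measure d E \<and> hausdorff_measure d E < \<infinity> \<and>
           \<not> removable \<alpha> K E"
proof -
  define \<kappa> where "\<kappa> = (1 - \<alpha>) / (1 + \<alpha> * K)"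
  have D: "1 + \<alpha> * K > 0" using assms by (simp add: add_pos_nonneg)
  have aK: "0 < \<alpha> * K" using assms by simp
  have kappa: "0 < \<kappa>" "\<kappa> < 1"
    unfolding \<kappa>_def pos_divide_less_eq[OF D] using assms(1,2) aK divide_pos_pos[OF _ D, of "1 - \<alpha>"] by auto
  have k1: "1 + K * \<kappa> = (1 + K) / (1 + \<alpha> * K)" "1 - \<kappa> = \<alpha> * (1 + K) / (1 + \<alpha> * K)"
    using D by (auto simp: \<kappa>_def field_simps)
  have \<alpha>: "(1 - \<kappa>) / (1 + K * \<kappa>) = \<alpha>" unfolding k1 using D assms by simp
  have d: "2 / (1 + K * \<kappa>) = d" unfolding k1 assms(4) using D assms by simp
  \<comment> \<open>Radii up to \<open>\<rho>\<close> satisfy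
    \<open>R powr \<kappa> \<le> 1/3\<close>, the condition \<open>R_small\<close>.\<close>
  define \<rho> where "\<rho> = (1 / 3 :: real) powr (1 / \<kappa>)"
  have \<rho>: "0 < \<rho>" "\<rho> powr \<kappa> = 1 / 3" using kappa by (auto simp: \<rho>_def powr_powr)
  define \<tau> where "\<tau> k = exp (- ((1 / 2 :: real) ^ Suc k))" for k
  \<comment> \<open>The range demanded by \<open>disc_packing\<close>:
    \<open>exp (- x) \<ge> 1 - x\<close> with \<open>x \<le> 1/2\<close> gives a value of at least
    1/2.\<close>
  have \<tau>: "1 / 4 \<le> \<tau> k" "\<tau> k < 1" for k
  proof -
    have "(1 / 2 :: real) ^ Suc k \<le> 1 / 2" using power_decreasing[of 1 "Suc k" "1 / 2 :: real"] by simp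
    thus "1 / 4 \<le> \<tau> k" using exp_ge_add_one_self[of "- ((1 / 2 :: real) ^ Suc k)"] unfolding \<tau>_def by linarith
    show "\<tau> k < 1" unfolding \<tau>_def by simp
  qed
  \<comment> \<open>Centres and both families of radii are bundled into one triple, so that a single
    choice over all \<open>k\<close> yields them together.\<close>
  define good where "good k X \<longleftrightarrow> (case X of (I, R, R') \<Rightarrow> finite I \<and>
     (\<forall>p\<in>I. 0 < R p \<and> R p < R' p \<and> R' p \<le> 2 * R p \<and> norm p + R' p \<le> 1 \<and> R p \<le> \<rho>) \<and>
     (\<forall>p\<in>I. \<forall>q\<in>I. p \<noteq> q \<longrightarrow> R' p + R' q < dist p q) \<and> \<tau> k \<le> (\<Sum>p\<in>I. (R p)\<^sup>2))"
    for k :: nat and X :: "complex set \<times> (complex \<Rightarrow> real) \<times> (complex \<Rightarrow> real)"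
  have "\<forall>k. \<exists>X. good k X"
    using disc_packing[OF \<tau> \<rho>(1)] unfolding good_def by fastforce
  then obtain X where X: "\<And>k. good k (X k)" by metis
  define I R R' where "I k = fst (X k)" and "R k = fst (snd (X k))" and "R' k = snd (snd (X k))" for k
  have P: "finite (I k)"
     "\<And>p. p \<in> I k \<Longrightarrow> 0 < R k p \<and> R k p < R' k p \<and> R' k p \<le> 2 * R k p \<and> norm p + R' k p \<le> 1 \<and> R k p \<le> \<rho>"
     "\<And>p q. p \<in> I k \<Longrightarrow> q \<in> I k \<Longrightarrow> p \<noteq> q \<Longrightarrow> R' k p + R' k q < dist p q"
     "\<tau> k \<le> (\<Sum>p\<in>I k. (R k p)\<^sup>2)" for k
    using X[of k] unfolding good_def I_def R_def R'_def case_prod_beta by blast+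
  interpret disc_packings I R R' \<kappa> K
  proof
    show "R k p powr \<kappa> \<le> 1 / 3" if "p \<in> I k" for p k
      unfolding \<rho>(2)[symmetric] using P(2)[OF that] kappa by (intro powr_mono2) auto
    show "exp (- ((1 / 2) ^ Suc k)) \<le> (\<Sum>p\<in>I k. (R k p)\<^sup>2)" for k using P(4)[of k] unfolding \<tau>_def .
  qed (use P assms kappa in auto)
  have "compact E" by (rule compact_limit_set)
  moreover have "0 < hausdorff_measure d E" using hausdorff_measure_limit_set_pos[OF K\<kappa>(1)] unfolding d .
  moreover have "hausdorff_measure d E < \<infinity>"
    using hausdorff_measure_limit_set_le[OF K\<kappa>(1)] unfolding d by (rule le_less_trans) simp
  moreover have "\<not> removable \<alpha> K E" using nonremovable_E[OF kappa(2)] unfolding \<alpha> .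
  ultimately show ?thesis by blast
qed

end
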